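(* Let $\phi=B_1+\overline{\mu\, B_2\circ B_1}$ where $\mu\in\mathbb{C}$ and $B_1,B_2$ are finite Blaschke products. Then the following assertions are equivalent: (a) $T_\phi$ is complex symmetric. (b) $T_\phi$ is UET. (c) $\mu B_2=q\varphi_b$ for some $q\in\mathbb{T}$ and $b\in\mathbb{D}$ satisfying $qb=\bar b$.
   Context: $\mathbb{D}$ is the open unit disk in $\mathbb{C}$, $\mathbb{T}$ its boundary with normalized Haar measure $\sigma$. $H^2$ is the Hardy space of $\mathbb{D}$, identified via boundary functions with a closed subspace of $L^2(\mathbb{T},\sigma)$; $P:L^2\to H^2$ is the orthogonal projection. For $\phi\in L^\infty(\mathbb{T})$, the Toeplitz operator is $T_\phi f=P(\phi f)$ for $f\in H^2$. A conjugation on a Hilbert space $\mathcal{H}$ is a conjugate-linear map $C:\mathcal{H}\to\mathcal{H}$ with $C^2=I$ and $\langle Cx,Cy\rangle=\langle y,x\rangle$ for all $x,y$. A bounded operator $T$ is complex symmetric if $CTC=T^*$ for some conjugation $C$ on $\mathcal{H}$. A bounded operator $T$ is called UET if $T$ is unitarily equivalent to $CT^*C$ for some conjugation $C$ on $\mathcal{H}$. For $a\in\mathbb{D}$, $\varphi_a(z)=\frac{a-z}{1-\bar az}$. A finite Blaschke product is a function of the form $\gamma\varphi_{a_1}\varphi_{a_2}\cdots\varphi_{a_N}$ with $N\ge1$, $\gamma\in\mathbb{T}$ and $a_j\in\mathbb{D}$. *)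

theory Defs
  imports "HOL-Analysis.Analysis"
begin

section \<open>Complex inner product spaces\<close>

text \<open>The complex inner product is linear in the first argument. The underlying real inner product
  is its real part, so norm and topology are those of the class \<open>real_inner\<close>.\<close>

class complex_inner = real_inner +
  fixes scaleC :: "complex \<Rightarrow> 'a \<Rightarrow> 'a"  (infixr "*\<^sub>C" 75)
    and cinner :: "'a \<Rightarrow> 'a \<Rightarrow> complex"
  assumes scaleC_add_right: "c *\<^sub>C (x + y) = c *\<^sub>C x + c *\<^sub>C y"
    and scaleC_add_left: "(c + d) *\<^sub>C x = c *\<^sub>C x + d *\<^sub>C x"
    and scaleC_scaleC: "c *\<^sub>C d *\<^sub>C x = (c * d) *\<^sub>C x"
    and scaleC_one: "1 *\<^sub>C x = x"
    and scaleR_scaleC: "r *\<^sub>R x = complex_of_real r *\<^sub>C x"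
    and cinner_commute: "cinner x y = cnj (cinner y x)"
    and cinner_add_left: "cinner (x + y) z = cinner x z + cinner y z"
    and cinner_scaleC_left: "cinner (c *\<^sub>C x) y = c * cinner x y"
    and inner_eq_Re_cinner: "inner x y = Re (cinner x y)"

section \<open>Operators on a subspace\<close>

text \<open>A Hilbert space is given as a closed subspace \<open>H\<close> of a complex inner product space; operators
  on it are functions on the ambient type of which only the values on \<open>H\<close> matter.\<close>

definition linear_on_sub :: "'a::complex_inner set \<Rightarrow> ('a \<Rightarrow> 'a) \<Rightarrow> bool" where
  "linear_on_sub H T \<longleftrightarrow>
     (\<forall>x\<in>H. T x \<in> H) \<and>
     (\<forall>x\<in>H. \<forall>y\<in>H. T (x + y) = T x + T y) \<and>
     (\<forall>c. \<forall>x\<in>H. T (c *\<^sub>C x) = c *\<^sub>C T x)"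

definition bounded_op_on :: "'a::complex_inner set \<Rightarrow> ('a \<Rightarrow> 'a) \<Rightarrow> bool" where
  "bounded_op_on H T \<longleftrightarrow> linear_on_sub H T \<and> (\<exists>K. \<forall>x\<in>H. norm (T x) \<le> K * norm x)"

definition adjoint_on :: "'a::complex_inner set \<Rightarrow> ('a \<Rightarrow> 'a) \<Rightarrow> 'a \<Rightarrow> 'a" where
  "adjoint_on H T y = (THE z. z \<in> H \<and> (\<forall>x\<in>H. cinner (T x) y = cinner x z))"

definition unitary_on :: "'a::complex_inner set \<Rightarrow> ('a \<Rightarrow> 'a) \<Rightarrow> bool" where
  "unitary_on H U \<longleftrightarrow>
     linear_on_sub H U \<and> U ` H = H \<and> (\<forall>x\<in>H. \<forall>y\<in>H. cinner (U x) (U y) = cinner x y)"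

definition unitarily_equivalent_on ::
    "'a::complex_inner set \<Rightarrow> ('a \<Rightarrow> 'a) \<Rightarrow> ('a \<Rightarrow> 'a) \<Rightarrow> bool" where
  "unitarily_equivalent_on H T S \<longleftrightarrow> (\<exists>U. unitary_on H U \<and> (\<forall>x\<in>H. U (T x) = S (U x)))"

definition conjugation_on :: "'a::complex_inner set \<Rightarrow> ('a \<Rightarrow> 'a) \<Rightarrow> bool" where
  "conjugation_on H C \<longleftrightarrow>
     (\<forall>x\<in>H. C x \<in> H) \<and>
     (\<forall>x\<in>H. \<forall>y\<in>H. C (x + y) = C x + C y) \<and>
     (\<forall>c. \<forall>x\<in>H. C (c *\<^sub>C x) = cnj c *\<^sub>C C x) \<and>
     (\<forall>x\<in>H. C (C x) = x) \<and>
     (\<forall>x\<in>H. \<forall>y\<in>H. cinner (C x) (C y) = cinner y x)"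

definition complex_symmetric_on :: "'a::complex_inner set \<Rightarrow> ('a \<Rightarrow> 'a) \<Rightarrow> bool" where
  "complex_symmetric_on H T \<longleftrightarrow>
     bounded_op_on H T \<and>
     (\<exists>C. conjugation_on H C \<and> (\<forall>x\<in>H. C (T (C x)) = adjoint_on H T x))"

definition UET_on :: "'a::complex_inner set \<Rightarrow> ('a \<Rightarrow> 'a) \<Rightarrow> bool" where
  "UET_on H T \<longleftrightarrow>
     bounded_op_on H T \<and>
     (\<exists>C. conjugation_on H C \<and> unitarily_equivalent_on H T (\<lambda>x. C (adjoint_on H T (C x))))"

definition orth_proj :: "'a::complex_inner set \<Rightarrow> 'a \<Rightarrow> 'a" where
  "orth_proj H x = (THE y. y \<in> H \<and> (\<forall>z\<in>H. cinner (x - y) z = 0))"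

section \<open>The space \<open>L\<^sup>2\<close> of the unit circle\<close>

definition circle_measure :: "complex measure" where
  "circle_measure = distr (uniform_measure lborel {0..<2*pi}) (restrict_space borel (sphere 0 1)) cis"

definition sq_integrable :: "(complex \<Rightarrow> complex) \<Rightarrow> bool" where
  "sq_integrable f \<longleftrightarrow>
     f \<in> borel_measurable circle_measure \<and> integrable circle_measure (\<lambda>z. (norm (f z))\<^sup>2)"

lemma sq_integrable_measurable: "sq_integrable f \<Longrightarrow> f \<in> borel_measurable circle_measure"
  by (simp add: sq_integrable_def)

lemma sq_integrable_zero: "sq_integrable (\<lambda>z. 0)"
  by (simp add: sq_integrable_def)

lemma sq_integrable_add:
  assumes "sq_integrable f" "sq_integrable g"
  shows "sq_integrable (\<lambda>z. f z + g z)"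
  unfolding sq_integrable_def
proof
  have [measurable]: "f \<in> borel_measurable circle_measure" "g \<in> borel_measurable circle_measure"
    using assms by (auto simp: sq_integrable_def)
  show "(\<lambda>z. f z + g z) \<in> borel_measurable circle_measure"
    by measurable
  have "integrable circle_measure (\<lambda>z. 2 * (norm (f z))\<^sup>2 + 2 * (norm (g z))\<^sup>2)"
    using assms by (auto simp: sq_integrable_def)
  then show "integrable circle_measure (\<lambda>z. (norm (f z + g z))\<^sup>2)"
  proof (rule Bochner_Integration.integrable_bound)
    show "AE z in circle_measure. norm ((norm (f z + g z))\<^sup>2)
        \<le> norm (2 * (norm (f z))\<^sup>2 + 2 * (norm (g z))\<^sup>2)"
    proof (rule AE_I2)
      fix z
      have "(norm (f z + g z))\<^sup>2 \<le> (norm (f z) + norm (g z))\<^sup>2"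
        by (simp add: norm_triangle_ineq power_mono)
      also have "\<dots> \<le> 2 * (norm (f z))\<^sup>2 + 2 * (norm (g z))\<^sup>2"
        using sum_squares_bound[of "norm (f z)" "norm (g z)"] by (simp add: power2_sum)
      finally show "norm ((norm (f z + g z))\<^sup>2) \<le> norm (2 * (norm (f z))\<^sup>2 + 2 * (norm (g z))\<^sup>2)"
        by simp
    qed
  qed measurable
qed

lemma sq_integrable_mult_bounded:
  assumes "sq_integrable f" and [measurable]: "h \<in> borel_measurable circle_measure"
    and "AE z in circle_measure. norm (h z) \<le> K"
  shows "sq_integrable (\<lambda>z. h z * f z)"
  unfolding sq_integrable_def
proof
  have [measurable]: "f \<in> borel_measurable circle_measure"
    using assms by (auto simp: sq_integrable_def)
  show "(\<lambda>z. h z * f z) \<in> borel_measurable circle_measure"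
    by measurable
  have "integrable circle_measure (\<lambda>z. K\<^sup>2 * (norm (f z))\<^sup>2)"
    using assms by (auto simp: sq_integrable_def)
  then show "integrable circle_measure (\<lambda>z. (norm (h z * f z))\<^sup>2)"
  proof (rule Bochner_Integration.integrable_bound)
    show "AE z in circle_measure. norm ((norm (h z * f z))\<^sup>2) \<le> norm (K\<^sup>2 * (norm (f z))\<^sup>2)"
      using assms(3)
    proof eventually_elim
      case (elim z)
      then have "(norm (h z))\<^sup>2 \<le> K\<^sup>2"
        by (simp add: power_mono)
      then show ?case
        by (simp add: norm_mult power_mult_distrib mult_right_mono)
    qed
  qed measurable
qed

lemma sq_integrable_cmult: "sq_integrable f \<Longrightarrow> sq_integrable (\<lambda>z. c * f z)"
  by (rule sq_integrable_mult_bounded[where K = "norm c"]) auto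

lemma borel_measurable_cnj [measurable]: "cnj \<in> borel_measurable borel"
  by (intro borel_measurable_continuous_onI continuous_intros)

lemma integrable_mult_cnj:
  assumes "sq_integrable f" "sq_integrable g"
  shows "integrable circle_measure (\<lambda>z. f z * cnj (g z))"
proof -
  have [measurable]: "f \<in> borel_measurable circle_measure" "g \<in> borel_measurable circle_measure"
    using assms by (auto simp: sq_integrable_def)
  have "integrable circle_measure (\<lambda>z. (norm (f z))\<^sup>2 + (norm (g z))\<^sup>2)"
    using assms by (auto simp: sq_integrable_def)
  then show ?thesis
  proof (rule Bochner_Integration.integrable_bound)
    show "AE z in circle_measure. norm (f z * cnj (g z)) \<le> norm ((norm (f z))\<^sup>2 + (norm (g z))\<^sup>2)"
    proof (rule AE_I2)
      fix z
      have "0 \<le> norm (f z) * norm (g z)"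
        by simp
      with sum_squares_bound[of "norm (f z)" "norm (g z)"]
      have "norm (f z) * norm (g z) \<le> (norm (f z))\<^sup>2 + (norm (g z))\<^sup>2"
        by linarith
      then show "norm (f z * cnj (g z)) \<le> norm ((norm (f z))\<^sup>2 + (norm (g z))\<^sup>2)"
        by (simp add: norm_mult)
    qed
  qed measurable
qed

definition L2_rel :: "(complex \<Rightarrow> complex) \<Rightarrow> (complex \<Rightarrow> complex) \<Rightarrow> bool" where
  "L2_rel f g \<longleftrightarrow> sq_integrable f \<and> sq_integrable g \<and> (AE z in circle_measure. f z = g z)"

quotient_type circle_L2 = "complex \<Rightarrow> complex" / partial: L2_rel
proof (rule part_equivpI)
  show "\<exists>f. L2_rel f f"
    using sq_integrable_zero by (auto simp: L2_rel_def)
  show "symp L2_rel"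
    by (auto simp: symp_def L2_rel_def elim: AE_mp)
  show "transp L2_rel"
    unfolding transp_def L2_rel_def
  proof (intro allI impI, elim conjE, intro conjI)
    fix f g h
    assume "AE z in circle_measure. f z = g z" "AE z in circle_measure. g z = h z"
    then show "AE z in circle_measure. f z = h z"
      by eventually_elim simp
  qed
qed

instantiation circle_L2 :: complex_inner
begin

lift_definition zero_circle_L2 :: circle_L2 is "\<lambda>z. 0"
  by (simp add: L2_rel_def sq_integrable_zero)

lift_definition plus_circle_L2 :: "circle_L2 \<Rightarrow> circle_L2 \<Rightarrow> circle_L2" is "\<lambda>f g z. f z + g z"
  by (auto simp: L2_rel_def sq_integrable_add elim: AE_mp)

lift_definition scaleC_circle_L2 :: "complex \<Rightarrow> circle_L2 \<Rightarrow> circle_L2" is "\<lambda>c f z. c * f z"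
  by (auto simp: L2_rel_def sq_integrable_cmult elim: AE_mp)

lift_definition cinner_circle_L2 :: "circle_L2 \<Rightarrow> circle_L2 \<Rightarrow> complex"
  is "\<lambda>f g. LINT z|circle_measure. f z * cnj (g z)"
proof -
  fix f f' g g'
  assume "L2_rel f f'" "L2_rel g g'"
  then show "(LINT z|circle_measure. f z * cnj (g z)) = (LINT z|circle_measure. f' z * cnj (g' z))"
    using integrable_mult_cnj
    by (intro integral_cong_AE) (auto simp: L2_rel_def intro: borel_measurable_integrable)
qed

definition uminus_circle_L2 :: "circle_L2 \<Rightarrow> circle_L2" where
  "uminus_circle_L2 x = (-1) *\<^sub>C x"

definition minus_circle_L2 :: "circle_L2 \<Rightarrow> circle_L2 \<Rightarrow> circle_L2" where
  "minus_circle_L2 x y = x + (- y)"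

definition scaleR_circle_L2 :: "real \<Rightarrow> circle_L2 \<Rightarrow> circle_L2" where
  "scaleR_circle_L2 r x = complex_of_real r *\<^sub>C x"

definition inner_circle_L2 :: "circle_L2 \<Rightarrow> circle_L2 \<Rightarrow> real" where
  "inner_circle_L2 x y = Re (cinner x y)"

definition norm_circle_L2 :: "circle_L2 \<Rightarrow> real" where
  "norm_circle_L2 x = sqrt (inner x x)"

definition sgn_circle_L2 :: "circle_L2 \<Rightarrow> circle_L2" where
  "sgn_circle_L2 x = inverse (norm x) *\<^sub>R x"

definition dist_circle_L2 :: "circle_L2 \<Rightarrow> circle_L2 \<Rightarrow> real" where
  "dist_circle_L2 x y = norm (x - y)"

definition uniformity_circle_L2 :: "(circle_L2 \<times> circle_L2) filter" where
  "uniformity_circle_L2 = (INF e\<in>{0<..}. principal {(x, y). dist x y < e})"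

definition open_circle_L2 :: "circle_L2 set \<Rightarrow> bool" where
  "open_circle_L2 U \<longleftrightarrow> (\<forall>x\<in>U. \<forall>\<^sub>F (x', y) in uniformity. x' = x \<longrightarrow> y \<in> U)"

instance
proof
  fix x y z :: circle_L2 and c d :: complex and r s :: real
  have add_left: "cinner (x + y) z = cinner x z + cinner y z" for x y z :: circle_L2
    by transfer (simp add: L2_rel_def ring_distribs integrable_mult_cnj Bochner_Integration.integral_add)
  have scale_left: "cinner (c *\<^sub>C x) y = c * cinner x y" for c and x y :: circle_L2
    by transfer (simp add: L2_rel_def mult.assoc)
  have commute: "cinner x y = cnj (cinner y x)" for x y :: circle_L2
    by transfer (simp add: mult.commute flip: Bochner_Integration.integral_cnj)
  have pos: "inner x x \<ge> 0" for x :: circle_L2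
    unfolding inner_circle_L2_def
  proof transfer
    fix f assume "L2_rel f f"
    then have "Re (LINT z|circle_measure. f z * cnj (f z))
        = (LINT z|circle_measure. Re (f z * cnj (f z)))"
      by (intro integral_Re[symmetric] integrable_mult_cnj) (auto simp: L2_rel_def)
    then show "0 \<le> Re (LINT z|circle_measure. f z * cnj (f z))"
      by simp
  qed
  have add_right: "c *\<^sub>C (x + y) = c *\<^sub>C x + c *\<^sub>C y" for c and x y :: circle_L2
    by transfer (simp add: L2_rel_def ring_distribs sq_integrable_add sq_integrable_cmult)
  have add_scal: "(c + d) *\<^sub>C x = c *\<^sub>C x + d *\<^sub>C x" for c d and x :: circle_L2
    by transfer (simp add: L2_rel_def ring_distribs sq_integrable_add sq_integrable_cmult)
  have scal_scal: "c *\<^sub>C d *\<^sub>C x = (c * d) *\<^sub>C x" for c d and x :: circle_L2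
    by transfer (simp add: L2_rel_def mult.assoc sq_integrable_cmult)
  have one: "1 *\<^sub>C x = x" for x :: circle_L2
    by transfer (simp add: L2_rel_def)
  show "x + y + z = x + (y + z)"
    by transfer (simp add: L2_rel_def add.assoc sq_integrable_add)
  show "x + y = y + x"
    by transfer (simp add: L2_rel_def add.commute sq_integrable_add)
  show "0 + x = x"
    by transfer (simp add: L2_rel_def)
  show "- x + x = 0"
    unfolding uminus_circle_L2_def
    by transfer (simp add: L2_rel_def sq_integrable_zero)
  show "x - y = x + - y"
    by (rule minus_circle_L2_def)
  show "r *\<^sub>R (x + y) = r *\<^sub>R x + r *\<^sub>R y" "(r + s) *\<^sub>R x = r *\<^sub>R x + s *\<^sub>R x"
    "r *\<^sub>R s *\<^sub>R x = (r * s) *\<^sub>R x" "1 *\<^sub>R x = x"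
    by (simp_all add: scaleR_circle_L2_def add_right add_scal scal_scal one)
  show "dist x y = norm (x - y)" "sgn x = inverse (norm x) *\<^sub>R x"
    by (rule dist_circle_L2_def sgn_circle_L2_def)+
  show "(uniformity :: (circle_L2 \<times> circle_L2) filter)
      = (INF e\<in>{0<..}. principal {(x, y). dist x y < e})"
    by (rule uniformity_circle_L2_def)
  show "open U \<longleftrightarrow> (\<forall>x\<in>U. \<forall>\<^sub>F (x', y) in uniformity. x' = x \<longrightarrow> y \<in> U)" for U :: "circle_L2 set"
    by (rule open_circle_L2_def)
  show "inner x y = inner y x"
    unfolding inner_circle_L2_def by (subst commute) simp
  show "inner (x + y) z = inner x z + inner y z"
    by (simp add: inner_circle_L2_def add_left)
  show "inner (r *\<^sub>R x) y = r * inner x y"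
    by (simp add: inner_circle_L2_def scaleR_circle_L2_def scale_left)
  show "0 \<le> inner x x"
    by (rule pos)
  show "inner x x = 0 \<longleftrightarrow> x = 0"
    unfolding inner_circle_L2_def
  proof transfer
    fix f assume "L2_rel f f"
    then have f: "sq_integrable f" by (simp add: L2_rel_def)
    then have [measurable]: "f \<in> borel_measurable circle_measure"
      by (rule sq_integrable_measurable)
    have "Re (LINT z|circle_measure. f z * cnj (f z))
        = (LINT z|circle_measure. (norm (f z))\<^sup>2)"
      using f integrable_mult_cnj[OF f f]
      by (simp add: integral_Re[symmetric] complex_norm_square[symmetric] flip: of_real_power)
    also have "\<dots> = 0 \<longleftrightarrow> (AE z in circle_measure. f z = 0)"
      using f by (subst integral_nonneg_eq_0_iff_AE) (auto simp: sq_integrable_def)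
    finally show "Re (LINT z|circle_measure. f z * cnj (f z)) = 0 \<longleftrightarrow> L2_rel f (\<lambda>z. 0)"
      using f by (simp add: L2_rel_def sq_integrable_zero)
  qed
  show "norm x = sqrt (inner x x)"
    by (rule norm_circle_L2_def)
  show "c *\<^sub>C (x + y) = c *\<^sub>C x + c *\<^sub>C y" "(c + d) *\<^sub>C x = c *\<^sub>C x + d *\<^sub>C x"
    "c *\<^sub>C d *\<^sub>C x = (c * d) *\<^sub>C x" "1 *\<^sub>C x = x"
    by (rule add_right add_scal scal_scal one)+
  show "r *\<^sub>R x = complex_of_real r *\<^sub>C x"
    by (rule scaleR_circle_L2_def)
  show "cinner x y = cnj (cinner y x)" "cinner (x + y) z = cinner x z + cinner y z"
    "cinner (c *\<^sub>C x) y = c * cinner x y"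
    by (rule commute add_left scale_left)+
  show "inner x y = Re (cinner x y)"
    by (rule inner_circle_L2_def)
qed

end

text \<open>The class of a square integrable function; \<open>0\<close> if the function is not square integrable.\<close>

lift_definition L2_class :: "(complex \<Rightarrow> complex) \<Rightarrow> circle_L2"
  is "\<lambda>f. if sq_integrable f then f else (\<lambda>z. 0)"
  by (simp add: L2_rel_def sq_integrable_zero)

definition Linfty :: "(complex \<Rightarrow> complex) set" where
  "Linfty = {\<phi> \<in> borel_measurable circle_measure. \<exists>K. AE z in circle_measure. norm (\<phi> z) \<le> K}"

text \<open>Multiplication by an essentially bounded function; it is \<open>0\<close> for all other functions.\<close>

lift_definition mult_L2 :: "(complex \<Rightarrow> complex) \<Rightarrow> circle_L2 \<Rightarrow> circle_L2"
  is "\<lambda>\<phi> f z. if \<phi> \<in> Linfty then \<phi> z * f z else 0"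
proof -
  fix \<phi> f g
  assume fg: "L2_rel f g"
  show "L2_rel (\<lambda>z. if \<phi> \<in> Linfty then \<phi> z * f z else 0) (\<lambda>z. if \<phi> \<in> Linfty then \<phi> z * g z else 0)"
  proof (cases "\<phi> \<in> Linfty")
    case True
    then show ?thesis
      using fg by (auto simp: L2_rel_def Linfty_def intro: sq_integrable_mult_bounded elim: AE_mp)
  qed (simp add: L2_rel_def sq_integrable_zero)
qed

section \<open>The Hardy space and Toeplitz operators\<close>

definition Hardy_disc :: "(complex \<Rightarrow> complex) set" where
  "Hardy_disc = {f. f holomorphic_on ball 0 1 \<and>
     bdd_above ((\<lambda>r::real. LINT w|circle_measure. (norm (f (r * w)))\<^sup>2) ` {0..<1})}"

text \<open>The boundary function of \<open>f\<close> is the \<open>L\<^sup>2\<close>-limit of the dilations of \<open>f\<close>, which are defined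
  on the circle for \<open>0 \<le> r < 1\<close>.\<close>

definition boundary_function :: "(complex \<Rightarrow> complex) \<Rightarrow> circle_L2 \<Rightarrow> bool" where
  "boundary_function f g \<longleftrightarrow> ((\<lambda>r::real. L2_class (\<lambda>w. f (r * w))) \<longlongrightarrow> g) (at_left 1)"

definition Hardy_circle :: "circle_L2 set" where
  "Hardy_circle = {g. \<exists>f\<in>Hardy_disc. boundary_function f g}"

definition toeplitz :: "(complex \<Rightarrow> complex) \<Rightarrow> circle_L2 \<Rightarrow> circle_L2" where
  "toeplitz \<phi> f = orth_proj Hardy_circle (mult_L2 \<phi> f)"

section \<open>Finite Blaschke products\<close>

definition disc_aut :: "complex \<Rightarrow> complex \<Rightarrow> complex" where
  "disc_aut a z = (a - z) / (1 - cnj a * z)"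

text \<open>A Blaschke product is a function on the closed disc, which contains no poles; the values of
  the total function \<open>B\<close> elsewhere do not matter.\<close>

definition finite_blaschke :: "(complex \<Rightarrow> complex) \<Rightarrow> bool" where
  "finite_blaschke B \<longleftrightarrow>
     (\<exists>\<gamma> as. norm \<gamma> = 1 \<and> as \<noteq> [] \<and> set as \<subseteq> ball 0 1 \<and>
        (\<forall>z\<in>cball 0 1. B z = \<gamma> * (\<Prod>a\<leftarrow>as. disc_aut a z)))"

end

theory Submission
  imports Defs "HOL-Complex_Analysis.Complex_Analysis"
begin

text \<open>
  Let \<open>V\<close> and \<open>A\<close> be multiplication by \<open>B1\<close> and by \<open>\<mu> * (B2 \<circ> B1)\<close> on the Hardy space, so that
  \<open>T = V + A\<^sup>*\<close> and \<open>T\<^sup>* = V\<^sup>* + A\<close>. The operator \<open>V\<close> is an isometry, \<open>A\<close> is \<open>\<mu>\<close> times an isometry,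
  and the two commute. Complex symmetry gives \<open>T = C T\<^sup>* C\<close>, so (a) implies (b) with the identity as
  unitary operator.

  If \<open>T\<close> is UET, composing the unitary operator with the conjugation gives an antiunitary \<open>W\<close>
  with \<open>W T = T\<^sup>* W\<close> and \<open>W T\<^sup>* = T W\<close>. This determines \<open>\<mu> * B2\<close> in three steps. If \<open>\<bar>\<mu>\<bar> < 1\<close>, then
  \<open>T\<close> is a small perturbation of an isometry and hence injective, while \<open>T\<^sup>*\<close> kills a nonzero vector
  that can be written down; for \<open>\<bar>\<mu>\<bar> > 1\<close> the roles are exchanged. As \<open>W\<close> identifies the two
  kernels, \<open>\<bar>\<mu>\<bar> = 1\<close> (\<open>norm_coefficient_eq_1\<close>). Now the self-commutator \<open>T\<^sup>* T - T T\<^sup>*\<close> is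
  \<open>D = A A\<^sup>* - V V\<^sup>*\<close>, the difference of the projections onto the kernels of \<open>V\<^sup>*\<close> and \<open>A\<^sup>*\<close>, and
  \<open>W D = - D W\<close>. If \<open>B2\<close> had two zeros, some nonzero vector would be both in the range of \<open>V\<close> and in
  the kernel of \<open>A\<^sup>*\<close>, an eigenvector of \<open>D\<close> for \<open>-1\<close>; but its image under \<open>W\<close> would be in the kernel
  of \<open>V\<^sup>*\<close> and in the range of \<open>A\<close>, which meet only in \<open>0\<close> (\<open>degree_less_2\<close>). So \<open>\<mu> * B2\<close> is
  \<open>q * disc_aut b\<close>. If \<open>b \<noteq> 0\<close>, then \<open>D\<close> has the eigenvalues \<open>\<bar>b\<bar>\<close> and \<open>- \<bar>b\<bar>\<close> with explicit
  eigenvectors, which \<open>W\<close> exchanges; comparing the values of the quadratic form of \<open>T\<close> on them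
  yields \<open>q * b = cnj b\<close> (\<open>degree_1_symmetry\<close>).

  Conversely, for \<open>A = q * disc_aut b (V)\<close> it suffices to find a conjugation \<open>C\<close> with
  \<open>C V C = A\<close>, because then \<open>C A\<^sup>* C = V\<^sup>*\<close> and \<open>C T C = T\<^sup>*\<close>. It is prescribed on the Szego kernels \<open>k z\<close>:
  \<open>C (k z)\<close> is an explicit function \<open>G z\<close>. Such a prescription extends to a conjugation as soon as
  \<open>\<langle>G z, G w\<rangle> = \<langle>k w, k z\<rangle>\<close> and \<open>G z w = G w z\<close> (\<open>conjugation_from_total_family\<close>); the symmetry is
  where \<open>q * b = cnj b\<close> enters (\<open>conjugation_intertwining_adjoint\<close>).

  Two analytic facts support this. The space \<open>L\<^sup>2\<close> of the circle is complete, so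
  projections exist. The Hardy space is the closure of the disc algebra, that is, of the functions
  continuous on the closed disc and holomorphic inside, so that Cauchy's formula makes the Szego
  kernels reproducing on all of it.
\<close>


section \<open>Geometry of complex inner product spaces\<close>

lemma cinner_add_right: "cinner x (y + z) = cinner x y + cinner x z"
  by (subst (1 2 3) cinner_commute) (simp add: cinner_add_left)

lemma cinner_scaleC_right: "cinner x (c *\<^sub>C y) = cnj c * cinner x y"
  by (subst (1 2) cinner_commute) (simp add: cinner_scaleC_left)

lemma scaleC_minus_one: "(-1) *\<^sub>C x = - x"
  using scaleR_scaleC[of "-1" x] by simp

lemma cinner_minus_left: "cinner (- x) y = - cinner x y"
  using cinner_scaleC_left[of "-1" x y] by (simp add: scaleC_minus_one)

lemma cinner_minus_right: "cinner x (- y) = - cinner x y"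
  using cinner_scaleC_right[of x "-1" y] by (simp add: scaleC_minus_one)

lemma cinner_diff_left: "cinner (x - y) z = cinner x z - cinner y z"
  using cinner_add_left[of x "- y" z] by (simp add: cinner_minus_left)

lemma cinner_diff_right: "cinner x (y - z) = cinner x y - cinner x z"
  using cinner_add_right[of x y "- z"] by (simp add: cinner_minus_right)

lemma cinner_zero_left [simp]: "cinner 0 x = 0"
  using cinner_diff_left[of x x x] by simp

lemma cinner_zero_right [simp]: "cinner x 0 = 0"
  using cinner_diff_right[of x x x] by simp

lemmas cinner_algebra = cinner_add_left cinner_add_right cinner_diff_left cinner_diff_right
  cinner_scaleC_left cinner_scaleC_right

lemma cinner_self: "cinner x x = complex_of_real ((norm x)\<^sup>2)"
proof -
  have "Im (cinner x x) = 0"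
    using cinner_commute[of x x] by (metis add.inverse_inverse cnj.simps(2) equal_neg_zero)
  moreover have "Re (cinner x x) = (norm x)\<^sup>2"
    by (simp add: inner_eq_Re_cinner[symmetric] power2_norm_eq_inner)
  ultimately show ?thesis
    by (simp add: complex_eq_iff)
qed

lemma cinner_self_eq_0_iff [simp]: "cinner x x = 0 \<longleftrightarrow> x = 0"
  by (simp add: cinner_self)

lemma scaleC_zero_right [simp]: "c *\<^sub>C 0 = 0"
  using scaleC_add_right[of c 0 0] by simp

lemma scaleC_zero_left [simp]: "0 *\<^sub>C x = 0"
  using scaleC_add_left[of 0 0 x] by simp

lemma scaleC_minus_left: "(- c) *\<^sub>C x = - (c *\<^sub>C x)"
  using scaleC_scaleC[of "-1" c x] by (simp add: scaleC_minus_one)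

lemma scaleC_minus_right: "c *\<^sub>C (- x) = - (c *\<^sub>C x)"
  using scaleC_scaleC[of c "-1" x] scaleC_minus_left[of c x] by (simp add: scaleC_minus_one)

lemma scaleC_diff_right: "c *\<^sub>C (x - y) = c *\<^sub>C x - c *\<^sub>C y"
  using scaleC_add_right[of c x "- y"] by (simp add: scaleC_minus_right)

lemma scaleC_diff_left: "(c - d) *\<^sub>C x = c *\<^sub>C x - d *\<^sub>C x"
  using scaleC_add_left[of c "- d" x] by (simp add: scaleC_minus_left)

lemma norm_scaleC: "norm (c *\<^sub>C x) = norm c * norm x"
proof -
  have "complex_of_real ((norm (c *\<^sub>C x))\<^sup>2) = complex_of_real ((norm c * norm x)\<^sup>2)"
    unfolding cinner_self[symmetric] cinner_algebra
    using complex_norm_square[of c]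
    by (simp add: cinner_self power_mult_distrib mult.assoc[symmetric] mult.commute[of "cnj c"])
  then show ?thesis
    by (simp only: of_real_eq_iff) (simp add: power2_eq_iff_nonneg)
qed

lemma cinner_Cauchy_Schwarz: "norm (cinner x y) \<le> norm x * norm y"
proof (cases "cinner x y = 0")
  case False
  define c where "c = cnj (sgn (cinner x y))"
  have "cinner (c *\<^sub>C x) y = complex_of_real (norm (cinner x y))"
    using False unfolding cinner_algebra c_def
    by (simp add: sgn_eq complex_norm_square[symmetric] mult.commute power2_eq_square)
  then have "norm (cinner x y) = inner (c *\<^sub>C x) y"
    by (simp add: inner_eq_Re_cinner)
  also have "\<dots> \<le> norm (c *\<^sub>C x) * norm y"
    using norm_cauchy_schwarz by blast
  also have "norm (c *\<^sub>C x) = norm x"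
    using False by (simp add: norm_scaleC c_def norm_sgn)
  finally show ?thesis .
qed simp

lemma bounded_linear_cinner_left: "bounded_linear (\<lambda>x. cinner x y)"
proof (rule bounded_linear_intro)
  show "cinner (r *\<^sub>R x) y = r *\<^sub>R cinner x y" for r and x :: 'a
    by (simp add: scaleR_scaleC cinner_scaleC_left scaleR_conv_of_real)
  show "norm (cinner x y) \<le> norm x * norm y" for x :: 'a
    by (rule cinner_Cauchy_Schwarz)
qed (rule cinner_add_left)

lemma tendsto_cinner_left: "(f \<longlongrightarrow> x) F \<Longrightarrow> ((\<lambda>i. cinner (f i) y) \<longlongrightarrow> cinner x y) F"
  by (rule bounded_linear.tendsto[OF bounded_linear_cinner_left])

lemma tendsto_cinner_right: "(f \<longlongrightarrow> x) F \<Longrightarrow> ((\<lambda>i. cinner y (f i)) \<longlongrightarrow> cinner y x) F"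
  by (subst (1 2) cinner_commute) (intro tendsto_cnj tendsto_cinner_left)

lemma bounded_linear_scaleC: "bounded_linear (\<lambda>x::'a::complex_inner. c *\<^sub>C x)"
proof (rule bounded_linear_intro)
  show "c *\<^sub>C (r *\<^sub>R x) = r *\<^sub>R (c *\<^sub>C x)" for r and x :: 'a
    by (simp add: scaleR_scaleC scaleC_scaleC mult.commute)
  show "norm (c *\<^sub>C x) \<le> norm x * norm c" for x :: 'a
    by (simp add: norm_scaleC mult.commute)
qed (rule scaleC_add_right)

text \<open>Closedness is not included: the image of the disc algebra in \<open>L\<^sup>2\<close>, whose
  closure is the Hardy space, is a subspace in this sense.\<close>

definition csubspace :: "'a::complex_inner set \<Rightarrow> bool" where
  "csubspace H \<longleftrightarrow> 0 \<in> H \<and> (\<forall>x\<in>H. \<forall>y\<in>H. x + y \<in> H) \<and> (\<forall>c. \<forall>x\<in>H. c *\<^sub>C x \<in> H)"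

lemma csubspaceD:
  assumes "csubspace H"
  shows csubspace_zero: "0 \<in> H"
    and csubspace_add: "x \<in> H \<Longrightarrow> y \<in> H \<Longrightarrow> x + y \<in> H"
    and csubspace_scaleC: "x \<in> H \<Longrightarrow> c *\<^sub>C x \<in> H"
    and csubspace_scaleR: "x \<in> H \<Longrightarrow> r *\<^sub>R x \<in> H"
    and csubspace_minus: "x \<in> H \<Longrightarrow> - x \<in> H"
    and csubspace_diff: "x \<in> H \<Longrightarrow> y \<in> H \<Longrightarrow> x - y \<in> H"
proof -
  show *: "0 \<in> H" "x \<in> H \<Longrightarrow> y \<in> H \<Longrightarrow> x + y \<in> H" "x \<in> H \<Longrightarrow> c *\<^sub>C x \<in> H" for x y c
    using assms by (auto simp: csubspace_def)
  show "x \<in> H \<Longrightarrow> r *\<^sub>R x \<in> H" "x \<in> H \<Longrightarrow> - x \<in> H" for x r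
    using *(3)[of x "complex_of_real r"] *(3)[of x "-1"]
    by (simp_all add: scaleR_scaleC scaleC_minus_one)
  then show "x \<in> H \<Longrightarrow> y \<in> H \<Longrightarrow> x - y \<in> H" for x y
    using *(2)[of x "- y"] by simp
qed

lemma csubspace_closure:
  assumes "csubspace H"
  shows "csubspace (closure H)"
  unfolding csubspace_def
proof (intro conjI ballI allI)
  show "0 \<in> closure H"
    using csubspace_zero[OF assms] closure_subset by blast
next
  fix x y assume "x \<in> closure H" "y \<in> closure H"
  then obtain f g where f: "\<And>n::nat. f n \<in> H" "f \<longlonglongrightarrow> x" and g: "\<And>n::nat. g n \<in> H" "g \<longlonglongrightarrow> y"
    by (auto simp: closure_sequential)
  then have "(\<lambda>n. f n + g n) \<longlonglongrightarrow> x + y" "\<And>n. f n + g n \<in> H"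
    by (auto intro: tendsto_intros csubspace_add[OF assms])
  then show "x + y \<in> closure H"
    by (auto simp: closure_sequential intro!: exI)
next
  fix c x assume "x \<in> closure H"
  then obtain f where f: "\<And>n::nat. f n \<in> H" "f \<longlonglongrightarrow> x"
    by (auto simp: closure_sequential)
  have "(\<lambda>n. c *\<^sub>C f n) \<longlonglongrightarrow> c *\<^sub>C x"
    using f(2) by (rule bounded_linear.tendsto[OF bounded_linear_scaleC])
  then show "c *\<^sub>C x \<in> closure H"
    using csubspace_scaleC[OF assms f(1)] by (auto simp: closure_sequential intro!: exI)
qed

text \<open>The distance to \<open>H\<close> is approached along a sequence that the parallelogram law makes Cauchy;
  the limit, a nearest point, differs from \<open>x\<close> by a vector orthogonal to \<open>H\<close>.\<close>

lemma orthogonal_decomposition_exists: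
  fixes H :: "'a::complex_inner set"
  assumes H: "csubspace H" and "complete H"
  shows "\<exists>y\<in>H. \<forall>z\<in>H. cinner (x - y) z = 0"
proof -
  define d where "d = Inf ((\<lambda>y. (norm (x - y))\<^sup>2) ` H)"
  have bdd: "bdd_below ((\<lambda>y. (norm (x - y))\<^sup>2) ` H)"
    by (rule bdd_belowI[of _ 0]) auto
  have d_le: "d \<le> (norm (x - y))\<^sup>2" if "y \<in> H" for y
    unfolding d_def using bdd that by (rule cINF_lower)
  have "\<exists>y\<in>H. (norm (x - y))\<^sup>2 < d + e" if "e > 0" for e
    using cInf_lessD[of "(\<lambda>y. (norm (x - y))\<^sup>2) ` H" "d + e"] that csubspace_zero[OF H]
    by (auto simp: d_def)
  then have "\<exists>y. y \<in> H \<and> (norm (x - y))\<^sup>2 < d + inverse (real (Suc n))" for n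
    by (meson inverse_positive_iff_positive of_nat_0_less_iff zero_less_Suc)
  then obtain y where y: "\<And>n. y n \<in> H" "\<And>n. (norm (x - y n))\<^sup>2 < d + inverse (real (Suc n))"
    by metis
  have para: "(norm (y m - y n))\<^sup>2 \<le> 2 * inverse (real (Suc m)) + 2 * inverse (real (Suc n))" for m n
  proof -
    have "(1/2) *\<^sub>R (y m + y n) \<in> H"
      using y(1) H by (intro csubspaceD)
    from d_le[OF this] have "4 * d \<le> (norm ((2::real) *\<^sub>R (x - (1/2) *\<^sub>R (y m + y n))))\<^sup>2"
      by (simp add: power_mult_distrib)
    also have "(2::real) *\<^sub>R (x - (1/2) *\<^sub>R (y m + y n)) = (x - y m) + (x - y n)"
      by (simp add: algebra_simps scaleR_2)
    also have "(norm ((x - y m) + (x - y n)))\<^sup>2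
        = 2 * (norm (x - y m))\<^sup>2 + 2 * (norm (x - y n))\<^sup>2 - (norm ((x - y m) - (x - y n)))\<^sup>2"
      by (simp add: power2_norm_eq_inner inner_add_left inner_add_right inner_diff_left inner_diff_right)
    also have "(x - y m) - (x - y n) = - (y m - y n)"
      by simp
    finally show ?thesis
      using y(2)[of m] y(2)[of n] by (simp only: norm_minus_cancel)
  qed
  have "Cauchy y"
  proof (rule metric_CauchyI)
    fix e :: real assume "e > 0"
    then obtain N where N: "inverse (real (Suc N)) < e\<^sup>2 / 4"
      using reals_Archimedean[of "e\<^sup>2/4"] by auto
    have "dist (y m) (y n) < e" if "m \<ge> N" "n \<ge> N" for m n
    proof -
      have *: "inverse (real (Suc k)) \<le> inverse (real (Suc N))" if "k \<ge> N" for k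
        using that by (simp add: field_simps)
      have "(norm (y m - y n))\<^sup>2 < e\<^sup>2"
        using para[of m n] N *[OF that(1)] *[OF that(2)] by linarith
      then show ?thesis
        using \<open>e > 0\<close> by (simp add: dist_norm power_less_imp_less_base)
    qed
    then show "\<exists>M. \<forall>m\<ge>M. \<forall>n\<ge>M. dist (y m) (y n) < e" by blast
  qed
  with \<open>complete H\<close> y(1) obtain l where l: "l \<in> H" "y \<longlonglongrightarrow> l"
    unfolding complete_def by blast
  have "(\<lambda>n. (norm (x - y n))\<^sup>2) \<longlonglongrightarrow> (norm (x - l))\<^sup>2"
    using l by (intro tendsto_intros)
  moreover have "(\<lambda>n. d + inverse (real (Suc n))) \<longlonglongrightarrow> d + 0"
    by (intro tendsto_intros LIMSEQ_inverse_real_of_nat)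
  ultimately have "(norm (x - l))\<^sup>2 \<le> d + 0"
    by (rule LIMSEQ_le) (use y(2) less_imp_le in blast)
  then have min: "(norm (x - l))\<^sup>2 \<le> (norm (x - z))\<^sup>2" if "z \<in> H" for z
    using d_le[OF that] by linarith
  show ?thesis
  proof (intro bexI[OF _ l(1)] ballI)
    fix z assume z: "z \<in> H"
    define c where "c = cinner (x - l) z"
    \<comment> \<open>Moving from \<open>l\<close> a small step in the direction \<open>c z\<close> must not decrease the distance.\<close>
    have "2 * t * (norm c)\<^sup>2 \<le> t\<^sup>2 * ((norm c)\<^sup>2 * (norm z)\<^sup>2)" for t :: real
    proof -
      have "l + (of_real t * c) *\<^sub>C z \<in> H"
        using l z H by (intro csubspaceD)
      from min[OF this] have "0 \<le> (norm (x - l - (of_real t * c) *\<^sub>C z))\<^sup>2 - (norm (x - l))\<^sup>2"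
        by (simp add: algebra_simps)
      also have "\<dots> = - 2 * inner (x - l) ((of_real t * c) *\<^sub>C z) + (norm ((of_real t * c) *\<^sub>C z))\<^sup>2"
        by (simp add: power2_norm_eq_inner inner_diff_left inner_diff_right inner_commute)
      also have "inner (x - l) ((of_real t * c) *\<^sub>C z) = t * (norm c)\<^sup>2"
        unfolding inner_eq_Re_cinner cinner_scaleC_right c_def[symmetric]
        by (simp add: cmod_power2) (simp add: power2_eq_square algebra_simps)
      finally show ?thesis
        by (simp add: norm_scaleC norm_mult power_mult_distrib)
    qed
    from this[of "1 / (norm z)\<^sup>2"] have "(norm c)\<^sup>2 \<le> 0" if "z \<noteq> 0"
      using that by (simp add: power2_eq_square field_simps)
    then show "cinner (x - l) z = 0"
      by (cases "z = 0") (auto simp: c_def)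
  qed
qed

lemma orth_proj:
  fixes H :: "'a::complex_inner set"
  assumes H: "csubspace H" "complete H"
  shows orth_proj_in: "orth_proj H x \<in> H"
    and cinner_orth_proj: "z \<in> H \<Longrightarrow> cinner (orth_proj H x) z = cinner x z"
    and orth_proj_eqI: "y \<in> H \<Longrightarrow> (\<And>z. z \<in> H \<Longrightarrow> cinner x z = cinner y z) \<Longrightarrow> orth_proj H x = y"
proof -
  have uniq: "y = y'" if "y \<in> H" "y' \<in> H" "\<forall>z\<in>H. cinner (x - y) z = 0" "\<forall>z\<in>H. cinner (x - y') z = 0"
    for y y'
  proof -
    have "y - y' \<in> H" using that H by (intro csubspaceD)
    then have "cinner (y - y') (y - y') = 0"
      using that(3,4) by (simp add: cinner_diff_left)
    then show ?thesis by simp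
  qed
  have ex1: "\<exists>!y. y \<in> H \<and> (\<forall>z\<in>H. cinner (x - y) z = 0)"
    using orthogonal_decomposition_exists[OF H, of x] uniq by blast
  have P: "orth_proj H x \<in> H \<and> (\<forall>z\<in>H. cinner (x - orth_proj H x) z = 0)"
    unfolding orth_proj_def by (rule theI'[OF ex1])
  then show "orth_proj H x \<in> H" "z \<in> H \<Longrightarrow> cinner (orth_proj H x) z = cinner x z"
    by (auto simp: cinner_diff_left)
  show "orth_proj H x = y" if "y \<in> H" "\<And>z. z \<in> H \<Longrightarrow> cinner x z = cinner y z"
    using uniq[of "orth_proj H x" y] P that by (auto simp: cinner_diff_left)
qed

text \<open>The difference of the two vectors lies in \<open>H\<close> and is orthogonal to itself.\<close>

lemma cinner_ext:
  assumes "csubspace H" "x \<in> H" "y \<in> H" "\<And>z. z \<in> H \<Longrightarrow> cinner x z = cinner y z"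
  shows "x = y"
proof -
  have "cinner (x - y) (x - y) = 0"
    using assms csubspace_diff[of H x y] by (simp add: cinner_diff_left)
  then show ?thesis by simp
qed

lemma adjoint_on_eqI:
  assumes "csubspace H" "S y \<in> H" "\<And>x. x \<in> H \<Longrightarrow> cinner (T x) y = cinner x (S y)"
  shows "adjoint_on H T y = S y"
  unfolding adjoint_on_def
proof (rule the_equality)
  fix z assume z: "z \<in> H \<and> (\<forall>x\<in>H. cinner (T x) y = cinner x z)"
  show "z = S y"
    by (rule cinner_ext[OF assms(1)]) (use z assms in \<open>auto simp: cinner_commute[of z] cinner_commute[of "S y"]\<close>)
qed (use assms in auto)

section \<open>Conjugations prescribed on a total family\<close>

text \<open>The conditions on \<open>x\<close> and \<open>y\<close> say that \<open>x i \<mapsto> y i\<close> is compatible with an isometric, respectively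
  symmetric, conjugate-linear map. The relation \<open>\<Gamma>\<close> of the proof consists of the pairs that such a
  map could contain; it is symmetric in its two arguments, and totality of \<open>x\<close> makes it
  single-valued. Being isometric, it has a closed domain, which contains the total family \<open>x\<close>. Hence it
  is the graph of a map \<open>C\<close> on \<open>H\<close>, and its symmetry says that \<open>C\<close> is an involution.\<close>

lemma conjugation_from_total_family:
  fixes H :: "'a::complex_inner set" and x y :: "'i \<Rightarrow> 'a"
  assumes H: "csubspace H" "complete H"
    and xH: "\<And>i. i \<in> I \<Longrightarrow> x i \<in> H" and yH: "\<And>i. i \<in> I \<Longrightarrow> y i \<in> H"
    and total: "\<And>f. f \<in> H \<Longrightarrow> (\<And>i. i \<in> I \<Longrightarrow> cinner f (x i) = 0) \<Longrightarrow> f = 0"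
    and iso: "\<And>i j. i \<in> I \<Longrightarrow> j \<in> I \<Longrightarrow> cinner (y i) (y j) = cinner (x j) (x i)"
    and sym: "\<And>i j. i \<in> I \<Longrightarrow> j \<in> I \<Longrightarrow> cinner (y i) (x j) = cinner (y j) (x i)"
  shows "\<exists>C. conjugation_on H C \<and> (\<forall>i\<in>I. C (x i) = y i)"
proof -
  define \<Gamma> where "\<Gamma> f g \<longleftrightarrow> f \<in> H \<and> g \<in> H \<and>
      (\<forall>i\<in>I. cinner g (x i) = cinner (y i) f \<and> cinner f (x i) = cinner (y i) g)" for f g
  have \<Gamma>_sym: "\<Gamma> g f" if "\<Gamma> f g" for f g
    using that by (auto simp: \<Gamma>_def)
  have \<Gamma>_xy: "\<Gamma> (x i) (y i)" if "i \<in> I" for i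
    using that xH yH iso sym by (auto simp: \<Gamma>_def)
  have \<Gamma>_0: "\<Gamma> 0 0"
    using csubspace_zero[OF H(1)] by (auto simp: \<Gamma>_def)
  have \<Gamma>_add: "\<Gamma> (f + f') (g + g')" if "\<Gamma> f g" "\<Gamma> f' g'" for f g f' g'
    using that H by (auto simp: \<Gamma>_def cinner_algebra intro: csubspaceD)
  have \<Gamma>_scale: "\<Gamma> (c *\<^sub>C f) (cnj c *\<^sub>C g)" if "\<Gamma> f g" for f g c
    using that H by (auto simp: \<Gamma>_def cinner_algebra intro: csubspaceD)
  have \<Gamma>_diff: "\<Gamma> (f - f') (g - g')" if "\<Gamma> f g" "\<Gamma> f' g'" for f g f' g'
    using \<Gamma>_add[OF that(1) \<Gamma>_scale[OF that(2), of "-1"]] by (simp add: scaleC_minus_one)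
  have \<Gamma>_unique: "g = g'" if "\<Gamma> f g" "\<Gamma> f g'" for f g g'
  proof -
    have "g - g' \<in> H"
      using that H by (auto simp: \<Gamma>_def intro: csubspaceD)
    moreover have "cinner (g - g') (x i) = 0" if "i \<in> I" for i
      using \<open>\<Gamma> f g\<close> \<open>\<Gamma> f g'\<close> that by (auto simp: \<Gamma>_def cinner_diff_left)
    ultimately show ?thesis using total by fastforce
  qed
  have \<Gamma>_iso_x: "cinner g (y i) = cinner (x i) f" if "\<Gamma> f g" "i \<in> I" for f g i
    using that by (auto simp: \<Gamma>_def cinner_commute[of g] cinner_commute[of "x i"])
  define X where "X = {f. \<exists>g. \<Gamma> f g \<and> (\<forall>f' g'. \<Gamma> f' g' \<longrightarrow> cinner g' g = cinner f f')}"
  have X_x: "x i \<in> X" if "i \<in> I" for i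
    unfolding X_def mem_Collect_eq
    by (rule exI[of _ "y i"]) (use that \<Gamma>_xy \<Gamma>_iso_x in auto)
  have X_sub: "csubspace X"
    unfolding csubspace_def
  proof (intro conjI ballI allI)
    show "0 \<in> X" using \<Gamma>_0 by (auto simp: X_def intro!: exI[of _ 0])
  next
    fix f f' assume "f \<in> X" "f' \<in> X"
    then obtain g g' where g: "\<Gamma> f g" "\<And>h k. \<Gamma> h k \<Longrightarrow> cinner k g = cinner f h"
      and g': "\<Gamma> f' g'" "\<And>h k. \<Gamma> h k \<Longrightarrow> cinner k g' = cinner f' h"
      unfolding X_def by blast
    then show "f + f' \<in> X"
      unfolding X_def mem_Collect_eq
      by (intro exI[of _ "g + g'"]) (auto simp: cinner_algebra intro: \<Gamma>_add)
  next
    fix c f assume "f \<in> X"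
    then obtain g where g: "\<Gamma> f g" "\<And>h k. \<Gamma> h k \<Longrightarrow> cinner k g = cinner f h"
      unfolding X_def by blast
    then show "c *\<^sub>C f \<in> X"
      unfolding X_def mem_Collect_eq
      by (intro exI[of _ "cnj c *\<^sub>C g"]) (auto simp: cinner_algebra intro: \<Gamma>_scale)
  qed
  have X_H: "X \<subseteq> H" by (auto simp: X_def \<Gamma>_def)
  \<comment> \<open>On \<open>X\<close> the relation is an isometric map, so it carries Cauchy sequences to Cauchy sequences.\<close>
  have X_complete: "complete X"
    unfolding complete_def
  proof (intro allI impI, elim conjE)
    fix f :: "nat \<Rightarrow> 'a" assume fX: "\<forall>n. f n \<in> X" and "Cauchy f"
    then obtain l where l: "f \<longlonglongrightarrow> l" "l \<in> H"
      using H(2) X_H unfolding complete_def by blast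
    from fX obtain g where g: "\<And>n. \<Gamma> (f n) (g n)"
        "\<And>n h k. \<Gamma> h k \<Longrightarrow> cinner k (g n) = cinner (f n) h"
      unfolding X_def mem_Collect_eq by metis
    have "dist (g m) (g n) = dist (f m) (f n)" for m n
    proof -
      have "cinner (g m - g n) (g m - g n) = cinner (f m - f n) (f m - f n)"
        using g(2)[OF \<Gamma>_diff[OF g(1)[of m] g(1)[of n]]] by (simp add: cinner_diff_right[of "g m - g n"] cinner_diff_left[of "f m"])
      then have "(norm (g m - g n))\<^sup>2 = (norm (f m - f n))\<^sup>2"
        unfolding cinner_self of_real_eq_iff .
      then show ?thesis by (simp add: dist_norm power2_eq_iff_nonneg)
    qed
    with \<open>Cauchy f\<close> have "Cauchy g" by (simp add: Cauchy_def)
    moreover have "g n \<in> H" for n using g(1)[of n] by (simp add: \<Gamma>_def)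
    ultimately obtain k where k: "g \<longlonglongrightarrow> k" "k \<in> H"
      using H(2) unfolding complete_def by blast
    have "\<Gamma> l k"
      unfolding \<Gamma>_def
    proof (intro conjI ballI l k)
      fix i assume i: "i \<in> I"
      have *: "cinner (g n) (x i) = cinner (y i) (f n)" "cinner (f n) (x i) = cinner (y i) (g n)" for n
        using g(1)[of n] i by (auto simp: \<Gamma>_def)
      show "cinner k (x i) = cinner (y i) l"
        using tendsto_cinner_left[OF k(1), of "x i"] tendsto_cinner_right[OF l(1), of "y i"]
        unfolding * by (rule LIMSEQ_unique)
      show "cinner l (x i) = cinner (y i) k"
        using tendsto_cinner_left[OF l(1), of "x i"] tendsto_cinner_right[OF k(1), of "y i"]
        unfolding * by (rule LIMSEQ_unique)
    qed
    moreover have "cinner k' k = cinner l h" if "\<Gamma> h k'" for h k'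
      using tendsto_cinner_right[OF k(1), of k'] tendsto_cinner_left[OF l(1), of h]
      unfolding g(2)[OF that] by (rule LIMSEQ_unique)
    ultimately have "l \<in> X" by (auto simp: X_def)
    with l show "\<exists>l\<in>X. f \<longlonglongrightarrow> l" by blast
  qed
  have "H \<subseteq> X"
  proof
    fix f assume f: "f \<in> H"
    obtain g where g: "g \<in> X" "\<forall>z\<in>X. cinner (f - g) z = 0"
      using orthogonal_decomposition_exists[OF X_sub X_complete] by blast
    have "f - g = 0"
      by (rule total) (use g f X_H X_x H in \<open>auto intro: csubspaceD\<close>)
    with g show "f \<in> X" by simp
  qed
  then have "\<forall>f\<in>H. \<exists>g. \<Gamma> f g \<and> (\<forall>f' g'. \<Gamma> f' g' \<longrightarrow> cinner g' g = cinner f f')"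
    by (auto simp: X_def)
  then obtain C where C: "\<And>f. f \<in> H \<Longrightarrow> \<Gamma> f (C f)"
      "\<And>f f' g'. f \<in> H \<Longrightarrow> \<Gamma> f' g' \<Longrightarrow> cinner g' (C f) = cinner f f'"
    by metis
  have C_eq: "C f = g" if "\<Gamma> f g" for f g
    using \<Gamma>_unique[OF _ that] C(1) that by (auto simp: \<Gamma>_def)
  have "conjugation_on H C"
    unfolding conjugation_on_def
  proof (intro conjI ballI allI)
    fix f g c assume "f \<in> H" "g \<in> H"
    then show "C (f + g) = C f + C g" "cinner (C f) (C g) = cinner g f"
      by (auto intro: C_eq \<Gamma>_add C)
  next
    fix f c assume f: "f \<in> H"
    then show "C f \<in> H" using C(1) by (auto simp: \<Gamma>_def)
    from f show "C (c *\<^sub>C f) = cnj c *\<^sub>C C f" "C (C f) = f"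
      by (auto intro: C_eq \<Gamma>_scale \<Gamma>_sym C)
  qed
  moreover have "C (x i) = y i" if "i \<in> I" for i
    using that by (intro C_eq \<Gamma>_xy)
  ultimately show ?thesis by blast
qed

section \<open>Integration on the circle and completeness of \<open>L\<^sup>2\<close>\<close>

lemma space_circle_measure [simp]: "space circle_measure = sphere 0 1"
  by (simp add: circle_measure_def space_restrict_space)

lemma sets_circle_measure [measurable_cong]:
  "sets circle_measure = sets (restrict_space borel (sphere 0 1))"
  by (simp add: circle_measure_def)

lemma cis_measurable_circle:
  "cis \<in> uniform_measure lborel {0..<2*pi} \<rightarrow>\<^sub>M restrict_space borel (sphere 0 1)"
proof -
  have "cis \<in> borel_measurable borel"
    by (intro borel_measurable_continuous_onI continuous_intros)
  then show ?thesis
    by (intro measurable_restrict_space2) (auto simp: measurable_def)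
qed

lemma emeasure_circle_measure: "emeasure circle_measure (sphere 0 1) = 1"
proof -
  have "sphere 0 1 \<in> sets (restrict_space borel (sphere (0::complex) 1))"
    using sets.top[of "restrict_space borel (sphere (0::complex) 1)"] by (simp add: space_restrict_space)
  moreover have "cis -` sphere 0 1 \<inter> space (uniform_measure lborel {0..<2*pi}) = UNIV"
    by auto
  ultimately show ?thesis
    unfolding circle_measure_def
    by (subst emeasure_distr[OF cis_measurable_circle]) (auto simp: ennreal_divide_self)
qed

lemma finite_measure_circle_measure: "finite_measure circle_measure"
  by (rule finite_measureI) (simp add: emeasure_circle_measure)

lemma measure_circle_measure [simp]: "measure circle_measure (sphere 0 1) = 1"
  by (simp add: measure_def emeasure_circle_measure)

lemma borel_measurable_circle_continuous:
  fixes f :: "complex \<Rightarrow> 'b::topological_space"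
  shows "continuous_on (sphere 0 1) f \<Longrightarrow> f \<in> borel_measurable circle_measure"
  by (subst measurable_cong_sets[OF sets_circle_measure refl])
     (rule borel_measurable_continuous_on_restrict)

lemma continuous_on_circle_bounded:
  fixes f :: "complex \<Rightarrow> complex"
  assumes "continuous_on (sphere 0 1) f"
  shows "\<exists>K. \<forall>z\<in>sphere 0 1. norm (f z) \<le> K"
proof -
  have "compact (f ` sphere 0 1)"
    using assms by (intro compact_continuous_image) auto
  then show ?thesis
    by (auto dest!: compact_imp_bounded simp: bounded_iff)
qed

lemma continuous_on_circle_Linfty: "continuous_on (sphere 0 1) f \<Longrightarrow> f \<in> Linfty"
  using continuous_on_circle_bounded[of f]
  unfolding Linfty_def
  by (simp add: borel_measurable_circle_continuous) (metis (no_types, lifting) AE_I2 mem_sphere_0 space_circle_measure)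

lemma sq_integrable_bounded:
  assumes [measurable]: "f \<in> borel_measurable circle_measure" and "AE z in circle_measure. norm (f z) \<le> K"
  shows "sq_integrable f"
proof -
  interpret finite_measure circle_measure by (rule finite_measure_circle_measure)
  have "sq_integrable (\<lambda>z. f z * 1)"
    by (rule sq_integrable_mult_bounded) (use assms in \<open>auto simp: sq_integrable_def\<close>)
  then show ?thesis by simp
qed

lemma sq_integrable_continuous: "continuous_on (sphere 0 1) f \<Longrightarrow> sq_integrable f"
  using continuous_on_circle_bounded[of f]
  by (auto intro!: sq_integrable_bounded AE_I2 borel_measurable_circle_continuous)

text \<open>The link between the normalized measure on the circle and gauge integrals over \<open>[0, 2
  \<pi>]\<close>, in which contour integrals are expressed.\<close>

lemma circle_integral_eq:
  fixes f :: "complex \<Rightarrow> complex"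
  assumes "continuous_on (sphere 0 1) f"
    and "((\<lambda>t. f (cis t)) has_integral J) {0..2*pi}"
  shows "(LINT z|circle_measure. f z) = J / (2*pi)"
proof -
  have f: "f \<in> borel_measurable (restrict_space borel (sphere 0 1))"
    using assms(1) by (rule borel_measurable_continuous_on_restrict)
  have cont: "continuous_on UNIV (\<lambda>t. f (cis t))"
    by (rule continuous_on_compose2[OF assms(1)]) (auto intro!: continuous_intros)
  then have [measurable]: "(\<lambda>t. f (cis t)) \<in> borel_measurable borel"
    by (intro borel_measurable_continuous_onI)
  have "uniform_measure lborel {0..<2*pi} = density lborel (\<lambda>t. ennreal (indicator {0..<2*pi} t / (2*pi)))"
    unfolding uniform_measure_def
    by (intro arg_cong[where f = "density lborel"] ext)
       (auto simp: indicator_def divide_ennreal ennreal_1[symmetric] simp del: ennreal_1)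
  then have "(LINT z|circle_measure. f z)
      = (LINT t|lborel. (indicator {0..<2*pi} t / (2*pi)) *\<^sub>R f (cis t))"
    unfolding circle_measure_def
    by (subst integral_distr[OF cis_measurable_circle f]) (simp add: integral_density)
  also have "\<dots> = (LINT t|lborel. (1 / (2*pi)) *\<^sub>R (indicator {0..2*pi} t *\<^sub>R f (cis t)))"
  proof (rule integral_cong_AE)
    have "AE t in lborel. t \<noteq> 2*pi" by (rule AE_lborel_singleton)
    then show "AE t in lborel. (indicator {0..<2*pi} t / (2*pi)) *\<^sub>R f (cis t)
        = (1 / (2*pi)) *\<^sub>R (indicator {0..2*pi} t *\<^sub>R f (cis t))"
      by eventually_elim (auto simp: indicator_def)
  qed auto
  also have "\<dots> = (1 / (2*pi)) *\<^sub>R (LINT t:{0..2*pi}|lborel. f (cis t))"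
    unfolding set_lebesgue_integral_def by (rule integral_scaleR_right)
  also have "(LINT t:{0..2*pi}|lborel. f (cis t)) = J"
  proof -
    have "set_integrable lborel {0..2*pi} (\<lambda>t. f (cis t))"
      by (rule borel_integrable_atLeastAtMost') (rule continuous_on_subset[OF cont], simp)
    then have "(LINT t:{0..2*pi}|lborel. f (cis t)) = integral {0..2*pi} (\<lambda>t. f (cis t))"
      by (rule set_borel_integral_eq_integral)
    also have "\<dots> = J"
      using assms(2) by (rule integral_unique)
    finally show ?thesis .
  qed
  finally show ?thesis
    by (simp add: scaleR_conv_of_real)
qed

text \<open>On the circle the conjugate of the kernel is \<open>w / (w - z)\<close>, which turns the average over the
  circle into Cauchy's integral.\<close>

lemma circle_integral_Cauchy:
  assumes h: "continuous_on (cball 0 1) h" "h holomorphic_on ball 0 1" and z: "z \<in> ball 0 1"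
  shows "(LINT w|circle_measure. h w * cnj (1 / (1 - cnj z * w))) = h z"
proof -
  have nz: "1 - cnj z * w \<noteq> 0" if "w \<in> sphere 0 1" for w
  proof
    assume "1 - cnj z * w = 0"
    then have "norm (cnj z * w) = 1" by simp
    with that z show False by (simp add: norm_mult)
  qed
  have "((\<lambda>u. h u / (u - z)) has_contour_integral (2 * of_real pi * \<i> * h z)) (circlepath 0 1)"
    by (rule Cauchy_integral_circlepath) (use h z in auto)
  then have "((\<lambda>t. h (cis t) / (cis t - z) * \<i> * cis t) has_integral (2 * of_real pi * \<i> * h z)) {0..2*pi}"
    unfolding circlepath_def by (subst (asm) has_contour_integral_part_circlepath_iff) auto
  then have "((\<lambda>t. (- \<i>) * (h (cis t) / (cis t - z) * \<i> * cis t)) has_integral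
      (- \<i>) * (2 * of_real pi * \<i> * h z)) {0..2*pi}"
    by (rule has_integral_mult_right)
  moreover have "(- \<i>) * (h (cis t) / (cis t - z) * \<i> * cis t)
      = h (cis t) * cnj (1 / (1 - cnj z * cis t))" for t
  proof -
    have "cis t \<noteq> z" using z by auto
    moreover have "1 - z * cnj (cis t) \<noteq> 0"
      using nz[of "cis t"] by (metis complex_cnj_cnj complex_cnj_diff complex_cnj_mult complex_cnj_one complex_cnj_zero_iff mem_sphere_0 norm_cis)
    moreover have "cis t * cnj (cis t) = 1"
      by (simp add: cis_cnj cis_mult)
    ultimately show ?thesis
      by (simp add: divide_simps) (simp add: algebra_simps)
  qed
  ultimately have "((\<lambda>t. h (cis t) * cnj (1 / (1 - cnj z * cis t))) has_integral 2 * pi * h z) {0..2*pi}"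
    by (simp add: algebra_simps)
  moreover have "continuous_on (sphere 0 1) (\<lambda>w. h w * cnj (1 / (1 - cnj z * w)))"
    using nz by (intro continuous_intros continuous_on_subset[OF h(1)]) auto
  ultimately have "(LINT w|circle_measure. h w * cnj (1 / (1 - cnj z * w))) = 2 * pi * h z / (2*pi)"
    by (intro circle_integral_eq)
  then show ?thesis by simp
qed

lemma L2_class_exists: "\<exists>f. sq_integrable f \<and> x = L2_class f"
  by transfer (auto simp: L2_rel_def)

lemma L2_class_add:
  "sq_integrable f \<Longrightarrow> sq_integrable g \<Longrightarrow> L2_class f + L2_class g = L2_class (\<lambda>z. f z + g z)"
  by transfer (simp add: L2_rel_def sq_integrable_add)

lemma L2_class_scaleC: "sq_integrable f \<Longrightarrow> c *\<^sub>C L2_class f = L2_class (\<lambda>z. c * f z)"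
  by transfer (simp add: L2_rel_def sq_integrable_cmult)

lemma sq_integrable_diff: "sq_integrable f \<Longrightarrow> sq_integrable g \<Longrightarrow> sq_integrable (\<lambda>z. f z - g z)"
  using sq_integrable_add[of f "\<lambda>z. (-1) * g z"] sq_integrable_cmult[of g "-1"] by simp

lemma L2_class_diff:
  "sq_integrable f \<Longrightarrow> sq_integrable g \<Longrightarrow> L2_class f - L2_class g = L2_class (\<lambda>z. f z - g z)"
  using L2_class_add[of f "\<lambda>z. (-1) * g z"] sq_integrable_cmult[of g "-1"] L2_class_scaleC[of g "-1"]
  by (simp add: scaleC_minus_one minus_circle_L2_def)

lemma cinner_L2_class:
  "sq_integrable f \<Longrightarrow> sq_integrable g \<Longrightarrow>
    cinner (L2_class f) (L2_class g) = (LINT z|circle_measure. f z * cnj (g z))"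
  by transfer simp

lemma norm_L2_class:
  assumes "sq_integrable f"
  shows "(norm (L2_class f))\<^sup>2 = (LINT z|circle_measure. (norm (f z))\<^sup>2)"
proof -
  have "complex_of_real ((norm (L2_class f))\<^sup>2) = (LINT z|circle_measure. complex_of_real ((norm (f z))\<^sup>2))"
    unfolding cinner_self[symmetric] cinner_L2_class[OF assms assms] complex_norm_square ..
  then show ?thesis
    unfolding integral_complex_of_real of_real_eq_iff .
qed

lemma norm_L2_class_le:
  assumes f: "sq_integrable f" and K: "AE z in circle_measure. norm (f z) \<le> K" "0 \<le> K"
  shows "norm (L2_class f) \<le> K"
proof -
  interpret finite_measure circle_measure by (rule finite_measure_circle_measure)
  have "(norm (L2_class f))\<^sup>2 \<le> (LINT z|circle_measure. K\<^sup>2)"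
    unfolding norm_L2_class[OF f]
  proof (rule integral_mono_AE)
    show "AE z in circle_measure. (norm (f z))\<^sup>2 \<le> K\<^sup>2"
      using K(1) by eventually_elim (simp add: power_mono)
  qed (use f in \<open>auto simp: sq_integrable_def\<close>)
  also have "\<dots> = K\<^sup>2" by simp
  finally show ?thesis using K(2) by (rule power2_le_imp_le)
qed

lemma L2_class_cong: "(\<And>z. z \<in> sphere 0 1 \<Longrightarrow> f z = g z) \<Longrightarrow> L2_class f = L2_class g"
proof -
  assume fg: "\<And>z. z \<in> sphere 0 1 \<Longrightarrow> f z = g z"
  have "f \<in> borel_measurable circle_measure \<longleftrightarrow> g \<in> borel_measurable circle_measure"
    by (rule measurable_cong) (use fg in auto)
  moreover have "integrable circle_measure (\<lambda>z. (norm (f z))\<^sup>2) \<longleftrightarrow> integrable circle_measure (\<lambda>z. (norm (g z))\<^sup>2)"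
    by (rule Bochner_Integration.integrable_cong) (use fg in auto)
  ultimately have sq: "sq_integrable f \<longleftrightarrow> sq_integrable g" by (simp add: sq_integrable_def)
  have "AE z in circle_measure. f z = g z"
    by (rule AE_I2) (use fg in auto)
  with sq show ?thesis
    by transfer (auto simp: L2_rel_def sq_integrable_zero)
qed

text \<open>The measure has total mass \<open>1\<close>, so this is the Cauchy-Schwarz inequality against
  the constant \<open>1\<close>.\<close>

lemma nn_integral_norm_le_norm_L2:
  assumes f: "sq_integrable f"
  shows "(\<integral>\<^sup>+z. ennreal (norm (f z)) \<partial>circle_measure) \<le> ennreal (norm (L2_class f))"
proof -
  interpret finite_measure circle_measure by (rule finite_measure_circle_measure)
  have one: "sq_integrable (\<lambda>z. 1)" by (simp add: sq_integrable_def)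
  have f': "sq_integrable (\<lambda>z. complex_of_real (norm (f z)))"
    using f by (auto simp: sq_integrable_def)
  have int: "integrable circle_measure (\<lambda>z. norm (f z))"
    using integrable_norm[OF integrable_mult_cnj[OF f one]] by simp
  have "(LINT z|circle_measure. norm (f z))
      = norm (cinner (L2_class (\<lambda>z. complex_of_real (norm (f z)))) (L2_class (\<lambda>z. 1)))"
    using f' one by (simp add: cinner_L2_class)
  also have "\<dots> \<le> norm (L2_class (\<lambda>z. complex_of_real (norm (f z)))) * norm (L2_class (\<lambda>z. 1))"
    by (rule cinner_Cauchy_Schwarz)
  also have "norm (L2_class (\<lambda>z. complex_of_real (norm (f z)))) = norm (L2_class f)"
    by (rule power2_eq_imp_eq) (use f f' in \<open>auto simp: norm_L2_class\<close>)
  also have "norm (L2_class (\<lambda>z. 1)) = 1"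
    by (rule power2_eq_imp_eq) (simp_all add: norm_L2_class[OF one])
  finally show ?thesis
    using int by (simp add: nn_integral_eq_integral)
qed

text \<open>A rapidly Cauchy sequence of functions has summable \<open>L\<^sup>1\<close> increments, hence converges almost
  everywhere; Fatou's lemma shows that the pointwise limit is the limit in \<open>L\<^sup>2\<close>.\<close>

lemma rapidly_Cauchy_L2_converges:
  fixes X :: "nat \<Rightarrow> circle_L2"
  assumes X: "\<And>m n. n \<le> m \<Longrightarrow> norm (X m - X n) \<le> (1/2) ^ n"
  shows "\<exists>l. X \<longlonglongrightarrow> l"
proof -
  have "\<exists>f. \<forall>n. sq_integrable (f n) \<and> X n = L2_class (f n)"
    by (intro choice allI L2_class_exists)
  then obtain f where f: "\<And>n. sq_integrable (f n)" "\<And>n. X n = L2_class (f n)"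
    by blast
  have [measurable]: "f n \<in> borel_measurable circle_measure" for n
    using f(1) by (simp add: sq_integrable_def)
  have "(\<integral>\<^sup>+z. (\<Sum>n. ennreal (norm (f (Suc n) z - f n z))) \<partial>circle_measure)
      = (\<Sum>n. \<integral>\<^sup>+z. ennreal (norm (f (Suc n) z - f n z)) \<partial>circle_measure)"
    by (rule nn_integral_suminf) measurable
  also have "\<dots> \<le> (\<Sum>n. ennreal ((1/2) ^ n))"
  proof (rule suminf_le)
    fix n
    have "(\<integral>\<^sup>+z. ennreal (norm (f (Suc n) z - f n z)) \<partial>circle_measure)
        \<le> ennreal (norm (L2_class (\<lambda>z. f (Suc n) z - f n z)))"
      by (intro nn_integral_norm_le_norm_L2 sq_integrable_diff f)
    also have "L2_class (\<lambda>z. f (Suc n) z - f n z) = X (Suc n) - X n"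
      using f by (simp add: L2_class_diff)
    also have "ennreal (norm (X (Suc n) - X n)) \<le> ennreal ((1/2) ^ n)"
      by (intro ennreal_leI X) simp
    finally show "(\<integral>\<^sup>+z. ennreal (norm (f (Suc n) z - f n z)) \<partial>circle_measure) \<le> ennreal ((1/2) ^ n)" .
  qed auto
  also have "\<dots> < \<infinity>"
    by (subst suminf_ennreal2) (auto intro: summable_geometric)
  finally have "AE z in circle_measure. (\<Sum>n. ennreal (norm (f (Suc n) z - f n z))) \<noteq> \<infinity>"
    by (intro nn_integral_PInf_AE) auto
  then have conv: "AE z in circle_measure. (\<lambda>n. f n z) \<longlonglongrightarrow> lim (\<lambda>n. f n z)"
  proof eventually_elim
    case (elim z)
    then have "summable (\<lambda>n. norm (f (Suc n) z - f n z))"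
      by (intro summable_suminf_not_top) auto
    then have "summable (\<lambda>n. f (Suc n) z - f n z)"
      by (rule summable_norm_cancel)
    then have "convergent (\<lambda>n. f n z)"
      using sum_lessThan_telescope[of "\<lambda>n. f n z"] convergent_add_const_iff[of "- f 0 z" "\<lambda>n. f n z"]
      by (simp add: summable_iff_convergent)
    then show ?case by (simp add: convergent_LIMSEQ_iff)
  qed
  define F where "F = (\<lambda>z. lim (\<lambda>n. f n z))"
  have F [measurable]: "F \<in> borel_measurable circle_measure"
    unfolding F_def by measurable
  have Fatou: "(\<integral>\<^sup>+z. ennreal ((norm (F z - f n z))\<^sup>2) \<partial>circle_measure) \<le> ennreal (((1/2) ^ n)\<^sup>2)" for n
  proof -
    have "(\<integral>\<^sup>+z. ennreal ((norm (F z - f n z))\<^sup>2) \<partial>circle_measure)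
        = (\<integral>\<^sup>+z. liminf (\<lambda>m. ennreal ((norm (f m z - f n z))\<^sup>2)) \<partial>circle_measure)"
    proof (rule nn_integral_cong_AE, use conv in eventually_elim)
      case (elim z)
      then have "(\<lambda>m. ennreal ((norm (f m z - f n z))\<^sup>2)) \<longlonglongrightarrow> ennreal ((norm (F z - f n z))\<^sup>2)"
        unfolding F_def by (intro tendsto_intros)
      then show ?case
        by (rule lim_imp_Liminf[OF sequentially_bot, symmetric])
    qed
    also have "\<dots> \<le> liminf (\<lambda>m. \<integral>\<^sup>+z. ennreal ((norm (f m z - f n z))\<^sup>2) \<partial>circle_measure)"
      by (rule nn_integral_liminf) measurable
    also have "\<dots> \<le> liminf (\<lambda>m::nat. ennreal (((1/2) ^ n)\<^sup>2))"
    proof (rule Liminf_mono)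
      have "(\<integral>\<^sup>+z. ennreal ((norm (f m z - f n z))\<^sup>2) \<partial>circle_measure) \<le> ennreal (((1/2) ^ n)\<^sup>2)"
        if "n \<le> m" for m
      proof -
        have sq: "sq_integrable (\<lambda>z. f m z - f n z)"
          by (intro sq_integrable_diff f)
        then have "(\<integral>\<^sup>+z. ennreal ((norm (f m z - f n z))\<^sup>2) \<partial>circle_measure)
            = ennreal ((norm (L2_class (\<lambda>z. f m z - f n z)))\<^sup>2)"
          unfolding norm_L2_class[OF sq]
          by (intro nn_integral_eq_integral) (auto simp: sq_integrable_def)
        also have "L2_class (\<lambda>z. f m z - f n z) = X m - X n"
          using f by (simp add: L2_class_diff)
        finally show ?thesis
          using X[OF that] by (simp add: ennreal_leI power_mono)
      qed
      then show "\<forall>\<^sub>F m in sequentially.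
          (\<integral>\<^sup>+z. ennreal ((norm (f m z - f n z))\<^sup>2) \<partial>circle_measure) \<le> ennreal (((1/2) ^ n)\<^sup>2)"
        by (intro eventually_mono[OF eventually_ge_at_top[of n]])
    qed
    also have "\<dots> = ennreal (((1/2) ^ n)\<^sup>2)"
      by (simp add: Liminf_const)
    finally show ?thesis .
  qed
  have sqFf: "sq_integrable (\<lambda>z. F z - f n z)" for n
  proof -
    have "(\<integral>\<^sup>+z. ennreal ((norm (F z - f n z))\<^sup>2) \<partial>circle_measure) < \<infinity>"
      using Fatou[of n] by (rule order_le_less_trans) simp
    then show ?thesis
      unfolding sq_integrable_def by (auto intro!: integrableI_nonneg)
  qed
  have sqF: "sq_integrable F"
    using sq_integrable_add[OF sqFf[of 0] f(1)[of 0]] by simp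
  have "norm (L2_class F - X n) \<le> (1/2) ^ n" for n
  proof -
    have "ennreal ((norm (L2_class (\<lambda>z. F z - f n z)))\<^sup>2)
        = (\<integral>\<^sup>+z. ennreal ((norm (F z - f n z))\<^sup>2) \<partial>circle_measure)"
      unfolding norm_L2_class[OF sqFf]
      by (intro nn_integral_eq_integral[symmetric]) (use sqFf in \<open>auto simp: sq_integrable_def\<close>)
    with Fatou[of n] have "ennreal ((norm (L2_class (\<lambda>z. F z - f n z)))\<^sup>2) \<le> ennreal (((1/2) ^ n)\<^sup>2)"
      by metis
    then have "(norm (L2_class (\<lambda>z. F z - f n z)))\<^sup>2 \<le> ((1/2) ^ n)\<^sup>2"
      by (subst (asm) ennreal_le_iff) auto
    then have "norm (L2_class (\<lambda>z. F z - f n z)) \<le> (1/2) ^ n"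
      by (rule power2_le_imp_le) simp
    then show ?thesis
      using sqF f by (simp add: L2_class_diff)
  qed
  then have "norm (X n - L2_class F) \<le> (1/2) ^ n" for n
    by (simp add: norm_minus_commute)
  then have "(\<lambda>n. X n - L2_class F) \<longlonglongrightarrow> 0"
    by (intro Lim_null_comparison[OF _ LIMSEQ_power_zero]) (auto intro!: always_eventually)
  then show ?thesis
    using LIM_zero_cancel by blast
qed

text \<open>A Cauchy sequence has a rapidly Cauchy subsequence, and it converges once a subsequence
  does.\<close>

lemma complete_circle_L2: "complete (UNIV :: circle_L2 set)"
  unfolding complete_def
proof (intro allI impI, elim conjE)
  fix X :: "nat \<Rightarrow> circle_L2" assume X: "Cauchy X"
  obtain r :: "nat \<Rightarrow> nat" where r: "strict_mono r" "\<And>n m. n \<le> m \<Longrightarrow> norm (X (r m) - X (r n)) \<le> (1/2) ^ n"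
  proof -
    have "\<exists>N. \<forall>m\<ge>N. \<forall>n\<ge>N. norm (X m - X n) < (1/2) ^ k" for k
      using X CauchyD[of X "(1/2) ^ k"] by simp
    then obtain N where N: "\<And>k m n. m \<ge> N k \<Longrightarrow> n \<ge> N k \<Longrightarrow> norm (X m - X n) < (1/2) ^ k"
      by metis
    \<comment> \<open>The sum makes the sequence increasing and at least \<open>N\<close>.\<close>
    define r where "r k = (\<Sum>i\<le>k. Suc (N i))" for k
    have "strict_mono r"
      unfolding r_def by (rule strict_mono_Suc_iff[THEN iffD2]) simp
    moreover have "N k \<le> r k" for k
      unfolding r_def by (rule order_trans[OF _ member_le_sum[of k]]) auto
    ultimately show ?thesis
      using N that[of r] by (meson less_imp_le order_trans strict_mono_less_eq)
  qed
  obtain l where "(\<lambda>n. X (r n)) \<longlonglongrightarrow> l"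
    using rapidly_Cauchy_L2_converges[of "\<lambda>n. X (r n)"] r(2) by blast
  then show "\<exists>l\<in>UNIV. X \<longlonglongrightarrow> l"
    using Cauchy_converges_subseq[OF X r(1)] by (auto simp: o_def)
qed

section \<open>Multiplication operators on \<open>L\<^sup>2\<close>\<close>

lemma mult_L2_class:
  "\<phi> \<in> Linfty \<Longrightarrow> sq_integrable f \<Longrightarrow> mult_L2 \<phi> (L2_class f) = L2_class (\<lambda>z. \<phi> z * f z)"
  by transfer (auto simp: L2_rel_def Linfty_def intro: sq_integrable_mult_bounded)

lemma sq_integrable_mult_Linfty: "\<phi> \<in> Linfty \<Longrightarrow> sq_integrable f \<Longrightarrow> sq_integrable (\<lambda>z. \<phi> z * f z)"
  by (auto simp: Linfty_def intro: sq_integrable_mult_bounded)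

lemmas mult_L2_class_simps = mult_L2_class sq_integrable_mult_Linfty continuous_on_circle_Linfty
  L2_class_add L2_class_diff L2_class_scaleC sq_integrable_add sq_integrable_cmult cinner_L2_class

context
  fixes \<phi> :: "complex \<Rightarrow> complex"
  assumes \<phi>: "continuous_on (sphere 0 1) \<phi>"
begin

lemma mult_L2_add: "mult_L2 \<phi> (x + y) = mult_L2 \<phi> x + mult_L2 \<phi> y"
  using L2_class_exists[of x] L2_class_exists[of y] \<phi>
  by (auto simp: mult_L2_class_simps distrib_left)

lemma mult_L2_scaleC: "mult_L2 \<phi> (c *\<^sub>C x) = c *\<^sub>C mult_L2 \<phi> x"
  using L2_class_exists[of x] \<phi> by (auto simp: mult_L2_class_simps mult.left_commute)

lemma mult_L2_diff: "mult_L2 \<phi> (x - y) = mult_L2 \<phi> x - mult_L2 \<phi> y"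
  using mult_L2_add[of x "- y"] mult_L2_scaleC[of "-1" y] by (simp add: scaleC_minus_one)

lemma mult_L2_zero: "mult_L2 \<phi> 0 = 0"
  using mult_L2_diff[of 0 0] by simp

lemma mult_L2_mult:
  "continuous_on (sphere 0 1) \<psi> \<Longrightarrow> mult_L2 \<phi> (mult_L2 \<psi> x) = mult_L2 (\<lambda>z. \<phi> z * \<psi> z) x"
  using L2_class_exists[of x] \<phi> by (auto simp: mult_L2_class_simps continuous_on_mult mult.assoc)

lemma mult_L2_plus:
  "continuous_on (sphere 0 1) \<psi> \<Longrightarrow> mult_L2 (\<lambda>z. \<phi> z + \<psi> z) x = mult_L2 \<phi> x + mult_L2 \<psi> x"
  using L2_class_exists[of x] \<phi> by (auto simp: mult_L2_class_simps continuous_on_add distrib_right)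

lemma cinner_mult_L2: "cinner (mult_L2 \<phi> x) y = cinner x (mult_L2 (\<lambda>z. cnj (\<phi> z)) y)"
proof -
  obtain f g where f: "sq_integrable f" "x = L2_class f" and g: "sq_integrable g" "y = L2_class g"
    using L2_class_exists[of x] L2_class_exists[of y] by blast
  have \<phi>': "\<phi> \<in> Linfty" "(\<lambda>z. cnj (\<phi> z)) \<in> Linfty"
    using \<phi> by (auto intro!: continuous_on_circle_Linfty continuous_on_cnj)
  have "cinner (mult_L2 \<phi> x) y = (LINT z|circle_measure. \<phi> z * f z * cnj (g z))"
    unfolding f(2) g(2) mult_L2_class[OF \<phi>'(1) f(1)]
    by (intro cinner_L2_class sq_integrable_mult_Linfty \<phi>' f g)
  also have "\<dots> = (LINT z|circle_measure. f z * cnj (cnj (\<phi> z) * g z))"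
    by (simp add: mult.commute mult.left_commute)
  also have "\<dots> = cinner x (mult_L2 (\<lambda>z. cnj (\<phi> z)) y)"
    unfolding f(2) g(2) mult_L2_class[OF \<phi>'(2) g(1)]
    by (intro cinner_L2_class[symmetric] sq_integrable_mult_Linfty \<phi>' f g)
  finally show ?thesis .
qed

lemma norm_mult_L2_le:
  assumes K: "\<And>z. z \<in> sphere 0 1 \<Longrightarrow> norm (\<phi> z) \<le> K"
  shows "norm (mult_L2 \<phi> x) \<le> K * norm x"
proof -
  obtain f where f: "sq_integrable f" "x = L2_class f"
    using L2_class_exists by blast
  have "norm (\<phi> 1) \<le> K" using K[of 1] by simp
  then have "0 \<le> K" using norm_ge_zero order_trans by blast
  have sq: "sq_integrable (\<lambda>z. \<phi> z * f z)"
    using f \<phi> by (simp add: mult_L2_class_simps)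
  have "(norm (mult_L2 \<phi> x))\<^sup>2 = (LINT z|circle_measure. (norm (\<phi> z * f z))\<^sup>2)"
    using f \<phi> sq by (simp add: mult_L2_class_simps norm_L2_class)
  also have "\<dots> \<le> (LINT z|circle_measure. K\<^sup>2 * (norm (f z))\<^sup>2)"
    using sq f(1) K
    by (intro integral_mono) (auto simp: sq_integrable_def norm_mult power_mult_distrib
        intro!: mult_right_mono power_mono)
  also have "\<dots> = (K * norm x)\<^sup>2"
    using f by (simp add: norm_L2_class power_mult_distrib)
  finally show ?thesis
    by (rule power2_le_imp_le) (simp add: \<open>0 \<le> K\<close>)
qed

lemma tendsto_mult_L2: "X \<longlonglongrightarrow> l \<Longrightarrow> (\<lambda>n. mult_L2 \<phi> (X n)) \<longlonglongrightarrow> mult_L2 \<phi> l"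
proof -
  assume X: "X \<longlonglongrightarrow> l"
  obtain K where K: "\<And>z. z \<in> sphere 0 1 \<Longrightarrow> norm (\<phi> z) \<le> K"
    using continuous_on_circle_bounded[OF \<phi>] by blast
  have "(\<lambda>n. K * norm (X n - l)) \<longlonglongrightarrow> K * norm (l - l)"
    using X by (intro tendsto_intros)
  then have lim: "(\<lambda>n. K * norm (X n - l)) \<longlonglongrightarrow> 0"
    by simp
  have "norm (mult_L2 \<phi> (X n) - mult_L2 \<phi> l) \<le> K * norm (X n - l)" for n
    unfolding mult_L2_diff[symmetric] using K by (rule norm_mult_L2_le)
  then have "(\<lambda>n. mult_L2 \<phi> (X n) - mult_L2 \<phi> l) \<longlonglongrightarrow> 0"
    by (intro Lim_null_comparison[OF _ lim] always_eventually allI)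
  then show ?thesis by (rule LIM_zero_cancel)
qed

end

lemma mult_L2_cong:
  assumes "continuous_on (sphere 0 1) \<phi>" "\<And>z. z \<in> sphere 0 1 \<Longrightarrow> \<phi> z = \<psi> z"
  shows "mult_L2 \<phi> x = mult_L2 \<psi> x"
proof -
  have "continuous_on (sphere 0 1) \<psi> \<longleftrightarrow> continuous_on (sphere 0 1) \<phi>"
    by (rule continuous_on_cong[OF refl]) (simp add: assms(2))
  then have \<psi>: "continuous_on (sphere 0 1) \<psi>"
    using assms(1) by simp
  obtain f where f: "sq_integrable f" "x = L2_class f"
    using L2_class_exists by blast
  have "L2_class (\<lambda>z. \<phi> z * f z) = L2_class (\<lambda>z. \<psi> z * f z)"
    by (rule L2_class_cong) (simp add: assms(2))
  then show ?thesis
    using f assms(1) \<psi> by (simp add: mult_L2_class_simps)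
qed

lemma mult_L2_const: "mult_L2 (\<lambda>z. c) x = c *\<^sub>C x"
  using L2_class_exists[of x] by (auto simp: mult_L2_class_simps)

section \<open>The disc algebra and the Szego kernel\<close>

definition disc_algebra :: "(complex \<Rightarrow> complex) set" where
  "disc_algebra = {h. continuous_on (cball 0 1) h \<and> h holomorphic_on ball 0 1}"

lemma disc_algebraD:
  assumes "h \<in> disc_algebra"
  shows "continuous_on (cball 0 1) h" "h holomorphic_on ball 0 1" "continuous_on (sphere 0 1) h"
    "sq_integrable h"
proof -
  show *: "continuous_on (cball 0 1) h" "h holomorphic_on ball 0 1"
    using assms by (auto simp: disc_algebra_def)
  then show "continuous_on (sphere 0 1) h"
    by (auto intro: continuous_on_subset)
  then show "sq_integrable h"
    by (rule sq_integrable_continuous)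
qed

named_theorems disc_algebra_intros

lemma disc_algebra_const [disc_algebra_intros]: "(\<lambda>z. c) \<in> disc_algebra"
  and disc_algebra_id [disc_algebra_intros]: "(\<lambda>z. z) \<in> disc_algebra"
  and disc_algebra_add [disc_algebra_intros]:
    "h \<in> disc_algebra \<Longrightarrow> k \<in> disc_algebra \<Longrightarrow> (\<lambda>z. h z + k z) \<in> disc_algebra"
  and disc_algebra_diff [disc_algebra_intros]:
    "h \<in> disc_algebra \<Longrightarrow> k \<in> disc_algebra \<Longrightarrow> (\<lambda>z. h z - k z) \<in> disc_algebra"
  and disc_algebra_mult [disc_algebra_intros]:
    "h \<in> disc_algebra \<Longrightarrow> k \<in> disc_algebra \<Longrightarrow> (\<lambda>z. h z * k z) \<in> disc_algebra"
  by (auto simp: disc_algebra_def intro!: continuous_intros holomorphic_intros)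

lemma disc_algebra_divide [disc_algebra_intros]:
  assumes "h \<in> disc_algebra" "k \<in> disc_algebra" "\<And>z. z \<in> cball 0 1 \<Longrightarrow> k z \<noteq> 0"
  shows "(\<lambda>z. h z / k z) \<in> disc_algebra"
  using assms by (auto simp: disc_algebra_def intro!: continuous_intros holomorphic_intros)

lemma disc_algebra_sum [disc_algebra_intros]:
  "(\<And>i. i \<in> I \<Longrightarrow> f i \<in> disc_algebra) \<Longrightarrow> (\<lambda>z. \<Sum>i\<in>I. f i z) \<in> disc_algebra"
  by (auto simp: disc_algebra_def intro!: continuous_intros holomorphic_intros)

lemma disc_algebra_power [disc_algebra_intros]: "h \<in> disc_algebra \<Longrightarrow> (\<lambda>z. h z ^ n) \<in> disc_algebra"
  by (auto simp: disc_algebra_def intro!: continuous_intros holomorphic_intros)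

lemma disc_algebra_compose:
  assumes "h \<in> disc_algebra" "k \<in> disc_algebra" "\<And>z. z \<in> cball 0 1 \<Longrightarrow> k z \<in> cball 0 1"
    "\<And>z. z \<in> ball 0 1 \<Longrightarrow> k z \<in> ball 0 1"
  shows "(\<lambda>z. h (k z)) \<in> disc_algebra"
proof -
  have "continuous_on (cball 0 1) (\<lambda>z. h (k z))"
    using assms by (intro continuous_on_compose2[of "cball 0 1" h "cball 0 1" k]) (auto simp: disc_algebra_def)
  moreover have "(h \<circ> k) holomorphic_on ball 0 1"
    using assms by (intro holomorphic_on_compose_gen[of k _ h "ball 0 1"]) (auto simp: disc_algebra_def)
  ultimately show ?thesis
    by (simp add: disc_algebra_def o_def)
qed

lemma disc_algebra_cong:
  assumes "h \<in> disc_algebra" "\<And>z. z \<in> cball 0 1 \<Longrightarrow> h z = k z"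
  shows "k \<in> disc_algebra"
proof -
  have "continuous_on (cball 0 1) h = continuous_on (cball 0 1) k"
    using assms(2) by (intro continuous_on_cong) auto
  moreover have "h holomorphic_on ball 0 1 \<longleftrightarrow> k holomorphic_on ball 0 1"
    using assms(2) by (intro holomorphic_cong) auto
  ultimately show ?thesis
    using assms(1) by (simp add: disc_algebra_def)
qed

lemma mult_lt_one_neq: "norm (a::complex) < 1 \<Longrightarrow> norm b \<le> 1 \<Longrightarrow> 1 - a * b \<noteq> 0"
proof
  assume *: "norm a < 1" "norm b \<le> 1" and "1 - a * b = 0"
  then have "norm (a * b) = 1" by simp
  moreover have "norm (a * b) \<le> norm a * 1"
    unfolding norm_mult using * by (intro mult_left_mono) auto
  ultimately show False using * by simp
qed

text \<open>The reproducing kernel of the Hardy space at the point \<open>z\<close>.\<close>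

definition szego_kernel :: "complex \<Rightarrow> complex \<Rightarrow> complex" where
  "szego_kernel z w = 1 / (1 - cnj z * w)"

definition szego :: "complex \<Rightarrow> circle_L2" where
  "szego z = L2_class (szego_kernel z)"

lemma szego_kernel_disc_algebra: "z \<in> ball 0 1 \<Longrightarrow> szego_kernel z \<in> disc_algebra"
  unfolding szego_kernel_def[abs_def]
  by (intro disc_algebra_intros mult_lt_one_neq) auto

lemma cinner_L2_class_szego:
  assumes "h \<in> disc_algebra" "z \<in> ball 0 1"
  shows "cinner (L2_class h) (szego z) = h z"
  using disc_algebraD[OF assms(1)] disc_algebraD(4)[OF szego_kernel_disc_algebra[OF assms(2)]]
    circle_integral_Cauchy[OF _ _ assms(2), of h]
  by (simp add: szego_def cinner_L2_class szego_kernel_def)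

lemma norm_szego_le:
  assumes "z \<in> ball 0 1"
  shows "norm (szego z) \<le> 1 / (1 - norm z)"
  unfolding szego_def
proof (rule norm_L2_class_le)
  show "sq_integrable (szego_kernel z)"
    using szego_kernel_disc_algebra[OF assms] by (rule disc_algebraD)
  have "norm (szego_kernel z w) \<le> 1 / (1 - norm z)" if "w \<in> sphere 0 1" for w
  proof -
    have "1 - norm z \<le> norm (1 - cnj z * w)"
      using that norm_triangle_ineq2[of 1 "cnj z * w"] by (simp add: norm_mult)
    then show ?thesis
      using assms by (simp add: szego_kernel_def norm_divide frac_le)
  qed
  then show "AE w in circle_measure. norm (szego_kernel z w) \<le> 1 / (1 - norm z)"
    by (intro AE_I2) auto
qed (use assms in auto)

section \<open>The Hardy space as the closure of the disc algebra\<close>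

abbreviation H2 :: "circle_L2 set" where
  "H2 \<equiv> Hardy_circle"

abbreviation dilation :: "real \<Rightarrow> (complex \<Rightarrow> complex) \<Rightarrow> circle_L2" where
  "dilation r h \<equiv> L2_class (\<lambda>w. h (complex_of_real r * w))"

lemma disc_algebra_uniformly_continuous:
  assumes h: "h \<in> disc_algebra" and "e > 0"
  obtains d where "d > 0"
    "\<And>x y. x \<in> cball 0 1 \<Longrightarrow> y \<in> cball 0 1 \<Longrightarrow> dist x y < d \<Longrightarrow> dist (h x) (h y) < e"
proof -
  have "uniformly_continuous_on (cball 0 1) h"
    using disc_algebraD(1)[OF h] by (intro compact_uniformly_continuous) auto
  then show ?thesis
    using \<open>e > 0\<close> that unfolding uniformly_continuous_on_def by blast
qed

text \<open>A dilation \<open>h (s z)\<close> with \<open>s < 1\<close> is uniformly close to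
  \<open>h\<close>, and the Taylor series of the dilation converges uniformly on the closed disc.\<close>

lemma disc_algebra_polynomial_approx:
  assumes h: "h \<in> disc_algebra" and "e > 0"
  shows "\<exists>p. (\<exists>N a. p = (\<lambda>z. \<Sum>k<N. a k * z ^ k)) \<and> (\<forall>z\<in>cball 0 1. norm (h z - p z) < e)"
proof -
  obtain d where d: "d > 0"
      "\<And>x y. x \<in> cball 0 1 \<Longrightarrow> y \<in> cball 0 1 \<Longrightarrow> dist x y < d \<Longrightarrow> dist (h x) (h y) < e/2"
    using disc_algebra_uniformly_continuous[OF h, of "e/2"] \<open>e > 0\<close> by auto
  \<comment> \<open>The lower bound \<open>1/2\<close> keeps \<open>s\<close> positive when \<open>d\<close> is large.\<close>
  define s where "s = max (1/2) (1 - d/2)"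
  have s: "0 < s" "s < 1" "1 - s < d" using d(1) by (auto simp: s_def)
  define a where "a = (\<lambda>n. (deriv ^^ n) h 0 / fact n)"
  have a: "(\<lambda>n. a n * w ^ n) sums h w" if "w \<in> ball 0 1" for w
    using holomorphic_power_series[OF disc_algebraD(2)[OF h] that] by (simp add: a_def)
  define t where "t = (s + 1) / 2"
  have t: "s < t" "0 < t" "t < 1" using s by (auto simp: t_def)
  have "complex_of_real t \<in> ball 0 1"
    using t by simp
  then have "ereal (norm (complex_of_real t)) \<le> conv_radius a"
    by (intro conv_radius_geI sums_summable[OF a])
  then have "ereal s < conv_radius a"
    using t less_le_trans[of "ereal s" "ereal t" "conv_radius a"] by simp
  then have "uniform_limit (cball 0 s) (\<lambda>n x. \<Sum>i<n. a i * (x - 0) ^ i)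
      (\<lambda>x. suminf (\<lambda>i. a i * (x - 0) ^ i)) sequentially"
    by (rule powser_uniform_limit)
  from uniform_limitD[OF this, of "e/2"] \<open>e > 0\<close>
  have "\<exists>N. \<forall>n\<ge>N. \<forall>x\<in>cball 0 s. dist (\<Sum>i<n. a i * x ^ i) (suminf (\<lambda>i. a i * x ^ i)) < e/2"
    unfolding eventually_sequentially by simp
  then obtain N where "\<forall>x\<in>cball 0 s. dist (\<Sum>i<N. a i * x ^ i) (suminf (\<lambda>i. a i * x ^ i)) < e/2"
    by blast
  then have N: "dist (\<Sum>i<N. a i * x ^ i) (suminf (\<lambda>i. a i * x ^ i)) < e/2" if "x \<in> cball 0 s" for x
    using that by blast
  have "norm (h z - (\<Sum>k<N. (a k * of_real s ^ k) * z ^ k)) < e" if z: "z \<in> cball 0 1" for z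
  proof -
    define w where "w = of_real s * z"
    have "norm w \<le> s * 1"
      unfolding w_def norm_mult using z s by (intro mult_mono) auto
    then have w: "w \<in> cball 0 s" "w \<in> ball 0 1" "w \<in> cball 0 1" using s by auto
    have "z - w = of_real (1 - s) * z"
      by (simp add: w_def algebra_simps)
    then have "norm (z - w) = \<bar>1 - s\<bar> * norm z"
      by (simp only: norm_mult norm_of_real)
    then have "norm (z - w) = (1 - s) * norm z"
      using s by simp
    also have "\<dots> \<le> (1 - s) * 1"
      using z s by (intro mult_left_mono) auto
    finally have "dist z w < d" using s by (simp add: dist_norm)
    then have "dist (h z) (h w) < e/2"
      using z w by (intro d)
    moreover have "dist (h w) (\<Sum>i<N. a i * w ^ i) < e/2"
      using N[OF w(1)] sums_unique[OF a[OF w(2)]] by (simp add: dist_commute)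
    ultimately have "dist (h z) (\<Sum>i<N. a i * w ^ i) < e"
      using dist_triangle[of "h z" "\<Sum>i<N. a i * w ^ i" "h w"] by linarith
    then show ?thesis
      by (simp add: dist_norm w_def power_mult_distrib mult.assoc)
  qed
  then show ?thesis
    by (intro exI[of _ "\<lambda>z. \<Sum>k<N. (a k * of_real s ^ k) * z ^ k"] exI[of _ N]
        exI[of _ "\<lambda>k. a k * of_real s ^ k"] conjI ballI refl)
qed

lemma norm_L2_class_diff_le:
  assumes "h \<in> disc_algebra" "k \<in> disc_algebra" "\<And>z. z \<in> sphere 0 1 \<Longrightarrow> norm (h z - k z) \<le> e"
  shows "norm (L2_class h - L2_class k) \<le> e"
proof -
  have "norm (h 1 - k 1) \<le> e" using assms(3)[of 1] by simp
  then have "0 \<le> e" using norm_ge_zero order_trans by blast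
  have "norm (L2_class (\<lambda>z. h z - k z)) \<le> e"
    using assms \<open>0 \<le> e\<close> by (intro norm_L2_class_le sq_integrable_diff disc_algebraD AE_I2) auto
  then show ?thesis
    using assms(1,2) by (simp add: L2_class_diff disc_algebraD)
qed

text \<open>Distinct powers of \<open>z\<close> are orthogonal on the circle.\<close>

lemma norm_L2_class_polynomial:
  "(norm (L2_class (\<lambda>z. \<Sum>k<N. a k * z ^ k)))\<^sup>2 = (\<Sum>k<N. (norm (a k))\<^sup>2)"
proof (induction N)
  case 0
  show ?case
    using norm_L2_class[OF sq_integrable_zero] by simp
next
  case (Suc N)
  define p where "p = (\<lambda>z. \<Sum>k<N. a k * z ^ k)"
  define m where "m = (\<lambda>z. a N * z ^ N)"
  have p: "sq_integrable p" and m: "sq_integrable m"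
    unfolding p_def m_def by (intro disc_algebraD disc_algebra_intros)+
  have szego0: "szego 0 = L2_class (\<lambda>z. 1)"
    by (simp add: szego_def szego_kernel_def[abs_def])
  have one: "sq_integrable (\<lambda>z. 1)"
    by (intro disc_algebraD disc_algebra_intros)
  have unit: "z * cnj z = 1" if "z \<in> sphere 0 1" for z
    using that complex_norm_square[of z] by simp
  \<comment> \<open>On the circle \<open>m \<cdot> cnj p\<close> is a polynomial without constant term, whose mean is its value at \<open>0\<close>.\<close>
  have "cinner (L2_class m) (L2_class p) = (LINT z|circle_measure. (\<Sum>k<N. a N * cnj (a k) * z ^ (N - k)) * cnj 1)"
    unfolding cinner_L2_class[OF m p]
  proof (rule Bochner_Integration.integral_cong[OF refl])
    fix z :: complex assume "z \<in> space circle_measure"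
    then have z: "z * cnj z = 1" using unit by simp
    have "z ^ N * cnj z ^ k = z ^ (N - k)" if "k < N" for k
    proof -
      have "z ^ N = z ^ (N - k) * z ^ k"
        using that by (simp flip: power_add)
      then show ?thesis
        using z by (simp add: mult.assoc flip: power_mult_distrib)
    qed
    then show "m z * cnj (p z) = (\<Sum>k<N. a N * cnj (a k) * z ^ (N - k)) * cnj 1"
      by (auto simp: m_def p_def sum_distrib_left intro!: sum.cong)
  qed
  also have "\<dots> = cinner (L2_class (\<lambda>z. \<Sum>k<N. a N * cnj (a k) * z ^ (N - k))) (szego 0)"
    unfolding szego0 by (subst cinner_L2_class) (intro disc_algebraD disc_algebra_intros one refl)+
  also have "\<dots> = (\<Sum>k<N. a N * cnj (a k) * 0 ^ (N - k))"
    by (rule cinner_L2_class_szego) (auto intro!: disc_algebra_intros)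
  also have "\<dots> = 0" by (intro sum.neutral) auto
  finally have orth: "cinner (L2_class m) (L2_class p) = 0" .
  have "(norm (L2_class m))\<^sup>2 = (LINT z|circle_measure. (norm (a N))\<^sup>2)"
    unfolding norm_L2_class[OF m]
    by (rule Bochner_Integration.integral_cong[OF refl]) (auto simp: m_def norm_mult norm_power)
  then have m2: "(norm (L2_class m))\<^sup>2 = (norm (a N))\<^sup>2" by simp
  have "L2_class (\<lambda>z. \<Sum>k<Suc N. a k * z ^ k) = L2_class p + L2_class m"
    using p m by (simp add: L2_class_add) (simp add: p_def m_def)
  moreover have "(norm (L2_class p + L2_class m))\<^sup>2 = (norm (L2_class p))\<^sup>2 + (norm (L2_class m))\<^sup>2"
  proof -
    have "inner (L2_class m) (L2_class p) = 0"
      using orth by (simp add: inner_eq_Re_cinner)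
    moreover from this have "inner (L2_class p) (L2_class m) = 0"
      by (subst inner_commute)
    ultimately show ?thesis
      by (simp add: power2_norm_eq_inner inner_add_left inner_add_right)
  qed
  ultimately show ?case
    using Suc m2 by (simp add: p_def)
qed

lemma dilation_disc_algebra:
  assumes "f holomorphic_on ball 0 1" "0 \<le> r" "r < 1"
  shows "(\<lambda>w. f (of_real r * w)) \<in> disc_algebra"
proof -
  have sub: "of_real r * w \<in> ball (0::complex) 1" if "w \<in> cball 0 1" for w :: complex
  proof -
    have "r * norm w \<le> r * 1" using that assms(2) by (intro mult_left_mono) auto
    then show ?thesis using assms(2,3) by (simp add: norm_mult)
  qed
  have cont: "continuous_on (cball 0 1) (\<lambda>w. f (of_real r * w))"
  proof (rule continuous_on_compose2[OF holomorphic_on_imp_continuous_on[OF assms(1)]])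
    show "continuous_on (cball 0 1) (\<lambda>w. complex_of_real r * w)"
      by (intro continuous_intros)
  qed (use sub in blast)
  have "(f \<circ> (\<lambda>w. of_real r * w)) holomorphic_on ball 0 1"
  proof (rule holomorphic_on_compose_gen[OF _ assms(1)])
    show "(\<lambda>w. complex_of_real r * w) holomorphic_on ball 0 1"
      by (intro holomorphic_intros)
    show "(\<lambda>w. complex_of_real r * w) ` ball 0 1 \<subseteq> ball 0 1"
    proof (rule image_subsetI)
      fix w :: complex assume "w \<in> ball 0 1"
      then show "of_real r * w \<in> ball 0 1" by (intro sub) simp
    qed
  qed
  with cont show ?thesis by (simp add: disc_algebra_def o_def)
qed

text \<open>For polynomials this is Pythagoras' theorem: dilation multiplies the \<open>k\<close>-th coefficient by \<open>r\<^sup>k\<close>.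
  The general case follows by uniform approximation.\<close>

lemma norm_dilation_le:
  assumes h: "h \<in> disc_algebra" and r: "0 \<le> r" "r < 1"
  shows "norm (dilation r h) \<le> norm (L2_class h)"
proof (rule field_le_epsilon)
  fix e :: real assume "e > 0"
  obtain p N a where p_def: "p = (\<lambda>z. \<Sum>k<N. a k * z ^ k)"
      and Na: "\<And>z. z \<in> cball 0 1 \<Longrightarrow> norm (h z - p z) < e/2"
    using disc_algebra_polynomial_approx[OF h half_gt_zero[OF \<open>e > 0\<close>]] by blast
  have p: "p \<in> disc_algebra" unfolding p_def by (intro disc_algebra_intros)
  have sub: "of_real r * w \<in> cball 0 1" if "w \<in> sphere 0 1" for w :: complex
    using that r by (simp add: norm_mult)
  have "norm (dilation r h - dilation r p) \<le> e/2"
    by (intro norm_L2_class_diff_le dilation_disc_algebra disc_algebraD(2) h p r less_imp_le[OF Na] sub)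
  moreover have "norm (L2_class p - L2_class h) \<le> e/2"
  proof (intro norm_L2_class_diff_le h p)
    fix z :: complex assume "z \<in> sphere 0 1"
    then show "norm (p z - h z) \<le> e/2"
      using Na[of z] by (simp add: norm_minus_commute)
  qed
  moreover have "norm (dilation r p) \<le> norm (L2_class p)"
  proof (rule power2_le_imp_le)
    have "(\<lambda>w. p (of_real r * w)) = (\<lambda>z. \<Sum>k<N. (a k * of_real r ^ k) * z ^ k)"
      by (auto simp: p_def power_mult_distrib mult.assoc)
    then have "(norm (dilation r p))\<^sup>2 = (\<Sum>k<N. (norm (a k * of_real r ^ k))\<^sup>2)"
      by (simp only: norm_L2_class_polynomial)
    also have "\<dots> \<le> (\<Sum>k<N. (norm (a k))\<^sup>2)"
      using r by (intro sum_mono power_mono) (auto simp: norm_mult norm_power power_le_one mult_left_le)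
    also have "\<dots> = (norm (L2_class p))\<^sup>2"
      by (simp only: norm_L2_class_polynomial p_def)
    finally show "(norm (dilation r p))\<^sup>2 \<le> (norm (L2_class p))\<^sup>2" .
  qed simp
  ultimately show "norm (dilation r h) \<le> norm (L2_class h) + e"
    using norm_triangle_sub[of "dilation r h" "dilation r p"]
      norm_triangle_sub[of "L2_class p" "L2_class h"] by linarith
qed

lemma dilation_tendsto:
  assumes h: "h \<in> disc_algebra"
  shows "((\<lambda>r. dilation r h) \<longlongrightarrow> L2_class h) (at_left (1::real))"
proof (rule tendstoI)
  fix e :: real assume "e > 0"
  obtain d where d: "d > 0"
      "\<And>x y. x \<in> cball 0 1 \<Longrightarrow> y \<in> cball 0 1 \<Longrightarrow> dist x y < d \<Longrightarrow> dist (h x) (h y) < e/2"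
    using disc_algebra_uniformly_continuous[OF h, of "e/2"] \<open>e > 0\<close> by auto
  have "eventually (\<lambda>r. r \<in> {max 0 (1 - d)<..<1}) (at_left (1::real))"
    by (rule eventually_at_leftI[of "max 0 (1 - d)"]) (use d in auto)
  then show "eventually (\<lambda>r. dist (dilation r h) (L2_class h) < e) (at_left (1::real))"
  proof eventually_elim
    case (elim r)
    have "norm (h (of_real r * w) - h w) \<le> e/2" if w: "w \<in> sphere 0 1" for w
    proof -
      have "of_real r * w - w = of_real (r - 1) * w" by (simp add: algebra_simps)
      then have "dist (of_real r * w) w = \<bar>r - 1\<bar> * norm w"
        by (simp only: dist_norm norm_mult norm_of_real)
      then have "dist (of_real r * w) w < d" using w elim by simp
      moreover have "of_real r * w \<in> cball 0 1" using w elim by (simp add: norm_mult)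
      ultimately show ?thesis
        using d(2)[of "of_real r * w" w] w by (simp add: dist_norm)
    qed
    then have "norm (dilation r h - L2_class h) \<le> e/2"
      using elim by (intro norm_L2_class_diff_le dilation_disc_algebra disc_algebraD(2) h) auto
    then show ?case using \<open>e > 0\<close> by (simp add: dist_norm)
  qed
qed

lemma csubspace_disc_algebra: "csubspace (L2_class ` disc_algebra)"
  unfolding csubspace_def
proof (intro conjI ballI allI)
  show "0 \<in> L2_class ` disc_algebra"
    by (rule image_eqI[of _ _ "\<lambda>z. 0"]) (use mult_L2_const[of 0 0] in \<open>auto intro: disc_algebra_intros simp: zero_circle_L2_def L2_class_def sq_integrable_zero\<close>)
next
  fix x y assume "x \<in> L2_class ` disc_algebra" "y \<in> L2_class ` disc_algebra"
  then show "x + y \<in> L2_class ` disc_algebra"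
    by (auto simp: L2_class_add disc_algebraD intro!: imageI disc_algebra_intros)
next
  fix c x assume "x \<in> L2_class ` disc_algebra"
  then show "c *\<^sub>C x \<in> L2_class ` disc_algebra"
    by (auto simp: L2_class_scaleC disc_algebraD intro!: imageI disc_algebra_intros)
qed

text \<open>An element \<open>g\<close> of the closure is the boundary function of \<open>z \<mapsto> cinner g (szego z)\<close>: this holds
  on the disc algebra by Cauchy's formula, and dilations are contractive.\<close>

lemma boundary_function_closure_disc_algebra:
  assumes g: "g \<in> closure (L2_class ` disc_algebra)"
  defines "f \<equiv> \<lambda>z. cinner g (szego z)"
  shows "f \<in> Hardy_disc" and "boundary_function f g"
proof -
  obtain X where X: "\<And>n. X n \<in> L2_class ` disc_algebra" "X \<longlonglongrightarrow> g"
    using g by (auto simp: closure_sequential)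
  then have "\<exists>h. \<forall>n. h n \<in> disc_algebra \<and> X n = L2_class (h n)"
    by (intro choice) auto
  then obtain h where h: "\<And>n. h n \<in> disc_algebra" and Xh: "X = (\<lambda>n. L2_class (h n))"
    by blast
  have lim: "(\<lambda>n. L2_class (h n)) \<longlonglongrightarrow> g" using X(2) by (simp add: Xh)
  have hf: "norm (h n z - f z) \<le> norm (L2_class (h n) - g) * (1 / (1 - norm z))" if "z \<in> ball 0 1" for n z
  proof -
    have "h n z - f z = cinner (L2_class (h n) - g) (szego z)"
      using that by (simp add: cinner_L2_class_szego h f_def cinner_diff_left)
    then have "norm (h n z - f z) \<le> norm (L2_class (h n) - g) * norm (szego z)"
      by (simp add: cinner_Cauchy_Schwarz)
    also have "\<dots> \<le> norm (L2_class (h n) - g) * (1 / (1 - norm z))"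
      using that by (intro mult_left_mono norm_szego_le) auto
    finally show ?thesis .
  qed
  have unif: "uniform_limit (cball 0 r) h f sequentially" if r: "r < 1" for r
  proof (rule uniform_limitI)
    fix e :: real assume "e > 0"
    have "(\<lambda>n. norm (L2_class (h n) - g) * (1 / (1 - r))) \<longlonglongrightarrow> norm (g - g) * (1 / (1 - r))"
      by (intro tendsto_intros lim)
    then have "\<forall>\<^sub>F n in sequentially. norm (L2_class (h n) - g) * (1 / (1 - r)) < e"
      using \<open>e > 0\<close> by (intro order_tendstoD(2)) auto
    then show "\<forall>\<^sub>F n in sequentially. \<forall>z\<in>cball 0 r. dist (h n z) (f z) < e"
    proof eventually_elim
      case (elim n)
      show ?case
      proof
        fix z :: complex assume z: "z \<in> cball 0 r"
        then have "norm (h n z - f z) \<le> norm (L2_class (h n) - g) * (1 / (1 - norm z))"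
          using r by (intro hf) auto
        also have "\<dots> \<le> norm (L2_class (h n) - g) * (1 / (1 - r))"
          using z r by (intro mult_left_mono divide_left_mono) auto
        finally show "dist (h n z) (f z) < e" using elim by (simp add: dist_norm)
      qed
    qed
  qed
  have hol: "f holomorphic_on ball 0 1"
  proof (rule holomorphic_uniform_sequence)
    show "h n holomorphic_on ball 0 1" for n using h by (rule disc_algebraD(2))
    fix z :: complex assume z: "z \<in> ball 0 1"
    define d where "d = (1 - norm z) / 2"
    have sub: "cball z d \<subseteq> cball 0 (norm z + d)"
    proof
      fix x assume "x \<in> cball z d"
      then show "x \<in> cball 0 (norm z + d)"
        using norm_triangle_sub[of x z] by (simp add: dist_norm norm_minus_commute)
    qed
    have d: "norm z + d < 1" "0 < d" using z by (auto simp: d_def field_simps)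
    have "cball z d \<subseteq> ball 0 1"
      using sub d(1) by (auto simp: subset_iff)
    moreover have "uniform_limit (cball z d) h f sequentially"
      using sub by (rule uniform_limit_on_subset[OF unif[OF d(1)]])
    ultimately show "\<exists>d>0. cball z d \<subseteq> ball 0 1 \<and> uniform_limit (cball z d) h f sequentially"
      using d(2) by blast
  qed auto
  have dil: "(\<lambda>n. dilation r (h n)) \<longlonglongrightarrow> dilation r f"
    if r: "0 \<le> r" "r < 1" for r :: real
  proof (rule metric_LIMSEQ_I)
    fix e :: real assume "e > 0"
    then have "\<exists>N. \<forall>n\<ge>N. \<forall>z\<in>cball 0 r. dist (h n z) (f z) < e/2"
      using uniform_limitD[OF unif[OF r(2)], of "e/2"] unfolding eventually_sequentially by simp
    then obtain N where N: "\<And>n z. n \<ge> N \<Longrightarrow> z \<in> cball 0 r \<Longrightarrow> dist (h n z) (f z) < e/2"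
      by blast
    have le: "norm (dilation r (h n) - dilation r f) \<le> e/2" if "n \<ge> N" for n
    proof (rule norm_L2_class_diff_le[OF dilation_disc_algebra[OF disc_algebraD(2)[OF h] r] dilation_disc_algebra[OF hol r]])
      fix w :: complex assume "w \<in> sphere 0 1"
      then have "of_real r * w \<in> cball 0 r" using r by (simp add: norm_mult)
      from N[OF that this] show "norm (h n (of_real r * w) - f (of_real r * w)) \<le> e/2"
        by (simp add: dist_norm)
    qed
    have "dist (dilation r (h n)) (dilation r f) < e" if "n \<ge> N" for n
      unfolding dist_norm using le[OF that] \<open>e > 0\<close> by linarith
    then show "\<exists>N. \<forall>n\<ge>N. dist (dilation r (h n)) (dilation r f) < e"
      by blast
  qed
  have bound: "norm (dilation r f) \<le> norm g" if "0 \<le> r" "r < 1" for r :: real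
    by (rule LIMSEQ_le[OF tendsto_norm[OF dil[OF that]] tendsto_norm[OF lim]])
       (use norm_dilation_le[OF h that] in blast)
  show "f \<in> Hardy_disc"
    unfolding Hardy_disc_def mem_Collect_eq
  proof (intro conjI hol bdd_aboveI2)
    fix r :: real assume "r \<in> {0..<1}"
    then have r: "0 \<le> r" "r < 1" by auto
    have "(LINT w|circle_measure. (norm (f (of_real r * w)))\<^sup>2) = (norm (dilation r f))\<^sup>2"
      by (intro norm_L2_class[symmetric] disc_algebraD dilation_disc_algebra hol r)
    also have "\<dots> \<le> (norm g)\<^sup>2"
      by (intro power_mono bound r) auto
    finally show "(LINT w|circle_measure. (norm (f (of_real r * w)))\<^sup>2) \<le> (norm g)\<^sup>2" .
  qed
  have close: "norm (dilation r f - dilation r (h n)) \<le> norm (g - L2_class (h n))"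
    if r: "0 \<le> r" "r < 1" for r :: real and n
  proof (rule LIMSEQ_le)
    show "(\<lambda>m. norm (dilation r (h m) - dilation r (h n)))
        \<longlonglongrightarrow> norm (dilation r f - dilation r (h n))"
      by (intro tendsto_intros dil r)
    show "(\<lambda>m. norm (L2_class (h m) - L2_class (h n))) \<longlonglongrightarrow> norm (g - L2_class (h n))"
      by (intro tendsto_intros lim)
    have "norm (dilation r (h m) - dilation r (h n))
        \<le> norm (L2_class (h m) - L2_class (h n))" for m
    proof -
      have "(\<lambda>w. h m w - h n w) \<in> disc_algebra"
        by (intro disc_algebra_intros h)
      from norm_dilation_le[OF this r] show ?thesis
        by (simp add: L2_class_diff h r disc_algebraD dilation_disc_algebra)
    qed
    then show "\<exists>N. \<forall>m\<ge>N. norm (dilation r (h m) - dilation r (h n))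
        \<le> norm (L2_class (h m) - L2_class (h n))" by blast
  qed
  show "boundary_function f g"
    unfolding boundary_function_def
  proof (rule tendstoI)
    fix e :: real assume "e > 0"
    then obtain n where n: "dist (L2_class (h n)) g < e/3"
      using metric_LIMSEQ_D[OF lim, of "e/3"] by auto
    have "\<forall>\<^sub>F r in at_left (1::real). dist (dilation r (h n)) (L2_class (h n)) < e/3"
      using \<open>e > 0\<close> by (intro tendstoD[OF dilation_tendsto[OF h]]) auto
    moreover have "\<forall>\<^sub>F r in at_left (1::real). r \<in> {0<..<1}"
      by (rule eventually_at_leftI[of 0]) auto
    ultimately show "\<forall>\<^sub>F r in at_left (1::real). dist (dilation r f) g < e"
    proof eventually_elim
      case (elim r)
      have "dist (dilation r f) (dilation r (h n)) < e/3"
        using close[of r n] elim n by (simp add: dist_norm norm_minus_commute)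
      then show ?case
        using elim n dist_triangle[of "dilation r f" g "L2_class (h n)"]
          dist_triangle[of "dilation r f" "L2_class (h n)" "dilation r (h n)"]
        by linarith
    qed
  qed
qed

text \<open>A boundary function is by definition a limit of dilations, which belong to the disc
  algebra.\<close>

lemma Hardy_circle_eq_closure: "H2 = closure (L2_class ` disc_algebra)"
proof
  show "closure (L2_class ` disc_algebra) \<subseteq> H2"
    unfolding Hardy_circle_def using boundary_function_closure_disc_algebra by blast
  show "H2 \<subseteq> closure (L2_class ` disc_algebra)"
  proof
    fix g assume "g \<in> H2"
    then obtain f where f: "f holomorphic_on ball 0 1"
        "((\<lambda>r::real. dilation r f) \<longlongrightarrow> g) (at_left 1)"
      by (auto simp: Hardy_circle_def Hardy_disc_def boundary_function_def)
    have "\<forall>\<^sub>F r::real in at_left 1. dilation r f \<in> closure (L2_class ` disc_algebra)"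
    proof (rule eventually_at_leftI[of 0])
      fix r :: real assume "r \<in> {0<..<1}"
      then show "dilation r f \<in> closure (L2_class ` disc_algebra)"
        using dilation_disc_algebra[OF f(1), of r] closure_subset by fastforce
    qed simp
    then show "g \<in> closure (L2_class ` disc_algebra)"
      using f(2) by (intro Lim_in_closed_set[OF closed_closure]) auto
  qed
qed

lemma csubspace_Hardy: "csubspace H2"
  unfolding Hardy_circle_eq_closure by (intro csubspace_closure csubspace_disc_algebra)

lemma complete_Hardy: "complete H2"
proof -
  have "complete (UNIV \<inter> H2)"
    by (intro complete_Int_closed complete_circle_L2) (simp add: Hardy_circle_eq_closure)
  then show ?thesis by simp
qed

lemma L2_class_in_Hardy: "h \<in> disc_algebra \<Longrightarrow> L2_class h \<in> H2"
  unfolding Hardy_circle_eq_closure by (rule subsetD[OF closure_subset imageI])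

lemma szego_in_Hardy: "z \<in> ball 0 1 \<Longrightarrow> szego z \<in> H2"
  unfolding szego_def by (intro L2_class_in_Hardy szego_kernel_disc_algebra)

text \<open>The coefficients \<open>cinner f (szego z)\<close> are the values in the disc of the holomorphic
  function with boundary function \<open>f\<close>.\<close>

lemma szego_total:
  assumes "f \<in> H2" and "\<And>z. z \<in> ball 0 1 \<Longrightarrow> cinner f (szego z) = 0"
  shows "f = 0"
proof -
  have lim: "((\<lambda>r::real. L2_class (\<lambda>w. cinner f (szego (r * w)))) \<longlongrightarrow> f) (at_left 1)"
    using boundary_function_closure_disc_algebra(2)[OF assms(1)[unfolded Hardy_circle_eq_closure]]
    unfolding boundary_function_def .
  have "\<forall>\<^sub>F r::real in at_left 1. L2_class (\<lambda>w. cinner f (szego (r * w))) = 0"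
  proof (rule eventually_at_leftI[of 0])
    fix r :: real assume r: "r \<in> {0<..<1}"
    have "L2_class (\<lambda>w. cinner f (szego (r * w))) = L2_class (\<lambda>w. 0)"
      by (rule L2_class_cong, rule assms(2)) (use r in \<open>auto simp: norm_mult\<close>)
    also have "\<dots> = 0"
      using L2_class_diff[OF sq_integrable_zero sq_integrable_zero] by simp
    finally show "L2_class (\<lambda>w. cinner f (szego (r * w))) = 0" .
  qed simp
  then have "((\<lambda>r::real. L2_class (\<lambda>w. cinner f (szego (r * w)))) \<longlongrightarrow> 0) (at_left 1)"
    by (rule tendsto_eventually)
  from tendsto_unique[OF _ lim this] show ?thesis by simp
qed

lemma Hardy_approx_sequence:
  assumes "x \<in> H2"
  obtains h where "\<And>n. h n \<in> disc_algebra" "(\<lambda>n. L2_class (h n)) \<longlonglongrightarrow> x"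
proof -
  obtain X where X: "\<And>n. X n \<in> L2_class ` disc_algebra" "X \<longlonglongrightarrow> x"
    using assms by (auto simp: Hardy_circle_eq_closure closure_sequential)
  then have "\<exists>h. \<forall>n. h n \<in> disc_algebra \<and> X n = L2_class (h n)"
    by (intro choice) auto
  then obtain h where "\<And>n. h n \<in> disc_algebra" "X = (\<lambda>n. L2_class (h n))"
    by blast
  then show ?thesis using that X(2) by blast
qed

lemma
  assumes u: "u \<in> disc_algebra" and x: "x \<in> H2"
  shows mult_in_Hardy: "mult_L2 u x \<in> H2"
    and cinner_mult_szego: "z \<in> ball 0 1 \<Longrightarrow> cinner (mult_L2 u x) (szego z) = u z * cinner x (szego z)"
proof -
  obtain h where h: "\<And>n. h n \<in> disc_algebra" "(\<lambda>n. L2_class (h n)) \<longlonglongrightarrow> x"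
    using Hardy_approx_sequence[OF x] by blast
  have uh: "mult_L2 u (L2_class (h n)) = L2_class (\<lambda>z. u z * h n z)" for n
    using u h(1) by (simp add: mult_L2_class continuous_on_circle_Linfty disc_algebraD)
  have uh': "(\<lambda>z. u z * h n z) \<in> disc_algebra" for n
    by (intro disc_algebra_intros u h)
  have lim: "(\<lambda>n. L2_class (\<lambda>z. u z * h n z)) \<longlonglongrightarrow> mult_L2 u x"
    using tendsto_mult_L2[OF disc_algebraD(3)[OF u] h(2)] by (simp add: uh)
  have closed: "closed H2"
    unfolding Hardy_circle_eq_closure by (rule closed_closure)
  show "mult_L2 u x \<in> H2"
    by (rule Lim_in_closed_set[OF closed _ sequentially_bot lim])
       (intro always_eventually allI L2_class_in_Hardy uh')
  assume z: "z \<in> ball 0 1"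
  have "(\<lambda>n. u z * h n z) \<longlonglongrightarrow> cinner (mult_L2 u x) (szego z)"
    using tendsto_cinner_left[OF lim, of "szego z"] unfolding cinner_L2_class_szego[OF uh' z] .
  moreover have "(\<lambda>n. u z * h n z) \<longlonglongrightarrow> u z * cinner x (szego z)"
    using tendsto_cinner_left[OF h(2), of "szego z"] unfolding cinner_L2_class_szego[OF h(1) z]
    by (rule tendsto_mult_left)
  ultimately show "cinner (mult_L2 u x) (szego z) = u z * cinner x (szego z)"
    by (rule LIMSEQ_unique)
qed

section \<open>Analytic and coanalytic Toeplitz operators\<close>

text \<open>For \<open>u\<close> in the disc algebra this is the adjoint of multiplication by
  \<open>u\<close> on the Hardy space.\<close>

definition coanalytic :: "(complex \<Rightarrow> complex) \<Rightarrow> circle_L2 \<Rightarrow> circle_L2" where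
  "coanalytic u = toeplitz (\<lambda>z. cnj (u z))"

lemma toeplitz_in_Hardy: "toeplitz \<phi> x \<in> H2"
  unfolding toeplitz_def by (rule orth_proj_in[OF csubspace_Hardy complete_Hardy])

lemma cinner_toeplitz:
  "y \<in> H2 \<Longrightarrow> cinner (toeplitz \<phi> x) y = cinner (mult_L2 \<phi> x) y"
  unfolding toeplitz_def by (rule cinner_orth_proj[OF csubspace_Hardy complete_Hardy])

text \<open>The orthogonal projection is a contraction: pair the projected vector with itself and
  cancel.\<close>

lemma norm_toeplitz_le:
  assumes "continuous_on (sphere 0 1) \<phi>" "\<And>z. z \<in> sphere 0 1 \<Longrightarrow> norm (\<phi> z) \<le> K"
  shows "norm (toeplitz \<phi> x) \<le> K * norm x"
proof (cases "toeplitz \<phi> x = 0")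
  case True
  have "0 \<le> norm (mult_L2 \<phi> x)" by simp
  also have "\<dots> \<le> K * norm x" by (rule norm_mult_L2_le[OF assms])
  finally show ?thesis using True by simp
next
  case False
  have "(norm (toeplitz \<phi> x))\<^sup>2 = norm (cinner (toeplitz \<phi> x) (toeplitz \<phi> x))"
    unfolding cinner_self norm_of_real by simp
  also have "\<dots> \<le> norm (mult_L2 \<phi> x) * norm (toeplitz \<phi> x)"
    unfolding cinner_toeplitz[OF toeplitz_in_Hardy] by (rule cinner_Cauchy_Schwarz)
  finally have "norm (toeplitz \<phi> x) \<le> norm (mult_L2 \<phi> x)"
    using False by (simp add: power2_eq_square)
  also have "\<dots> \<le> K * norm x" by (rule norm_mult_L2_le[OF assms])
  finally show ?thesis .
qed

lemma Hardy_ext: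
  "x \<in> H2 \<Longrightarrow> y \<in> H2 \<Longrightarrow> (\<And>z. z \<in> H2 \<Longrightarrow> cinner x z = cinner y z) \<Longrightarrow> x = y"
  by (rule cinner_ext[OF csubspace_Hardy])

lemmas Hardy_closed = csubspace_zero[OF csubspace_Hardy] csubspace_add[OF csubspace_Hardy]
  csubspace_scaleC[OF csubspace_Hardy] csubspace_minus[OF csubspace_Hardy]
  csubspace_diff[OF csubspace_Hardy] mult_in_Hardy

lemma coanalytic_in_Hardy: "coanalytic u x \<in> H2"
  unfolding coanalytic_def by (rule toeplitz_in_Hardy)

lemma cinner_coanalytic:
  assumes "u \<in> disc_algebra" "y \<in> H2"
  shows "cinner (coanalytic u x) y = cinner x (mult_L2 u y)"
  using cinner_mult_L2[of "\<lambda>z. cnj (u z)" x y] disc_algebraD(3)[OF assms(1)]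
  by (simp add: coanalytic_def cinner_toeplitz[OF assms(2)] continuous_on_cnj)

lemma cinner_mult_coanalytic:
  assumes "u \<in> disc_algebra" "y \<in> H2"
  shows "cinner (mult_L2 u y) x = cinner y (coanalytic u x)"
  using cinner_coanalytic[OF assms, of x] by (metis cinner_commute)

lemma mult_disc_algebra:
  assumes "u \<in> disc_algebra"
  shows mult_disc_add: "mult_L2 u (x + y) = mult_L2 u x + mult_L2 u y"
    and mult_disc_diff: "mult_L2 u (x - y) = mult_L2 u x - mult_L2 u y"
    and mult_disc_scaleC: "mult_L2 u (c *\<^sub>C x) = c *\<^sub>C mult_L2 u x"
    and mult_disc_zero: "mult_L2 u 0 = 0"
    and mult_disc_mult: "v \<in> disc_algebra \<Longrightarrow> mult_L2 u (mult_L2 v x) = mult_L2 (\<lambda>z. u z * v z) x"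
    and mult_disc_plus: "v \<in> disc_algebra \<Longrightarrow> mult_L2 (\<lambda>z. u z + v z) x = mult_L2 u x + mult_L2 v x"
    and mult_disc_cmult: "mult_L2 (\<lambda>z. c * u z) x = c *\<^sub>C mult_L2 u x"
    and mult_disc_cong: "(\<And>z. z \<in> cball 0 1 \<Longrightarrow> u z = w z) \<Longrightarrow> mult_L2 u x = mult_L2 w x"
proof -
  note u = disc_algebraD(3)[OF assms]
  show "mult_L2 u (x + y) = mult_L2 u x + mult_L2 u y" "mult_L2 u (x - y) = mult_L2 u x - mult_L2 u y"
    "mult_L2 u (c *\<^sub>C x) = c *\<^sub>C mult_L2 u x" "mult_L2 u 0 = 0"
    by (rule mult_L2_add[OF u] mult_L2_diff[OF u] mult_L2_scaleC[OF u] mult_L2_zero[OF u])+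
  show "mult_L2 u (mult_L2 v x) = mult_L2 (\<lambda>z. u z * v z) x"
    "mult_L2 (\<lambda>z. u z + v z) x = mult_L2 u x + mult_L2 v x" if "v \<in> disc_algebra"
    using disc_algebraD(3)[OF that] by (rule mult_L2_mult[OF u] mult_L2_plus[OF u])+
  show "mult_L2 (\<lambda>z. c * u z) x = c *\<^sub>C mult_L2 u x"
    using mult_L2_mult[OF _ u, of "\<lambda>z. c" x] by (simp add: mult_L2_const)
  show "mult_L2 u x = mult_L2 w x" if "\<And>z. z \<in> cball 0 1 \<Longrightarrow> u z = w z"
    by (rule mult_L2_cong[OF u]) (simp add: that)
qed

lemma coanalytic_add:
  assumes u: "u \<in> disc_algebra" and "x \<in> H2" "y \<in> H2"
  shows "coanalytic u (x + y) = coanalytic u x + coanalytic u y"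
  by (rule Hardy_ext) (simp_all add: cinner_algebra cinner_coanalytic[OF u] coanalytic_in_Hardy Hardy_closed)

lemma coanalytic_scaleC:
  assumes u: "u \<in> disc_algebra"
  shows "coanalytic u (c *\<^sub>C x) = c *\<^sub>C coanalytic u x"
  by (rule Hardy_ext) (simp_all add: cinner_algebra cinner_coanalytic[OF u] coanalytic_in_Hardy Hardy_closed)

lemma coanalytic_diff:
  assumes u: "u \<in> disc_algebra"
  shows "coanalytic u (x - y) = coanalytic u x - coanalytic u y"
  by (rule Hardy_ext) (simp_all add: cinner_algebra cinner_coanalytic[OF u] coanalytic_in_Hardy Hardy_closed)

lemma coanalytic_mult:
  assumes u: "u \<in> disc_algebra" and v: "v \<in> disc_algebra"
  shows "coanalytic u (coanalytic v x) = coanalytic (\<lambda>z. u z * v z) x"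
  by (rule Hardy_ext)
    (simp_all add: cinner_coanalytic u v disc_algebra_mult mult_disc_mult mult.commute
      coanalytic_in_Hardy mult_in_Hardy)

lemma coanalytic_plus:
  assumes u: "u \<in> disc_algebra" and v: "v \<in> disc_algebra"
  shows "coanalytic (\<lambda>z. u z + v z) x = coanalytic u x + coanalytic v x"
  by (rule Hardy_ext)
    (simp_all add: cinner_coanalytic u v disc_algebra_add mult_disc_plus cinner_algebra
      coanalytic_in_Hardy Hardy_closed)

lemma coanalytic_const:
  assumes "x \<in> H2"
  shows "coanalytic (\<lambda>z. c) x = cnj c *\<^sub>C x"
  by (rule Hardy_ext)
    (simp_all add: cinner_coanalytic disc_algebra_const mult_L2_const cinner_algebra
      coanalytic_in_Hardy Hardy_closed assms)

lemma coanalytic_cmult: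
  assumes u: "u \<in> disc_algebra"
  shows "coanalytic (\<lambda>z. c * u z) x = cnj c *\<^sub>C coanalytic u x"
  using coanalytic_mult[OF disc_algebra_const u, of c x]
  by (simp add: coanalytic_const coanalytic_in_Hardy)

lemma coanalytic_cong:
  assumes u: "u \<in> disc_algebra" and eq: "\<And>z. z \<in> cball 0 1 \<Longrightarrow> u z = w z"
  shows "coanalytic u x = coanalytic w x"
proof -
  have "mult_L2 (\<lambda>z. cnj (u z)) x = mult_L2 (\<lambda>z. cnj (w z)) x"
    by (rule mult_L2_cong) (auto simp: eq intro!: continuous_on_cnj disc_algebraD(3)[OF u])
  then show ?thesis by (simp add: coanalytic_def toeplitz_def)
qed

text \<open>The reproducing property read through the adjoint: \<open>u f\<close> takes the value \<open>u z
  * f z\<close> at \<open>z\<close>.\<close>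

lemma coanalytic_szego:
  assumes u: "u \<in> disc_algebra" and z: "z \<in> ball 0 1"
  shows "coanalytic u (szego z) = cnj (u z) *\<^sub>C szego z"
proof (rule Hardy_ext)
  fix y assume y: "y \<in> H2"
  have "cinner y (coanalytic u (szego z)) = u z * cinner y (szego z)"
    using cinner_mult_coanalytic[OF u y] cinner_mult_szego[OF u y z] by simp
  then show "cinner (coanalytic u (szego z)) y = cinner (cnj (u z) *\<^sub>C szego z) y"
    by (subst (1 2) cinner_commute) (simp add: cinner_scaleC_right)
qed (use z in \<open>simp_all add: coanalytic_in_Hardy Hardy_closed szego_in_Hardy\<close>)

lemma szego_nonzero:
  assumes "z \<in> ball 0 1"
  shows "szego z \<noteq> 0"
proof -
  have "cinner (szego z) (szego z) = szego_kernel z z"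
    using cinner_L2_class_szego[OF szego_kernel_disc_algebra[OF assms] assms] by (simp add: szego_def)
  moreover have "1 - cnj z * z \<noteq> 0"
    by (rule mult_lt_one_neq) (use assms in auto)
  ultimately show ?thesis by (auto simp: szego_kernel_def)
qed

text \<open>An inner function has unimodular boundary values almost everywhere; here the boundary values are
  continuous, so the condition is pointwise.\<close>

definition inner_functions :: "(complex \<Rightarrow> complex) set" where
  "inner_functions = {u \<in> disc_algebra. \<forall>z\<in>sphere 0 1. norm (u z) = 1}"

lemma inner_functionsD:
  "u \<in> inner_functions \<Longrightarrow> u \<in> disc_algebra"
  "u \<in> inner_functions \<Longrightarrow> z \<in> sphere 0 1 \<Longrightarrow> norm (u z) = 1"
  by (auto simp: inner_functions_def)

lemma norm_inner_function_le_1: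
  assumes u: "u \<in> inner_functions" and z: "z \<in> cball 0 1"
  shows "norm (u z) \<le> 1"
proof (rule maximum_modulus_frontier[of u "cball 0 1"])
  show "u holomorphic_on interior (cball 0 1)" "continuous_on (closure (cball 0 1)) u"
    using disc_algebraD[OF inner_functionsD(1)[OF u]] by simp_all
  show "norm (u w) \<le> 1" if "w \<in> frontier (cball 0 1)" for w
    using that inner_functionsD(2)[OF u, of w] by simp
qed (use z in simp_all)

lemma inner_functions_mult:
  "u \<in> inner_functions \<Longrightarrow> v \<in> inner_functions \<Longrightarrow> (\<lambda>z. u z * v z) \<in> inner_functions"
  by (auto simp: inner_functions_def disc_algebra_mult norm_mult)

lemma inner_functions_const: "norm c = 1 \<Longrightarrow> (\<lambda>z. c) \<in> inner_functions"
  by (auto simp: inner_functions_def disc_algebra_const)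

text \<open>On the circle \<open>cnj u * u = 1\<close>, so multiplication by \<open>u\<close> is an
  isometry.\<close>

lemma coanalytic_mult_inner:
  assumes u: "u \<in> inner_functions" and x: "x \<in> H2"
  shows "coanalytic u (mult_L2 u x) = x"
proof -
  note u' = inner_functionsD(1)[OF u]
  have "mult_L2 (\<lambda>z. cnj (u z)) (mult_L2 u x) = mult_L2 (\<lambda>z. cnj (u z) * u z) x"
    by (intro mult_L2_mult continuous_on_cnj disc_algebraD u')
  also have "\<dots> = mult_L2 (\<lambda>z. 1) x"
  proof (rule mult_L2_cong)
    fix z :: complex assume "z \<in> sphere 0 1"
    then show "cnj (u z) * u z = 1"
      using inner_functionsD(2)[OF u] complex_norm_square[of "u z"] by (simp add: mult.commute)
  qed (intro continuous_intros continuous_on_cnj disc_algebraD u')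
  also have "\<dots> = x" by (simp add: mult_L2_const scaleC_one)
  finally show ?thesis
    unfolding coanalytic_def toeplitz_def
    using x by (auto intro: orth_proj_eqI[OF csubspace_Hardy complete_Hardy])
qed

lemma cinner_mult_inner:
  assumes u: "u \<in> inner_functions" and "x \<in> H2" "y \<in> H2"
  shows "cinner (mult_L2 u x) (mult_L2 u y) = cinner x y"
  using assms by (simp add: cinner_mult_coanalytic inner_functionsD coanalytic_mult_inner)

lemma norm_mult_inner:
  assumes "u \<in> inner_functions" "x \<in> H2"
  shows "norm (mult_L2 u x) = norm x"
  using cinner_mult_inner[OF assms assms(2)]
  unfolding cinner_self of_real_eq_iff by (simp add: power2_eq_iff_nonneg)

lemma norm_coanalytic_inner_le:
  assumes "u \<in> inner_functions"
  shows "norm (coanalytic u x) \<le> norm x"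
proof -
  have "norm (toeplitz (\<lambda>z. cnj (u z)) x) \<le> 1 * norm x"
    using assms by (intro norm_toeplitz_le continuous_on_cnj disc_algebraD) (auto simp: inner_functionsD)
  then show ?thesis by (simp add: coanalytic_def)
qed

lemma toeplitz_analytic_plus_coanalytic:
  assumes v: "v \<in> disc_algebra" and a: "a \<in> disc_algebra" and x: "x \<in> H2"
  shows "toeplitz (\<lambda>z. v z + cnj (a z)) x = mult_L2 v x + coanalytic a x"
proof (rule Hardy_ext)
  fix y assume y: "y \<in> H2"
  have "mult_L2 (\<lambda>z. v z + cnj (a z)) x = mult_L2 v x + mult_L2 (\<lambda>z. cnj (a z)) x"
    by (intro mult_L2_plus continuous_on_cnj disc_algebraD v a)
  then show "cinner (toeplitz (\<lambda>z. v z + cnj (a z)) x) y = cinner (mult_L2 v x + coanalytic a x) y"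
    using y by (simp add: cinner_algebra coanalytic_def cinner_toeplitz)
qed (simp_all add: toeplitz_in_Hardy coanalytic_in_Hardy Hardy_closed v x)

lemma cinner_analytic_plus_coanalytic:
  assumes v: "v \<in> disc_algebra" and a: "a \<in> disc_algebra"
    and x: "x \<in> H2" and y: "y \<in> H2"
  shows "cinner (mult_L2 v x + coanalytic a x) y = cinner x (coanalytic v y + mult_L2 a y)"
  by (simp add: cinner_algebra cinner_mult_coanalytic[OF v x] cinner_coanalytic[OF a y])

lemma bounded_op_on_toeplitz:
  assumes \<phi>: "continuous_on (sphere 0 1) \<phi>"
  shows "bounded_op_on H2 (toeplitz \<phi>)"
  unfolding bounded_op_on_def linear_on_sub_def
proof (intro conjI ballI allI toeplitz_in_Hardy)
  fix x y assume "x \<in> H2" "y \<in> H2"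
  show "toeplitz \<phi> (x + y) = toeplitz \<phi> x + toeplitz \<phi> y"
    by (rule Hardy_ext)
      (simp_all add: cinner_toeplitz mult_L2_add[OF \<phi>] cinner_algebra toeplitz_in_Hardy Hardy_closed)
next
  fix c x
  show "toeplitz \<phi> (c *\<^sub>C x) = c *\<^sub>C toeplitz \<phi> x"
    by (rule Hardy_ext)
      (simp_all add: cinner_toeplitz mult_L2_scaleC[OF \<phi>] cinner_algebra toeplitz_in_Hardy Hardy_closed)
next
  obtain K where "\<And>z. z \<in> sphere 0 1 \<Longrightarrow> norm (\<phi> z) \<le> K"
    using continuous_on_circle_bounded[OF \<phi>] by blast
  then show "\<exists>K. \<forall>x\<in>H2. norm (toeplitz \<phi> x) \<le> K * norm x"
    by (intro exI[of _ K] ballI norm_toeplitz_le[OF \<phi>])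
qed

section \<open>Finite Blaschke products\<close>

lemma disc_aut_denominator:
  assumes "a \<in> ball 0 1" "z \<in> cball 0 1"
  shows "1 - cnj a * z \<noteq> 0"
  using assms by (intro mult_lt_one_neq) auto

lemma disc_aut_disc_algebra: "a \<in> ball 0 1 \<Longrightarrow> disc_aut a \<in> disc_algebra"
  unfolding disc_aut_def[abs_def]
  by (intro disc_algebra_intros disc_aut_denominator) auto

text \<open>At \<open>z = w\<close> this identity gives \<open>norm (disc_aut a z)\<close>; off the diagonal
  it matches the inner products of the kernels in the construction of the conjugation.\<close>

lemma disc_aut_identity:
  assumes a: "a \<in> ball 0 1" and z: "z \<in> cball 0 1" and w: "w \<in> cball 0 1"
  shows "1 - disc_aut a z * cnj (disc_aut a w)
    = (1 - a * cnj a) * (1 - z * cnj w) / ((1 - cnj a * z) * (1 - a * cnj w))"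
proof -
  have "1 - cnj a * z \<noteq> 0" using disc_aut_denominator[OF a z] .
  moreover have "1 - a * cnj w \<noteq> 0"
    using disc_aut_denominator[OF a w] by (metis complex_cnj_cnj complex_cnj_diff complex_cnj_mult complex_cnj_one complex_cnj_zero)
  ultimately show ?thesis
    by (simp add: disc_aut_def divide_simps) (simp add: algebra_simps)
qed

lemma norm_disc_aut:
  assumes a: "a \<in> ball 0 1" and z: "z \<in> cball 0 1"
  shows "1 - (norm (disc_aut a z))\<^sup>2 = (1 - (norm a)\<^sup>2) * (1 - (norm z)\<^sup>2) / (norm (1 - cnj a * z))\<^sup>2"
proof -
  have d: "cnj (1 - cnj a * z) = 1 - a * cnj z" by simp
  have "complex_of_real (1 - (norm (disc_aut a z))\<^sup>2)
      = complex_of_real ((1 - (norm a)\<^sup>2) * (1 - (norm z)\<^sup>2) / (norm (1 - cnj a * z))\<^sup>2)"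
    using disc_aut_identity[OF a z z]
    unfolding of_real_diff of_real_mult of_real_divide complex_norm_square of_real_1 d .
  then show ?thesis by (simp only: of_real_eq_iff)
qed

lemma norm_disc_aut_eq_1:
  assumes "a \<in> ball 0 1" "z \<in> sphere 0 1"
  shows "norm (disc_aut a z) = 1"
  using norm_disc_aut[of a z] assms by (simp add: power2_eq_1_iff) (smt (verit) norm_ge_zero)

lemma norm_disc_aut_less_1:
  assumes a: "a \<in> ball 0 1" and z: "z \<in> ball 0 1"
  shows "norm (disc_aut a z) < 1"
proof -
  have "1 - cnj a * z \<noteq> 0" using assms by (intro disc_aut_denominator) auto
  then have "0 < (1 - (norm a)\<^sup>2) * (1 - (norm z)\<^sup>2) / (norm (1 - cnj a * z))\<^sup>2"
    using a z by (intro divide_pos_pos mult_pos_pos) (auto simp: abs_square_less_1)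
  then have "(norm (disc_aut a z))\<^sup>2 < 1"
    using norm_disc_aut[OF a, of z] z by simp
  then show ?thesis by (simp add: abs_square_less_1)
qed

lemma disc_aut_inner: "a \<in> ball 0 1 \<Longrightarrow> disc_aut a \<in> inner_functions"
  by (simp add: inner_functions_def disc_aut_disc_algebra norm_disc_aut_eq_1)

lemma disc_aut_prod_inner:
  "set as \<subseteq> ball 0 1 \<Longrightarrow> (\<lambda>z. \<Prod>a\<leftarrow>as. disc_aut a z) \<in> inner_functions"
  by (induction as) (auto intro!: inner_functions_const inner_functions_mult disc_aut_inner)

lemma inner_functions_cong:
  assumes "u \<in> inner_functions" "\<And>z. z \<in> cball 0 1 \<Longrightarrow> u z = w z"
  shows "w \<in> inner_functions"
  using assms disc_algebra_cong[of u w] by (auto simp: inner_functions_def)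

lemma finite_blaschke_inner:
  assumes "finite_blaschke B"
  shows "B \<in> inner_functions"
proof -
  obtain \<gamma> as where B: "norm \<gamma> = 1" "set as \<subseteq> ball 0 1"
      "\<And>z. z \<in> cball 0 1 \<Longrightarrow> B z = \<gamma> * (\<Prod>a\<leftarrow>as. disc_aut a z)"
    using assms by (auto simp: finite_blaschke_def)
  have "(\<lambda>z. \<gamma> * (\<Prod>a\<leftarrow>as. disc_aut a z)) \<in> inner_functions"
    by (intro inner_functions_mult inner_functions_const disc_aut_prod_inner B)
  then show ?thesis
    by (rule inner_functions_cong) (simp add: B(3))
qed

lemma finite_blaschke_norm_less_1:
  assumes "finite_blaschke B" and z: "z \<in> ball 0 1"
  shows "norm (B z) < 1"
proof -
  obtain \<gamma> as where B: "norm \<gamma> = 1" "as \<noteq> []" "set as \<subseteq> ball 0 1"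
      "\<And>z. z \<in> cball 0 1 \<Longrightarrow> B z = \<gamma> * (\<Prod>a\<leftarrow>as. disc_aut a z)"
    using assms by (auto simp: finite_blaschke_def)
  obtain a as' where as: "as = a # as'" using B(2) by (cases as) auto
  have "norm (B z) = norm (disc_aut a z) * norm (\<Prod>a\<leftarrow>as'. disc_aut a z)"
    using B z as by (simp add: norm_mult)
  also have "\<dots> \<le> norm (disc_aut a z) * 1"
    using B as z by (intro mult_left_mono norm_inner_function_le_1 disc_aut_prod_inner) auto
  also have "\<dots> < 1"
    using B as z by (simp add: norm_disc_aut_less_1)
  finally show ?thesis .
qed

lemma compose_finite_blaschke:
  assumes "finite_blaschke B"
  shows "u \<in> disc_algebra \<Longrightarrow> (\<lambda>z. u (B z)) \<in> disc_algebra"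
    and "u \<in> inner_functions \<Longrightarrow> (\<lambda>z. u (B z)) \<in> inner_functions"
proof -
  have B: "B \<in> disc_algebra"
    by (rule inner_functionsD(1)[OF finite_blaschke_inner[OF assms]])
  show *: "(\<lambda>z. u (B z)) \<in> disc_algebra" if "u \<in> disc_algebra" for u
    using disc_algebra_compose[OF that B] finite_blaschke_norm_less_1[OF assms]
      norm_inner_function_le_1[OF finite_blaschke_inner[OF assms]] by simp
  assume u: "u \<in> inner_functions"
  have "norm (u (B z)) = 1" if "z \<in> sphere 0 1" for z
    using inner_functionsD(2)[OF u, of "B z"] inner_functionsD(2)[OF finite_blaschke_inner[OF assms] that] by simp
  then show "(\<lambda>z. u (B z)) \<in> inner_functions"
    using *[OF inner_functionsD(1)[OF u]] by (simp add: inner_functions_def)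
qed

text \<open>The proof treats a single factor and at least two factors in different ways. The remaining
  factors are kept together as an inner function \<open>G\<close>.\<close>

lemma finite_blaschke_cases:
  assumes "finite_blaschke B"
  obtains (degree_1) c \<gamma> where "c \<in> ball 0 1" "norm \<gamma> = 1"
      "\<And>z. z \<in> cball 0 1 \<Longrightarrow> B z = \<gamma> * disc_aut c z"
  | (degree_ge_2) c d G where "c \<in> ball 0 1" "d \<in> ball 0 1" "G \<in> inner_functions"
      "\<And>z. z \<in> cball 0 1 \<Longrightarrow> B z = disc_aut c z * (disc_aut d z * G z)"
proof -
  obtain \<gamma> as where B: "norm \<gamma> = 1" "as \<noteq> []" "set as \<subseteq> ball 0 1"
      "\<And>z. z \<in> cball 0 1 \<Longrightarrow> B z = \<gamma> * (\<Prod>a\<leftarrow>as. disc_aut a z)"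
    using assms by (auto simp: finite_blaschke_def)
  obtain c as' where as: "as = c # as'" using B(2) by (cases as) auto
  show ?thesis
  proof (cases as')
    case Nil
    show ?thesis by (rule degree_1[of c \<gamma>]) (use B as Nil in auto)
  next
    case (Cons d as'')
    show ?thesis
      by (rule degree_ge_2[of c d "\<lambda>z. \<gamma> * (\<Prod>a\<leftarrow>as''. disc_aut a z)"])
        (use B as Cons in \<open>auto intro!: inner_functions_mult inner_functions_const disc_aut_prod_inner simp: mult_ac\<close>)
  qed
qed

lemma finite_blaschke_factor:
  assumes "finite_blaschke B"
  obtains c G where "c \<in> ball 0 1" "G \<in> inner_functions" "\<And>z. z \<in> cball 0 1 \<Longrightarrow> B z = disc_aut c z * G z"
  using assms
proof (cases rule: finite_blaschke_cases)
  case (degree_1 c \<gamma>)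
  then show ?thesis
    by (intro that[of c "\<lambda>z. \<gamma>"]) (auto intro: inner_functions_const simp: mult.commute)
next
  case (degree_ge_2 c d G)
  then show ?thesis
    by (intro that[of c "\<lambda>z. disc_aut d z * G z"] inner_functions_mult disc_aut_inner)
qed

lemma finite_blaschke_zero:
  assumes "finite_blaschke B"
  obtains a where "a \<in> ball 0 1" "B a = 0"
proof -
  obtain c G where "c \<in> ball 0 1" "\<And>z. z \<in> cball 0 1 \<Longrightarrow> B z = disc_aut c z * G z"
    using finite_blaschke_factor[OF assms] by blast
  then show ?thesis by (intro that[of c]) (auto simp: disc_aut_def)
qed

section \<open>Solving equations with the resolvent of an isometry\<close>

lemmas scaleC_algebra = scaleC_add_right scaleC_add_left scaleC_diff_right scaleC_diff_left
  scaleC_minus_left scaleC_minus_right scaleC_scaleC scaleC_one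

lemma mult_disc_minus:
  assumes "u \<in> disc_algebra" "w \<in> disc_algebra"
  shows "mult_L2 (\<lambda>z. u z - w z) x = mult_L2 u x - mult_L2 w x"
  using mult_disc_plus[OF disc_algebra_diff[OF assms] assms(2), of x] by simp

lemma coanalytic_minus:
  assumes "u \<in> disc_algebra" "w \<in> disc_algebra"
  shows "coanalytic (\<lambda>z. u z - w z) x = coanalytic u x - coanalytic w x"
  using coanalytic_plus[OF disc_algebra_diff[OF assms] assms(2), of x] by simp

lemma mult_reciprocal:
  assumes h: "h \<in> disc_algebra" "\<And>z. z \<in> cball 0 1 \<Longrightarrow> h z \<noteq> 0"
  shows "mult_L2 h (mult_L2 (\<lambda>z. 1 / h z) x) = x"
    and "x \<in> H2 \<Longrightarrow> coanalytic (\<lambda>z. 1 / h z) (coanalytic h x) = x"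
    and "x \<in> H2 \<Longrightarrow> coanalytic h (coanalytic (\<lambda>z. 1 / h z) x) = x"
proof -
  have r: "(\<lambda>z. 1 / h z) \<in> disc_algebra"
    using h by (intro disc_algebra_intros)
  have "mult_L2 h (mult_L2 (\<lambda>z. 1 / h z) x) = mult_L2 (\<lambda>z. 1) x"
    unfolding mult_disc_mult[OF h(1) r]
    by (rule mult_disc_cong[OF disc_algebra_mult[OF h(1) r]]) (simp add: h(2))
  then show "mult_L2 h (mult_L2 (\<lambda>z. 1 / h z) x) = x"
    by (simp add: mult_L2_const scaleC_one)
  assume x: "x \<in> H2"
  have "coanalytic (\<lambda>z. 1 / h z) (coanalytic h x) = coanalytic (\<lambda>z. 1) x"
    unfolding coanalytic_mult[OF r h(1)]
    by (rule coanalytic_cong[OF disc_algebra_mult[OF r h(1)]]) (simp add: h(2))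
  then show "coanalytic (\<lambda>z. 1 / h z) (coanalytic h x) = x"
    by (simp add: coanalytic_const[OF x] scaleC_one)
  have "coanalytic h (coanalytic (\<lambda>z. 1 / h z) x) = coanalytic (\<lambda>z. 1) x"
    unfolding coanalytic_mult[OF h(1) r]
    by (rule coanalytic_cong[OF disc_algebra_mult[OF h(1) r]]) (simp add: h(2))
  then show "coanalytic h (coanalytic (\<lambda>z. 1 / h z) x) = x"
    by (simp add: coanalytic_const[OF x] scaleC_one)
qed

lemma coanalytic_commute:
  assumes "u \<in> disc_algebra" "w \<in> disc_algebra"
  shows "coanalytic u (coanalytic w x) = coanalytic w (coanalytic u x)"
  using assms by (simp add: coanalytic_mult mult.commute)

lemma mult_disc_commute:
  assumes "u \<in> disc_algebra" "w \<in> disc_algebra"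
  shows "mult_L2 u (mult_L2 w x) = mult_L2 w (mult_L2 u x)"
  using assms by (simp add: mult_disc_mult mult.commute)

text \<open>The isometric part has norm \<open>norm x\<close>, the other one at most \<open>norm \<nu> *
  norm x\<close>.\<close>

lemma perturbed_isometry_injective:
  assumes p: "p \<in> inner_functions" and r: "r \<in> inner_functions" and \<nu>: "norm \<nu> < 1"
    and x: "x \<in> H2" and 0: "mult_L2 p x + \<nu> *\<^sub>C coanalytic r x = 0"
  shows "x = 0"
proof -
  have "norm x = norm (mult_L2 p x)"
    by (rule norm_mult_inner[OF p x, symmetric])
  also have "mult_L2 p x = - (\<nu> *\<^sub>C coanalytic r x)"
    using 0 by (simp add: eq_neg_iff_add_eq_0)
  also have "norm (- (\<nu> *\<^sub>C coanalytic r x)) \<le> norm \<nu> * norm x"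
    by (simp add: norm_scaleC mult_left_mono norm_coanalytic_inner_le[OF r])
  finally have "(1 - norm \<nu>) * norm x \<le> 0"
    by (simp add: algebra_simps)
  then show ?thesis
    using \<nu> by (simp add: mult_le_0_iff)
qed

text \<open>The vector is \<open>f / (1 + \<nu> p r)\<close>. The adjoint of multiplication by
  \<open>p\<close> maps \<open>x + \<nu> p r x = f\<close> to the expression that is to vanish.\<close>

lemma perturbed_coisometry_not_injective:
  assumes p: "p \<in> inner_functions" and r: "r \<in> inner_functions" and \<nu>: "norm \<nu> < 1"
    and f: "f \<in> H2" "f \<noteq> 0" "coanalytic p f = 0"
  shows "\<exists>x\<in>H2. x \<noteq> 0 \<and> coanalytic p x + \<nu> *\<^sub>C mult_L2 r x = 0"
proof -
  note p' = inner_functionsD(1)[OF p] and r' = inner_functionsD(1)[OF r]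
  define h where "h = (\<lambda>z. 1 + \<nu> * (p z * r z))"
  have h: "h \<in> disc_algebra"
    unfolding h_def by (intro disc_algebra_intros p' r')
  have nz: "h z \<noteq> 0" if "z \<in> cball 0 1" for z
  proof -
    have "norm (p z * r z) \<le> 1"
      using norm_inner_function_le_1[OF inner_functions_mult[OF p r] that] .
    then have "1 - (- \<nu>) * (p z * r z) \<noteq> 0"
      using \<nu> by (intro mult_lt_one_neq) auto
    then show ?thesis by (simp add: h_def)
  qed
  define x where "x = mult_L2 (\<lambda>z. 1 / h z) f"
  have rec: "(\<lambda>z. 1 / h z) \<in> disc_algebra"
    using h nz by (intro disc_algebra_intros)
  have x: "x \<in> H2"
    unfolding x_def by (rule mult_in_Hardy[OF rec f(1)])
  have "f = mult_L2 h x"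
    unfolding x_def using mult_reciprocal(1)[OF h nz] by simp
  also have "\<dots> = x + \<nu> *\<^sub>C mult_L2 p (mult_L2 r x)"
    unfolding h_def
    by (simp add: mult_disc_plus disc_algebra_intros p' r' mult_L2_const scaleC_one mult_disc_cmult mult_disc_mult)
  finally have fx: "f = x + \<nu> *\<^sub>C mult_L2 p (mult_L2 r x)" .
  have "0 = coanalytic p f" using f by simp
  also have "\<dots> = coanalytic p x + \<nu> *\<^sub>C coanalytic p (mult_L2 p (mult_L2 r x))"
    unfolding fx by (simp add: coanalytic_add[OF p'] coanalytic_scaleC[OF p'] Hardy_closed x p' r')
  also have "coanalytic p (mult_L2 p (mult_L2 r x)) = mult_L2 r x"
    by (rule coanalytic_mult_inner[OF p mult_in_Hardy[OF r' x]])
  finally have "coanalytic p x + \<nu> *\<^sub>C mult_L2 r x = 0" by simp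
  moreover have "x \<noteq> 0"
    using fx f(2) by (auto simp: mult_disc_zero p' r')
  ultimately show ?thesis using x by blast
qed

text \<open>This is \<open>(I - cnj c V)\<inverse>\<close> for the operator \<open>V\<close> of
  multiplication by \<open>v\<close>.\<close>

definition resolvent :: "(complex \<Rightarrow> complex) \<Rightarrow> complex \<Rightarrow> circle_L2 \<Rightarrow> circle_L2" where
  "resolvent v c = mult_L2 (\<lambda>z. 1 / (1 - cnj c * v z))"

context
  fixes v :: "complex \<Rightarrow> complex" and c :: complex
  assumes v: "v \<in> inner_functions" and c: "c \<in> ball 0 1"
begin

private lemma v_disc: "v \<in> disc_algebra" using v by (rule inner_functionsD)

private lemma den: "(\<lambda>z. 1 - cnj c * v z) \<in> disc_algebra"
  by (intro disc_algebra_intros v_disc)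

private lemma den_nz: "z \<in> cball 0 1 \<Longrightarrow> 1 - cnj c * v z \<noteq> 0"
  using norm_inner_function_le_1[OF v] c by (intro mult_lt_one_neq) auto

lemma resolvent_symbol_disc_algebra: "(\<lambda>z. 1 / (1 - cnj c * v z)) \<in> disc_algebra"
  by (rule disc_algebra_divide[OF disc_algebra_const den den_nz])

lemma resolvent_in_Hardy: "x \<in> H2 \<Longrightarrow> resolvent v c x \<in> H2"
  unfolding resolvent_def by (rule mult_in_Hardy[OF resolvent_symbol_disc_algebra])

lemma resolvent_equation: "resolvent v c x = x + cnj c *\<^sub>C mult_L2 v (resolvent v c x)"
proof -
  have "x = mult_L2 (\<lambda>z. 1 - cnj c * v z) (resolvent v c x)"
    unfolding resolvent_def using mult_reciprocal(1)[OF den den_nz] by simp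
  also have "\<dots> = resolvent v c x - cnj c *\<^sub>C mult_L2 v (resolvent v c x)"
    by (simp add: mult_disc_minus disc_algebra_intros v_disc mult_L2_const scaleC_one mult_disc_cmult[OF v_disc])
  finally show ?thesis by (simp add: algebra_simps)
qed

lemma resolvent_eqI:
  assumes "y = x + cnj c *\<^sub>C mult_L2 v y"
  shows "y = resolvent v c x"
proof -
  have "mult_L2 (\<lambda>z. 1 - cnj c * v z) y = y - cnj c *\<^sub>C mult_L2 v y"
    by (simp add: mult_disc_minus disc_algebra_intros v_disc mult_L2_const scaleC_one mult_disc_cmult[OF v_disc])
  also have "\<dots> = x" using assms by (simp add: algebra_simps)
  finally have "resolvent v c x = resolvent v c (mult_L2 (\<lambda>z. 1 - cnj c * v z) y)" by simp
  also have "\<dots> = mult_L2 (\<lambda>z. 1 - cnj c * v z) (mult_L2 (\<lambda>z. 1 / (1 - cnj c * v z)) y)"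
    unfolding resolvent_def by (rule mult_disc_commute[OF resolvent_symbol_disc_algebra den])
  also have "\<dots> = y"
    by (rule mult_reciprocal(1)[OF den den_nz])
  finally show ?thesis by simp
qed

text \<open>Applying \<open>V\<^sup>*\<close> to \<open>f = k + cnj c V f\<close> removes \<open>k\<close>:
  the resolvent turns vectors of the kernel of \<open>V\<^sup>*\<close> into eigenvectors.\<close>

lemma coanalytic_resolvent:
  assumes "k \<in> H2" "coanalytic v k = 0"
  shows "coanalytic v (resolvent v c k) = cnj c *\<^sub>C resolvent v c k"
proof -
  note R = resolvent_in_Hardy[OF assms(1)]
  have "coanalytic v (resolvent v c k) = coanalytic v (k + cnj c *\<^sub>C mult_L2 v (resolvent v c k))"
    using resolvent_equation[of k] by simp
  also have "\<dots> = cnj c *\<^sub>C coanalytic v (mult_L2 v (resolvent v c k))"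
    by (simp add: coanalytic_add[OF v_disc] coanalytic_scaleC[OF v_disc] Hardy_closed assms R v_disc)
  also have "\<dots> = cnj c *\<^sub>C resolvent v c k"
    by (simp add: coanalytic_mult_inner[OF v R])
  finally show ?thesis .
qed

lemma disc_aut_compose_disc_algebra: "(\<lambda>z. disc_aut c (v z)) \<in> disc_algebra"
proof -
  have "(\<lambda>z. (c - v z) / (1 - cnj c * v z)) \<in> disc_algebra"
    using den_nz by (intro disc_algebra_intros v_disc) auto
  then show ?thesis by (simp add: disc_aut_def)
qed

lemma coanalytic_disc_aut:
  assumes x: "x \<in> H2"
  shows "coanalytic (\<lambda>z. disc_aut c (v z)) x
    = coanalytic (\<lambda>z. 1 / (1 - cnj c * v z)) (cnj c *\<^sub>C x - coanalytic v x)"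
proof -
  have "cnj c *\<^sub>C x - coanalytic v x = coanalytic (\<lambda>z. c - v z) x"
    by (simp add: coanalytic_minus disc_algebra_intros v_disc coanalytic_const[OF x])
  then have "coanalytic (\<lambda>z. 1 / (1 - cnj c * v z)) (cnj c *\<^sub>C x - coanalytic v x)
      = coanalytic (\<lambda>z. 1 / (1 - cnj c * v z) * (c - v z)) x"
    by (simp only: coanalytic_mult resolvent_symbol_disc_algebra disc_algebra_intros v_disc)
  also have "\<dots> = coanalytic (\<lambda>z. disc_aut c (v z)) x"
    by (rule coanalytic_cong[OF disc_algebra_mult[OF resolvent_symbol_disc_algebra disc_algebra_diff[OF disc_algebra_const v_disc]]])
      (simp add: disc_aut_def)
  finally show ?thesis by simp
qed

text \<open>In \<open>disc_aut c (V) = (c - V) (I - cnj c V)\<inverse>\<close> the second factor is invertible, so the adjoint has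
  the same kernel as \<open>cnj c - V\<^sup>*\<close>.\<close>

lemma coanalytic_disc_aut_eq_0_iff:
  assumes x: "x \<in> H2"
  shows "coanalytic (\<lambda>z. disc_aut c (v z)) x = 0 \<longleftrightarrow> coanalytic v x = cnj c *\<^sub>C x"
proof
  assume "coanalytic v x = cnj c *\<^sub>C x"
  then show "coanalytic (\<lambda>z. disc_aut c (v z)) x = 0"
    using coanalytic_scaleC[OF resolvent_symbol_disc_algebra, of 0 0] by (simp add: coanalytic_disc_aut[OF x])
next
  assume 0: "coanalytic (\<lambda>z. disc_aut c (v z)) x = 0"
  have y: "cnj c *\<^sub>C x - coanalytic v x \<in> H2"
    by (intro Hardy_closed coanalytic_in_Hardy x)
  have "cnj c *\<^sub>C x - coanalytic v x
      = coanalytic (\<lambda>z. 1 - cnj c * v z) (coanalytic (\<lambda>z. disc_aut c (v z)) x)"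
    unfolding coanalytic_disc_aut[OF x] using mult_reciprocal(3)[OF den den_nz y] by simp
  also have "\<dots> = 0"
    using coanalytic_scaleC[OF den, of 0 0] by (simp add: 0)
  finally show "coanalytic v x = cnj c *\<^sub>C x" by simp
qed

lemma coanalytic_disc_aut_wandering:
  assumes k: "k \<in> H2" "coanalytic v k = 0"
  shows "coanalytic (\<lambda>z. disc_aut c (v z)) k = cnj c *\<^sub>C k"
proof -
  have "coanalytic (\<lambda>z. 1 - cnj c * v z) k = k"
    by (simp add: coanalytic_minus disc_algebra_intros v_disc coanalytic_const k coanalytic_cmult[OF v_disc] scaleC_one)
  then have "coanalytic (\<lambda>z. 1 / (1 - cnj c * v z)) k = k"
    using mult_reciprocal(2)[OF den den_nz k(1)] by simp
  then show ?thesis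
    by (simp add: coanalytic_disc_aut k coanalytic_scaleC[OF resolvent_symbol_disc_algebra])
qed

lemma mult_disc_aut:
  "mult_L2 (\<lambda>z. disc_aut c (v z)) x = c *\<^sub>C resolvent v c x - mult_L2 v (resolvent v c x)"
proof -
  have "mult_L2 (\<lambda>z. disc_aut c (v z)) x = mult_L2 (\<lambda>z. (c - v z) * (1 / (1 - cnj c * v z))) x"
    by (rule mult_disc_cong[OF disc_aut_compose_disc_algebra]) (simp add: disc_aut_def)
  also have "\<dots> = mult_L2 (\<lambda>z. c - v z) (resolvent v c x)"
    unfolding resolvent_def by (rule mult_disc_mult[symmetric]) (intro disc_algebra_intros v_disc resolvent_symbol_disc_algebra)+
  also have "\<dots> = c *\<^sub>C resolvent v c x - mult_L2 v (resolvent v c x)"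
    by (simp add: mult_disc_minus disc_algebra_intros v_disc mult_L2_const)
  finally show ?thesis .
qed

lemma cinner_resolvent:
  assumes k: "k \<in> H2" "coanalytic v k = 0"
  shows "cinner k (resolvent v c k) = cinner k k"
    and "cinner (resolvent v c k) k = cinner k k"
    and "(1 - (norm c)\<^sup>2) * (norm (resolvent v c k))\<^sup>2 = (norm k)\<^sup>2"
proof -
  define f where "f = resolvent v c k"
  have f: "f \<in> H2" "f = k + cnj c *\<^sub>C mult_L2 v f" "coanalytic v f = cnj c *\<^sub>C f"
    unfolding f_def using resolvent_in_Hardy[OF k(1)] resolvent_equation[of k] coanalytic_resolvent[OF k]
    by simp_all
  have "cinner f k = cinner (k + cnj c *\<^sub>C mult_L2 v f) k"
    using f(2) by simp
  also have "\<dots> = cinner k k"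
    by (simp add: cinner_algebra cinner_mult_coanalytic[OF v_disc f(1)] k)
  finally have fk: "cinner f k = cinner k k" .
  then have kf: "cinner k f = cinner k k"
    by (metis cinner_commute)
  have "cinner f f = cinner (k + cnj c *\<^sub>C mult_L2 v f) f"
    using f(2) by simp
  also have "\<dots> = cinner k k + cnj c * c * cinner f f"
    by (simp add: cinner_algebra cinner_mult_coanalytic[OF v_disc f(1)] kf f(3))
  finally have "complex_of_real ((norm f)\<^sup>2) = complex_of_real ((norm k)\<^sup>2 + (norm c)\<^sup>2 * (norm f)\<^sup>2)"
    unfolding of_real_add of_real_mult complex_norm_square[of c] cinner_self[symmetric]
    by (simp add: mult.commute)
  then have "(norm f)\<^sup>2 = (norm k)\<^sup>2 + (norm c)\<^sup>2 * (norm f)\<^sup>2"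
    by (simp only: of_real_eq_iff)
  then have 3: "(1 - (norm c)\<^sup>2) * (norm f)\<^sup>2 = (norm k)\<^sup>2"
    by (simp add: algebra_simps)
  from fk kf 3 show "cinner k (resolvent v c k) = cinner k k" "cinner (resolvent v c k) k = cinner k k"
    "(1 - (norm c)\<^sup>2) * (norm (resolvent v c k))\<^sup>2 = (norm k)\<^sup>2"
    by (simp_all add: f_def)
qed

end

section \<open>Operators unitarily equivalent to a conjugate of their adjoint\<close>

text \<open>\<open>W\<close> is the composition of the unitary operator with the conjugation.\<close>

lemma UET_antiunitary:
  fixes H :: "'a::complex_inner set"
  assumes H: "csubspace H" and UET: "UET_on H T" and Ts: "\<And>x. x \<in> H \<Longrightarrow> Ts x \<in> H"
    and adj: "\<And>x y. x \<in> H \<Longrightarrow> y \<in> H \<Longrightarrow> cinner (T x) y = cinner x (Ts y)"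
  obtains W where "\<And>x. x \<in> H \<Longrightarrow> W x \<in> H" "\<And>y. y \<in> H \<Longrightarrow> \<exists>x\<in>H. W x = y"
    "\<And>x y. x \<in> H \<Longrightarrow> y \<in> H \<Longrightarrow> W (x + y) = W x + W y"
    "\<And>c x. x \<in> H \<Longrightarrow> W (c *\<^sub>C x) = cnj c *\<^sub>C W x"
    "\<And>x y. x \<in> H \<Longrightarrow> y \<in> H \<Longrightarrow> cinner (W x) (W y) = cinner y x"
    "\<And>x. x \<in> H \<Longrightarrow> W (T x) = Ts (W x)"
proof -
  obtain C U where C: "conjugation_on H C" and U: "unitary_on H U"
    and UT: "\<And>x. x \<in> H \<Longrightarrow> U (T x) = C (adjoint_on H T (C (U x)))"
    using UET unfolding UET_on_def unitarily_equivalent_on_def by blast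
  have T: "T x \<in> H" if "x \<in> H" for x
    using UET that by (auto simp: UET_on_def bounded_op_on_def linear_on_sub_def)
  have CH: "C x \<in> H" "C (C x) = x" if "x \<in> H" for x
    using C that by (auto simp: conjugation_on_def)
  have UH: "U x \<in> H" if "x \<in> H" for x
    using U that by (auto simp: unitary_on_def linear_on_sub_def)
  have adjoint: "adjoint_on H T y = Ts y" if "y \<in> H" for y
    by (rule adjoint_on_eqI[OF H]) (use that Ts adj in auto)
  show ?thesis
  proof (rule that[of "\<lambda>x. C (U x)"])
    fix x assume x: "x \<in> H"
    show "C (U x) \<in> H" using x by (intro CH UH)
    have "U (T x) = C (Ts (C (U x)))"
      using UT[OF x] adjoint x CH UH by simp
    then show "C (U (T x)) = Ts (C (U x))"
      using x CH UH Ts by simp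
    show "C (U (c *\<^sub>C x)) = cnj c *\<^sub>C C (U x)" for c
      using C U x UH[OF x] by (simp add: conjugation_on_def unitary_on_def linear_on_sub_def)
  next
    fix y assume "y \<in> H"
    then have "C y \<in> U ` H" using U CH by (simp add: unitary_on_def)
    then show "\<exists>x\<in>H. C (U x) = y"
      using CH \<open>y \<in> H\<close> by (metis imageE)
  next
    fix x y assume "x \<in> H" "y \<in> H"
    then show "C (U (x + y)) = C (U x) + C (U y)" "cinner (C (U x)) (C (U y)) = cinner y x"
      using C U UH by (simp_all add: conjugation_on_def unitary_on_def linear_on_sub_def)
  qed
qed

lemma complex_symmetric_imp_UET:
  assumes "complex_symmetric_on H T"
  shows "UET_on H T"
proof -
  obtain C where T: "bounded_op_on H T" and C: "conjugation_on H C"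
    and CT: "\<And>x. x \<in> H \<Longrightarrow> C (T (C x)) = adjoint_on H T x"
    using assms by (auto simp: complex_symmetric_on_def)
  have "unitary_on H (\<lambda>x. x)"
    by (auto simp: unitary_on_def linear_on_sub_def)
  moreover have "T x = C (adjoint_on H T (C x))" if "x \<in> H" for x
  proof -
    have Tx: "T x \<in> H" using T that by (auto simp: bounded_op_on_def linear_on_sub_def)
    have C': "C y \<in> H" "C (C y) = y" if "y \<in> H" for y
      using C that by (auto simp: conjugation_on_def)
    have "adjoint_on H T (C x) = C (T x)"
      using CT[OF C'(1)[OF that]] C'(2)[OF that] by simp
    then show ?thesis
      using C'(2)[OF Tx] by simp
  qed
  ultimately have "unitarily_equivalent_on H T (\<lambda>x. C (adjoint_on H T (C x)))"
    unfolding unitarily_equivalent_on_def by blast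
  then show ?thesis using T C by (auto simp: UET_on_def)
qed

section \<open>Intertwining a Toeplitz operator with its adjoint\<close>

text \<open>The operator is \<open>T = V + A\<^sup>*\<close> with commuting multiplications \<open>V\<close> and \<open>A\<close>, and \<open>W\<close> is an
  antiunitary map taking \<open>T\<close> to its adjoint \<open>Ts\<close>.\<close>

locale toeplitz_intertwiner =
  fixes v a :: "complex \<Rightarrow> complex" and W :: "circle_L2 \<Rightarrow> circle_L2"
  assumes v: "v \<in> inner_functions" and a: "a \<in> disc_algebra"
    and W_in: "\<And>x. x \<in> H2 \<Longrightarrow> W x \<in> H2"
    and W_surj: "\<And>y. y \<in> H2 \<Longrightarrow> \<exists>x\<in>H2. W x = y"
    and W_add: "\<And>x y. x \<in> H2 \<Longrightarrow> y \<in> H2 \<Longrightarrow> W (x + y) = W x + W y"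
    and W_scaleC: "\<And>c x. x \<in> H2 \<Longrightarrow> W (c *\<^sub>C x) = cnj c *\<^sub>C W x"
    and W_iso: "\<And>x y. x \<in> H2 \<Longrightarrow> y \<in> H2 \<Longrightarrow> cinner (W x) (W y) = cinner y x"
    and W_intertwines: "\<And>x. x \<in> H2 \<Longrightarrow>
      W (mult_L2 v x + coanalytic a x) = coanalytic v (W x) + mult_L2 a (W x)"
begin

definition T where "T x = mult_L2 v x + coanalytic a x"
definition Ts where "Ts x = coanalytic v x + mult_L2 a x"

lemma v': "v \<in> disc_algebra" using v by (rule inner_functionsD)

lemma T_in: "x \<in> H2 \<Longrightarrow> T x \<in> H2"
  and Ts_in: "x \<in> H2 \<Longrightarrow> Ts x \<in> H2"
  unfolding T_def Ts_def by (intro Hardy_closed coanalytic_in_Hardy v' a; assumption)+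

lemma T_adjoint: "x \<in> H2 \<Longrightarrow> y \<in> H2 \<Longrightarrow> cinner (T x) y = cinner x (Ts y)"
  unfolding T_def Ts_def by (rule cinner_analytic_plus_coanalytic[OF v' a])

lemma W_T: "x \<in> H2 \<Longrightarrow> W (T x) = Ts (W x)"
  unfolding T_def Ts_def by (rule W_intertwines)

lemma W_zero: "W 0 = 0"
  using W_scaleC[OF csubspace_zero[OF csubspace_Hardy], of 0] by simp

lemma W_norm: "x \<in> H2 \<Longrightarrow> norm (W x) = norm x"
  using W_iso[of x x] unfolding cinner_self of_real_eq_iff by (simp add: power2_eq_iff_nonneg)

lemma W_diff: "x \<in> H2 \<Longrightarrow> y \<in> H2 \<Longrightarrow> W (x - y) = W x - W y"
  using W_add[of x "(-1) *\<^sub>C y"] W_scaleC[of y "-1"]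
  by (simp add: scaleC_minus_one Hardy_closed)

text \<open>The intertwining relation for the adjoints: pair with an arbitrary \<open>W y\<close> and move
  everything to the other side.\<close>

lemma W_Ts:
  assumes x: "x \<in> H2"
  shows "W (Ts x) = T (W x)"
proof (rule Hardy_ext)
  fix z assume "z \<in> H2"
  then obtain y where y: "y \<in> H2" "W y = z" using W_surj by blast
  have "cinner (W (Ts x)) z = cinner y (Ts x)"
    using W_iso[of "Ts x" y] x y Ts_in by simp
  also have "\<dots> = cinner (T y) x"
    using T_adjoint x y by simp
  also have "\<dots> = cinner (W x) (W (T y))"
    using W_iso[of x "T y"] x y T_in by simp
  also have "\<dots> = cinner (T (W x)) z"
    using T_adjoint[OF W_in[OF x] W_in[OF y(1)]] W_T[OF y(1)] y(2) by simp
  finally show "cinner (W (Ts x)) z = cinner (T (W x)) z" .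
qed (intro W_in Ts_in T_in x)+

lemma numerical_range: "x \<in> H2 \<Longrightarrow> cinner (T (W x)) (W x) = cinner (T x) x"
  using W_iso[of "Ts x" x] by (simp add: W_Ts[symmetric] Ts_in T_adjoint)

text \<open>\<open>W\<close> maps the kernel of \<open>T\<close> into that of \<open>T\<^sup>*\<close> and
  conversely.\<close>

lemma injective_iff:
  "(\<forall>x\<in>H2. T x = 0 \<longrightarrow> x = 0) \<longleftrightarrow> (\<forall>x\<in>H2. Ts x = 0 \<longrightarrow> x = 0)"
proof -
  have W_eq_0: "x = 0" if "x \<in> H2" "W x = 0" for x
    using W_norm[OF that(1)] that(2) by simp
  show ?thesis
  proof (intro iffI ballI impI)
    fix x assume inj: "\<forall>x\<in>H2. T x = 0 \<longrightarrow> x = 0" and x: "x \<in> H2" "Ts x = 0"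
    then have "T (W x) = 0" using W_Ts[OF x(1)] W_zero by simp
    then have "W x = 0" using inj W_in[OF x(1)] by blast
    then show "x = 0" by (rule W_eq_0[OF x(1)])
  next
    fix x assume inj: "\<forall>x\<in>H2. Ts x = 0 \<longrightarrow> x = 0" and x: "x \<in> H2" "T x = 0"
    then have "Ts (W x) = 0" using W_T[OF x(1)] W_zero by simp
    then have "W x = 0" using inj W_in[OF x(1)] by blast
    then show "x = 0" by (rule W_eq_0[OF x(1)])
  qed
qed

definition D where "D x = mult_L2 a (coanalytic a x) - mult_L2 v (coanalytic v x)"

text \<open>If \<open>A\<close> is isometric, then \<open>D\<close> is the self-commutator \<open>T\<^sup>* T - T T\<^sup>*\<close>, which \<open>W\<close> negates.\<close>

lemma W_D:
  assumes "a \<in> inner_functions" and x: "x \<in> H2"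
  shows "W (D x) = - D (W x)"
proof -
  have D: "D x = Ts (T x) - T (Ts x)" if x: "x \<in> H2" for x
  proof -
    have "Ts (T x) = (x + coanalytic v (coanalytic a x)) + (mult_L2 a (mult_L2 v x) + mult_L2 a (coanalytic a x))"
      unfolding T_def Ts_def
      by (simp add: mult_disc_add[OF a] coanalytic_add[OF v' mult_in_Hardy[OF v' x] coanalytic_in_Hardy]
          coanalytic_mult_inner[OF v x])
    moreover have "T (Ts x) = (mult_L2 v (coanalytic v x) + mult_L2 v (mult_L2 a x)) + (coanalytic a (coanalytic v x) + x)"
      unfolding T_def Ts_def
      by (simp add: mult_disc_add[OF v'] coanalytic_add[OF a coanalytic_in_Hardy mult_in_Hardy[OF a x]]
          coanalytic_mult_inner[OF assms(1) x])
    moreover note mult_disc_commute[OF a v', of x] coanalytic_commute[OF a v', of x]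
    ultimately show ?thesis
      by (simp add: D_def algebra_simps)
  qed
  have "W (D x) = T (Ts (W x)) - Ts (T (W x))"
    using x by (simp add: D W_diff W_T W_Ts T_in Ts_in W_in)
  then show ?thesis
    using D[OF W_in[OF x]] by simp
qed

text \<open>In either case of strict inequality one of \<open>T\<close> and \<open>T\<^sup>*\<close> is a
  perturbed isometry and the other one a perturbed coisometry.\<close>

lemma norm_coefficient_eq_1:
  assumes b: "b \<in> inner_functions" and ab: "\<And>z. z \<in> cball 0 1 \<Longrightarrow> a z = \<mu> * b z"
    and k: "k \<in> H2" "k \<noteq> 0" "coanalytic v k = 0"
    and f: "f \<in> H2" "f \<noteq> 0" "coanalytic b f = 0"
  shows "norm \<mu> = 1"
proof -
  note b' = inner_functionsD(1)[OF b]
  have a1: "mult_L2 a x = \<mu> *\<^sub>C mult_L2 b x" for x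
    using mult_disc_cong[OF a ab] mult_disc_cmult[OF b'] by simp
  have a2: "coanalytic a x = cnj \<mu> *\<^sub>C coanalytic b x" for x
    using coanalytic_cong[OF a ab] coanalytic_cmult[OF b'] by simp
  consider "norm \<mu> < 1" | "norm \<mu> > 1" | "norm \<mu> = 1" by linarith
  then show ?thesis
  proof cases
    case 1
    \<comment> \<open>Here \<open>T\<close> is the perturbed isometry and \<open>T\<^sup>*\<close> the perturbed coisometry.\<close>
    obtain x where "x \<in> H2" "x \<noteq> 0" "Ts x = 0"
      using perturbed_coisometry_not_injective[OF v b 1 k] by (auto simp: Ts_def a1)
    then obtain y where y: "y \<in> H2" "y \<noteq> 0" "T y = 0"
      using injective_iff by blast
    moreover have "norm (cnj \<mu>) < 1" using 1 by simp
    ultimately show ?thesis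
      using perturbed_isometry_injective[OF v b, of "cnj \<mu>" y] by (simp add: T_def a2)
  next
    case 2
    \<comment> \<open>After division by \<open>\<mu>\<close> it is \<open>T\<^sup>*\<close> that is a perturbed isometry.\<close>
    then have \<mu>: "\<mu> \<noteq> 0" "norm (1 / \<mu>) < 1" "norm (1 / cnj \<mu>) < 1"
      by (auto simp: norm_divide divide_less_eq)
    obtain x where x: "x \<in> H2" "x \<noteq> 0" "coanalytic b x + (1 / cnj \<mu>) *\<^sub>C mult_L2 v x = 0"
      using perturbed_coisometry_not_injective[OF b v \<mu>(3) f] by blast
    have "T x = cnj \<mu> *\<^sub>C (coanalytic b x + (1 / cnj \<mu>) *\<^sub>C mult_L2 v x)"
      using \<mu>(1) by (simp add: T_def a2 scaleC_algebra add.commute)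
    then obtain y where y: "y \<in> H2" "y \<noteq> 0" "Ts y = 0"
      using x injective_iff by auto
    have "mult_L2 b y + (1 / \<mu>) *\<^sub>C coanalytic v y = (1 / \<mu>) *\<^sub>C Ts y"
      using \<mu>(1) by (simp add: Ts_def a1 scaleC_algebra add.commute)
    then show ?thesis
      using perturbed_isometry_injective[OF b v \<mu>(2) y(1)] y by simp
  qed
qed

text \<open>The vector \<open>V y\<close> satisfies \<open>D (V y) = - V y\<close>, so \<open>w = W (V
  y)\<close> satisfies \<open>D w = w\<close>. As \<open>D\<close> is a difference of projections,
  \<open>w\<close> is then killed by \<open>V\<^sup>*\<close> and in the range of \<open>A\<close>, hence in
  that of \<open>c - V\<close>. From \<open>w = (c - V) t\<close> it follows that \<open>c V\<^sup>* t =
  t\<close>, which forces \<open>t = 0\<close>, and so \<open>y = 0\<close>, because \<open>\<bar>c\<bar> <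
  1\<close>.\<close>

lemma degree_less_2:
  assumes a_inner: "a \<in> inner_functions" and c: "c \<in> ball 0 1" and g: "g \<in> disc_algebra"
    and ag: "\<And>z. z \<in> cball 0 1 \<Longrightarrow> a z = disc_aut c (v z) * g z"
    and y: "y \<in> H2" "coanalytic a (mult_L2 v y) = 0"
  shows "y = 0"
proof -
  define x where "x = mult_L2 v y"
  have x: "x \<in> H2" unfolding x_def by (rule mult_in_Hardy[OF v' y(1)])
  have "D x = - x"
    unfolding D_def using y by (simp add: x_def mult_disc_zero[OF a] coanalytic_mult_inner[OF v])
  then have "- D (W x) = - W x"
    using W_D[OF a_inner x] W_diff[of 0 x] x W_zero by (simp add: Hardy_closed)
  then have Dw: "D (W x) = W x" by simp
  define w where "w = W x"
  have w: "w \<in> H2" "D w = w" using Dw W_in[OF x] by (simp_all add: w_def)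
  have "cinner w w = cinner (D w) w" using w by simp
  also have "\<dots> = cinner (coanalytic a w) (coanalytic a w) - cinner (coanalytic v w) (coanalytic v w)"
    unfolding D_def by (simp add: cinner_algebra cinner_mult_coanalytic a v' coanalytic_in_Hardy)
  finally have "complex_of_real ((norm w)\<^sup>2) = complex_of_real ((norm (coanalytic a w))\<^sup>2 - (norm (coanalytic v w))\<^sup>2)"
    unfolding cinner_self by simp
  then have "(norm w)\<^sup>2 = (norm (coanalytic a w))\<^sup>2 - (norm (coanalytic v w))\<^sup>2"
    by (simp only: of_real_eq_iff)
  moreover have "(norm (coanalytic a w))\<^sup>2 \<le> (norm w)\<^sup>2"
    by (intro power_mono norm_coanalytic_inner_le a_inner) simp
  ultimately have "(norm (coanalytic v w))\<^sup>2 \<le> 0" by simp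
  then have vw: "coanalytic v w = 0" by simp
  define u where "u = mult_L2 g (coanalytic a w)"
  have u: "u \<in> H2" unfolding u_def by (intro mult_in_Hardy g coanalytic_in_Hardy)
  define t where "t = resolvent v c u"
  have t: "t \<in> H2" unfolding t_def by (rule resolvent_in_Hardy[OF v c u])
  note aut = disc_aut_compose_disc_algebra[OF v c]
  have "w = mult_L2 a (coanalytic a w)"
    using w(2) by (simp add: D_def vw mult_disc_zero[OF v'])
  also have "\<dots> = mult_L2 (\<lambda>z. disc_aut c (v z)) u"
    unfolding u_def mult_disc_mult[OF aut g] using ag by (rule mult_disc_cong[OF a])
  also have "\<dots> = c *\<^sub>C t - mult_L2 v t"
    unfolding t_def by (rule mult_disc_aut[OF v c])
  finally have wt: "w = c *\<^sub>C t - mult_L2 v t" .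
  have "0 = coanalytic v (c *\<^sub>C t - mult_L2 v t)"
    using vw wt by simp
  also have "\<dots> = c *\<^sub>C coanalytic v t - t"
    by (simp add: coanalytic_diff[OF v'] coanalytic_scaleC[OF v'] coanalytic_mult_inner[OF v t])
  finally have "t = c *\<^sub>C coanalytic v t" by simp
  then have "norm t = norm c * norm (coanalytic v t)"
    by (metis norm_scaleC)
  also have "\<dots> \<le> norm c * norm t"
    by (intro mult_left_mono norm_coanalytic_inner_le v) auto
  finally have "(1 - norm c) * norm t \<le> 0" by (simp add: algebra_simps)
  then have "t = 0" using c by (simp add: mult_le_0_iff)
  then have "w = 0" using wt by (simp add: mult_disc_zero[OF v'])
  then have "x = 0" using W_norm[OF x] by (simp add: w_def)
  then show "y = 0" using norm_mult_inner[OF v y(1)] by (simp add: x_def)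
qed

text \<open>For \<open>k\<close> in the kernel of \<open>V\<^sup>*\<close> let \<open>F k = (I - cnj b
  V)\<inverse> k\<close>, which is in the kernel of \<open>A\<^sup>*\<close>. On the span of
  \<open>k\<close> and \<open>F k\<close> the operator \<open>D\<close> is a \<open>2 \<times> 2\<close>
  matrix with the eigenvalues \<open>s\<close> and \<open>- s\<close>, where \<open>s =
  \<bar>b\<bar>\<close>, and the eigenvectors \<open>k - (1 - s) F k\<close> and \<open>k - (1 + s) F
  k\<close>. As \<open>W\<close> preserves the quadratic form of \<open>T\<close>, the normalized values of
  this form on both eigenvectors agree.\<close>

lemma degree_1_symmetry:
  assumes q: "norm q = 1" and b: "b \<in> ball 0 1"
    and a_eq: "\<And>z. z \<in> cball 0 1 \<Longrightarrow> a z = q * disc_aut b (v z)"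
    and k: "k \<in> H2" "k \<noteq> 0" "coanalytic v k = 0"
  shows "q * b = cnj b"
proof (cases "b = 0")
  case False
  define s where "s = norm b"
  have s: "0 < s" "s < 1" using False b by (auto simp: s_def)
  have bb: "cnj b * b = complex_of_real (s\<^sup>2)"
    using complex_norm_square[of b] by (simp add: s_def mult.commute)
  have qq: "cnj q * q = 1"
    using complex_norm_square[of q] q by (simp add: mult.commute)
  note aut = disc_aut_compose_disc_algebra[OF v b]
  have a_inner: "a \<in> inner_functions"
  proof -
    have "norm (a z) = 1" if "z \<in> sphere 0 1" for z
      using a_eq[of z] norm_disc_aut_eq_1[OF b, of "v z"] inner_functionsD(2)[OF v that] that q
      by (simp add: norm_mult)
    then show ?thesis using a by (simp add: inner_functions_def)
  qed
  have a1: "mult_L2 a x = q *\<^sub>C mult_L2 (\<lambda>z. disc_aut b (v z)) x" for x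
    using mult_disc_cong[OF a a_eq] mult_disc_cmult[OF aut] by simp
  have a2: "coanalytic a x = cnj q *\<^sub>C coanalytic (\<lambda>z. disc_aut b (v z)) x" for x
    using coanalytic_cong[OF a a_eq] coanalytic_cmult[OF aut] by simp
  define \<beta> where "\<beta> = cnj (q * b)"
  define F where "F = resolvent v b"
  define e where "e t p = p - complex_of_real t *\<^sub>C F p" for t p
  have wandering: "F p \<in> H2" "mult_L2 v (F p) \<in> H2"
      "cnj b *\<^sub>C mult_L2 v (F p) = F p - p" "coanalytic v (F p) = cnj b *\<^sub>C F p"
      "coanalytic a (F p) = 0" "coanalytic a p = \<beta> *\<^sub>C p"
      "cinner p (F p) = cinner p p" "cinner (F p) p = cinner p p"
      "(1 - s\<^sup>2) * (norm (F p))\<^sup>2 = (norm p)\<^sup>2"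
    if p: "p \<in> H2" "coanalytic v p = 0" for p
  proof -
    show F: "F p \<in> H2" unfolding F_def by (rule resolvent_in_Hardy[OF v b p(1)])
    then show "mult_L2 v (F p) \<in> H2" by (rule mult_in_Hardy[OF v'])
    show "cnj b *\<^sub>C mult_L2 v (F p) = F p - p"
      using resolvent_equation[OF v b, of p] by (simp add: F_def algebra_simps)
    show vF: "coanalytic v (F p) = cnj b *\<^sub>C F p"
      unfolding F_def by (rule coanalytic_resolvent[OF v b p])
    show "coanalytic a (F p) = 0"
      using coanalytic_disc_aut_eq_0_iff[OF v b F] vF by (simp add: a2)
    show "coanalytic a p = \<beta> *\<^sub>C p"
      using coanalytic_disc_aut_wandering[OF v b p] by (simp add: a2 \<beta>_def scaleC_scaleC)
    show "cinner p (F p) = cinner p p" "cinner (F p) p = cinner p p"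
      "(1 - s\<^sup>2) * (norm (F p))\<^sup>2 = (norm p)\<^sup>2"
      using cinner_resolvent[OF v b p] by (simp_all add: F_def s_def)
  qed
  have D_F: "D (F p) = p - F p" if p: "p \<in> H2" "coanalytic v p = 0" for p
    using wandering[OF p] by (simp add: D_def mult_disc_zero[OF a] mult_disc_scaleC[OF v'])
  have D_p: "D p = p - complex_of_real (1 - s\<^sup>2) *\<^sub>C F p"
    if p: "p \<in> H2" "coanalytic v p = 0" for p
  proof -
    have "D p = \<beta> *\<^sub>C mult_L2 a p"
      using wandering[OF p] p by (simp add: D_def mult_disc_zero[OF v'] mult_disc_scaleC[OF a])
    also have "mult_L2 a p = q *\<^sub>C (b *\<^sub>C F p - mult_L2 v (F p))"
      by (simp add: a1 mult_disc_aut[OF v b] F_def)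
    also have "\<beta> *\<^sub>C q *\<^sub>C (b *\<^sub>C F p - mult_L2 v (F p))
        = (cnj q * q) *\<^sub>C ((cnj b * b) *\<^sub>C F p - cnj b *\<^sub>C mult_L2 v (F p))"
      by (simp add: \<beta>_def scaleC_algebra mult_ac)
    also have "\<dots> = complex_of_real (s\<^sup>2) *\<^sub>C F p - (F p - p)"
      using wandering(3)[OF p] by (simp add: qq bb scaleC_one)
    also have "\<dots> = p - complex_of_real (1 - s\<^sup>2) *\<^sub>C F p"
      by (simp add: scaleC_algebra)
    finally show ?thesis .
  qed
  have D_diff: "D (x - y) = D x - D y" and D_scaleC: "D (c *\<^sub>C x) = c *\<^sub>C D x" for x y c
    by (simp_all add: D_def coanalytic_diff[OF a] coanalytic_diff[OF v'] mult_disc_diff[OF a]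
        mult_disc_diff[OF v'] coanalytic_scaleC[OF a] coanalytic_scaleC[OF v'] mult_disc_scaleC[OF a]
        mult_disc_scaleC[OF v'] scaleC_algebra)
  have form: "cinner (T (e t p)) (e t p)
      = (of_real (t\<^sup>2 / (1 - s\<^sup>2) - t) * b + of_real (1 - t) * \<beta>) * cinner p p"
    and normsq: "(norm (e t p))\<^sup>2 = (1 - 2 * t + t\<^sup>2 / (1 - s\<^sup>2)) * (norm p)\<^sup>2"
    if p: "p \<in> H2" "coanalytic v p = 0" for t p
  proof -
    note w = wandering[OF p]
    have "1 - s\<^sup>2 \<noteq> 0" using s by (simp add: power2_eq_1_iff)
    then have nF: "(norm (F p))\<^sup>2 = (norm p)\<^sup>2 / (1 - s\<^sup>2)"
      using w(9) by (simp add: field_simps)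
    have FF: "cinner (F p) (F p) = cinner p p / of_real (1 - s\<^sup>2)"
      unfolding cinner_self nF by simp
    have e: "e t p \<in> H2"
      unfolding e_def by (intro Hardy_closed p w)
    have ve: "coanalytic v (e t p) = - ((of_real t * cnj b) *\<^sub>C F p)"
      using p(2) w(4) by (simp add: e_def coanalytic_diff[OF v'] coanalytic_scaleC[OF v'] scaleC_scaleC)
    have ae: "coanalytic a (e t p) = \<beta> *\<^sub>C p"
      using w(5,6) by (simp add: e_def coanalytic_diff[OF a] coanalytic_scaleC[OF a])
    have "cinner (T (e t p)) (e t p) = cinner (e t p) (coanalytic v (e t p)) + cinner (coanalytic a (e t p)) (e t p)"
      by (simp add: T_def cinner_add_left cinner_mult_coanalytic[OF v' e])
    also have "cinner (e t p) (coanalytic v (e t p)) = - (of_real t * b) * (cinner p p - of_real t * cinner p p / of_real (1 - s\<^sup>2))"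
      unfolding ve by (simp add: e_def cinner_minus_right cinner_algebra w(7) FF)
    also have "cinner (coanalytic a (e t p)) (e t p) = \<beta> * (cinner p p - of_real t * cinner p p)"
      unfolding ae by (simp add: e_def cinner_algebra w(7) algebra_simps)
    finally show "cinner (T (e t p)) (e t p)
      = (of_real (t\<^sup>2 / (1 - s\<^sup>2) - t) * b + of_real (1 - t) * \<beta>) * cinner p p"
      by (simp add: algebra_simps power2_eq_square)
    have "cinner (e t p) (e t p) = cinner p p - 2 * of_real t * cinner p p + of_real t * of_real t * cinner p p / of_real (1 - s\<^sup>2)"
      by (simp add: e_def cinner_algebra w(7,8) FF algebra_simps)
    also have "\<dots> = complex_of_real ((1 - 2 * t + t\<^sup>2 / (1 - s\<^sup>2)) * (norm p)\<^sup>2)"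
      unfolding cinner_self by (simp add: algebra_simps power2_eq_square)
    finally show "(norm (e t p))\<^sup>2 = (1 - 2 * t + t\<^sup>2 / (1 - s\<^sup>2)) * (norm p)\<^sup>2"
      unfolding cinner_self of_real_eq_iff .
  qed
  define x where "x = e (1 - s) k"
  have x: "x \<in> H2"
    unfolding x_def e_def by (intro Hardy_closed k wandering)
  have "D x = of_real s *\<^sub>C x"
  proof -
    have "D x = (k - of_real (1 - s\<^sup>2) *\<^sub>C F k) - of_real (1 - s) *\<^sub>C (k - F k)"
      unfolding x_def e_def by (simp add: D_diff D_scaleC D_p[OF k(1,3)] D_F[OF k(1,3)])
    also have "\<dots> = of_real s *\<^sub>C k - (of_real (1 - s\<^sup>2) - of_real (1 - s)) *\<^sub>C F k"
      by (simp add: scaleC_algebra)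
    also have "complex_of_real (1 - s\<^sup>2) - of_real (1 - s) = of_real s * of_real (1 - s)"
      by (simp add: algebra_simps power2_eq_square)
    finally show ?thesis
      by (simp only: x_def e_def scaleC_diff_right scaleC_scaleC)
  qed
  then have Dy: "D (W x) = - (of_real s *\<^sub>C W x)"
    using W_D[OF a_inner x] W_scaleC[OF x, of "of_real s"] by (metis complex_cnj_complex_of_real minus_minus)
  define y where "y = W x"
  have y: "y \<in> H2" unfolding y_def by (rule W_in[OF x])
  \<comment> \<open>An eigenvector for \<open>- s\<close> has the same shape, with \<open>- s\<close> in place of \<open>s\<close>.\<close>
  obtain p where p: "p \<in> H2" "coanalytic v p = 0" and yp: "y = e (1 + s) p"
  proof -
    \<comment> \<open>These are the projections of \<open>y\<close> onto the kernels of \<open>V\<^sup>*\<close> and \<open>A\<^sup>*\<close>, so \<open>m - r = D y = - s y\<close>.\<close>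
    define m where "m = y - mult_L2 v (coanalytic v y)"
    define r where "r = y - mult_L2 a (coanalytic a y)"
    have m: "m \<in> H2" and r: "r \<in> H2"
      unfolding m_def r_def by (intro Hardy_closed coanalytic_in_Hardy y v' a)+
    have vm: "coanalytic v m = 0"
      by (simp add: m_def coanalytic_diff[OF v'] coanalytic_mult_inner[OF v coanalytic_in_Hardy])
    have "coanalytic a r = 0"
      by (simp add: r_def coanalytic_diff[OF a] coanalytic_mult_inner[OF a_inner coanalytic_in_Hardy])
    then have "cnj q *\<^sub>C coanalytic (\<lambda>z. disc_aut b (v z)) r = 0"
      by (simp add: a2)
    then have "q *\<^sub>C cnj q *\<^sub>C coanalytic (\<lambda>z. disc_aut b (v z)) r = 0"
      by simp
    then have "coanalytic (\<lambda>z. disc_aut b (v z)) r = 0"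
      using qq by (simp add: scaleC_scaleC scaleC_one mult.commute)
    then have vr: "coanalytic v r = cnj b *\<^sub>C r"
      using coanalytic_disc_aut_eq_0_iff[OF v b r] by simp
    have "m - r = D y" by (simp add: m_def r_def D_def)
    then have sy: "of_real s *\<^sub>C y = r - m"
      using Dy by (simp add: y_def algebra_simps)
    have "of_real s *\<^sub>C coanalytic v y = cnj b *\<^sub>C r"
      using arg_cong[OF sy, of "coanalytic v"] vr vm by (simp add: coanalytic_diff[OF v'] coanalytic_scaleC[OF v'])
    then have "of_real s *\<^sub>C m = (r - m) - cnj b *\<^sub>C mult_L2 v r"
      using sy by (simp add: m_def scaleC_diff_right mult_disc_scaleC[OF v', symmetric])
    then have "r = complex_of_real (1 + s) *\<^sub>C m + cnj b *\<^sub>C mult_L2 v r"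
      by (simp add: scaleC_algebra algebra_simps)
    then have "r = resolvent v b (complex_of_real (1 + s) *\<^sub>C m)"
      by (rule resolvent_eqI[OF v b])
    define p where "p = of_real (- 1 / s) *\<^sub>C m"
    have p: "p \<in> H2" "coanalytic v p = 0"
      by (simp_all add: p_def m Hardy_closed coanalytic_scaleC[OF v'] vm)
    have mp: "m = of_real (- s) *\<^sub>C p"
      using s by (simp add: p_def scaleC_scaleC scaleC_one flip: of_real_mult)
    have "r = complex_of_real (- s) *\<^sub>C complex_of_real (1 + s) *\<^sub>C F p"
    proof -
      have "r = complex_of_real (1 + s) *\<^sub>C complex_of_real (- s) *\<^sub>C p + cnj b *\<^sub>C mult_L2 v r"
        using \<open>r = complex_of_real (1 + s) *\<^sub>C m + cnj b *\<^sub>C mult_L2 v r\<close> unfolding mp .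
      then have "r = resolvent v b (complex_of_real (1 + s) *\<^sub>C complex_of_real (- s) *\<^sub>C p)"
        by (rule resolvent_eqI[OF v b])
      then show ?thesis
        by (simp add: F_def resolvent_def mult_disc_scaleC[OF resolvent_symbol_disc_algebra[OF v b]]
            scaleC_scaleC mult.commute)
    qed
    then have "of_real s *\<^sub>C y = of_real s *\<^sub>C e (1 + s) p"
      unfolding sy mp e_def by (simp add: scaleC_algebra)
    then have "of_real (1 / s) *\<^sub>C of_real s *\<^sub>C y = of_real (1 / s) *\<^sub>C of_real s *\<^sub>C e (1 + s) p"
      by simp
    then have "y = e (1 + s) p"
      using s by (simp add: scaleC_scaleC scaleC_one)
    with p show ?thesis by (rule that)
  qed
  have s12: "1 - s\<^sup>2 = (1 - s) * (1 + s)" by (simp add: algebra_simps power2_eq_square)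
  have c1: "(1 - s)\<^sup>2 / (1 - s\<^sup>2) = (1 - s) / (1 + s)" and c2: "(1 + s)\<^sup>2 / (1 - s\<^sup>2) = (1 + s) / (1 - s)"
    using s unfolding s12 by (simp_all add: power2_eq_square)
  \<comment> \<open>Since \<open>norm x = norm y\<close>, this is also \<open>(norm p)\<^sup>2 / (1 - s)\<close>.\<close>
  define K where "K = (norm k)\<^sup>2 / (1 + s)"
  have K: "K \<noteq> 0" "(norm k)\<^sup>2 = K * (1 + s)"
    using k(2) s by (auto simp: K_def)
  have "(norm y)\<^sup>2 = (norm x)\<^sup>2"
    by (simp add: y_def W_norm[OF x])
  then have "(1 - 2 * (1 + s) + (1 + s) / (1 - s)) * (norm p)\<^sup>2 = (1 - 2 * (1 - s) + (1 - s) / (1 + s)) * (norm k)\<^sup>2"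
    unfolding yp x_def normsq[OF p] normsq[OF k(1,3)] c1 c2 .
  then have "(2 * s\<^sup>2 / (1 - s)) * (norm p)\<^sup>2 = (2 * s\<^sup>2 / (1 + s)) * (norm k)\<^sup>2"
    using s by (simp add: field_simps power2_eq_square)
  then have "2 * s\<^sup>2 * ((norm p)\<^sup>2 / (1 - s)) = 2 * s\<^sup>2 * K"
    by (simp add: K_def)
  then have "(norm p)\<^sup>2 / (1 - s) = K"
    by (subst (asm) mult_left_cancel) (use s in simp_all)
  then have P: "(norm p)\<^sup>2 = K * (1 - s)"
    using s by (simp add: divide_eq_eq)
  have "cinner (T y) y = cinner (T x) x"
    unfolding y_def by (rule numerical_range[OF x])
  then have "(of_real ((1 + s) / (1 - s) - (1 + s)) * b + of_real (- s) * \<beta>) * of_real (K * (1 - s))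
      = (of_real ((1 - s) / (1 + s) - (1 - s)) * b + of_real s * \<beta>) * of_real (K * (1 + s))"
    unfolding yp x_def form[OF p] form[OF k(1,3)] c1 c2 cinner_self P K(2) by simp
  moreover have "(of_real ((1 + s) / (1 - s) - (1 + s)) * b + of_real (- s) * \<beta>) * of_real (K * (1 - s))
      = of_real (((1 + s) / (1 - s) - (1 + s)) * (1 - s)) * of_real K * b - of_real (s * (1 - s)) * of_real K * \<beta>"
    unfolding of_real_mult of_real_minus by (simp add: algebra_simps)
  moreover have "((1 + s) / (1 - s) - (1 + s)) * (1 - s) = s * (1 + s)"
    using s by (simp add: field_simps)
  moreover have "(of_real ((1 - s) / (1 + s) - (1 - s)) * b + of_real s * \<beta>) * of_real (K * (1 + s))
      = of_real (((1 - s) / (1 + s) - (1 - s)) * (1 + s)) * of_real K * b + of_real (s * (1 + s)) * of_real K * \<beta>"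
    unfolding of_real_mult by (simp add: algebra_simps)
  moreover have "((1 - s) / (1 + s) - (1 - s)) * (1 + s) = - (s * (1 - s))"
    using s by (simp add: field_simps)
  ultimately have "of_real (s * (1 + s)) * of_real K * b - of_real (s * (1 - s)) * of_real K * \<beta>
      = - (of_real (s * (1 - s)) * of_real K * b) + of_real (s * (1 + s)) * of_real K * \<beta>"
    by (simp only: of_real_minus mult_minus_left)
  then have "of_real (2 * s * K) * b = of_real (2 * s * K) * \<beta>"
    by (simp add: algebra_simps)
  then have "b = \<beta>"
    using s K by simp
  from arg_cong[OF this, of cnj] show ?thesis
    by (simp add: \<beta>_def)
qed simp

end

text \<open>The vectors required by the previous lemmas are built from the Szego kernel \<open>k\<close> at
  a zero of \<open>B1\<close>, which the adjoint of \<open>V\<close> kills, by applying resolvents at zeros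
  of \<open>B2\<close>.\<close>

lemma UET_imp_degree_1:
  assumes B1: "finite_blaschke B1" and B2: "finite_blaschke B2"
    and \<phi>: "\<phi> = (\<lambda>z. B1 z + cnj (\<mu> * B2 (B1 z)))"
    and UET: "UET_on H2 (toeplitz \<phi>)"
  shows "\<exists>q b. norm q = 1 \<and> b \<in> ball 0 1 \<and> (\<forall>z\<in>cball 0 1. \<mu> * B2 z = q * disc_aut b z) \<and> q * b = cnj b"
proof -
  define v where "v = B1"
  define \<beta> where "\<beta> = (\<lambda>z. B2 (B1 z))"
  define a where "a = (\<lambda>z. \<mu> * \<beta> z)"
  have v: "v \<in> inner_functions" unfolding v_def by (rule finite_blaschke_inner[OF B1])
  note v' = inner_functionsD(1)[OF v]
  have \<beta>: "\<beta> \<in> inner_functions"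
    unfolding \<beta>_def by (rule compose_finite_blaschke(2)[OF B1 finite_blaschke_inner[OF B2]])
  have a: "a \<in> disc_algebra"
    unfolding a_def by (intro disc_algebra_intros inner_functionsD(1)[OF \<beta>])
  have v_cball: "v z \<in> cball 0 1" if "z \<in> cball 0 1" for z
    using norm_inner_function_le_1[OF v that] by simp
  have T: "toeplitz \<phi> x = mult_L2 v x + coanalytic a x" if "x \<in> H2" for x
    using toeplitz_analytic_plus_coanalytic[OF v' a that] by (simp add: \<phi> v_def a_def \<beta>_def)
  obtain W where W: "toeplitz_intertwiner v a W"
  proof (rule UET_antiunitary[OF csubspace_Hardy UET, of "\<lambda>x. coanalytic v x + mult_L2 a x"])
    show "coanalytic v x + mult_L2 a x \<in> H2" if "x \<in> H2" for x
      by (intro Hardy_closed coanalytic_in_Hardy a that)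
    show "cinner (toeplitz \<phi> x) y = cinner x (coanalytic v y + mult_L2 a y)"
      if "x \<in> H2" "y \<in> H2" for x y
      unfolding T[OF that(1)] by (rule cinner_analytic_plus_coanalytic[OF v' a that])
    fix W
    assume "\<And>x. x \<in> H2 \<Longrightarrow> W x \<in> H2"
      "\<And>y. y \<in> H2 \<Longrightarrow> \<exists>x\<in>H2. W x = y"
      "\<And>x y. x \<in> H2 \<Longrightarrow> y \<in> H2 \<Longrightarrow> W (x + y) = W x + W y"
      "\<And>c x. x \<in> H2 \<Longrightarrow> W (c *\<^sub>C x) = cnj c *\<^sub>C W x"
      "\<And>x y. x \<in> H2 \<Longrightarrow> y \<in> H2 \<Longrightarrow> cinner (W x) (W y) = cinner y x"
      "\<And>x. x \<in> H2 \<Longrightarrow> W (toeplitz \<phi> x) = coanalytic v (W x) + mult_L2 a (W x)"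
    then have "toeplitz_intertwiner v a W"
      by unfold_locales (simp_all add: v a T)
    then show thesis by (rule that)
  qed
  interpret toeplitz_intertwiner v a W by (rule W)
  obtain z0 where z0: "z0 \<in> ball 0 1" "v z0 = 0"
    using finite_blaschke_zero[OF B1] by (auto simp: v_def)
  define k where "k = szego z0"
  have k: "k \<in> H2" "k \<noteq> 0" "coanalytic v k = 0"
    using szego_in_Hardy[OF z0(1)] szego_nonzero[OF z0(1)] coanalytic_szego[OF v' z0(1)] z0(2)
    by (simp_all add: k_def)
  have res_nz: "resolvent v c x \<noteq> 0" if "c \<in> ball 0 1" "x \<noteq> 0" for c x
    using resolvent_equation[OF v that(1), of x] that(2) by (auto simp: mult_disc_zero[OF v'])
  have aut: "(\<lambda>z. disc_aut c (v z)) \<in> inner_functions" if "c \<in> ball 0 1" for c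
    unfolding v_def by (rule compose_finite_blaschke(2)[OF B1 disc_aut_inner[OF that]])
  have comp: "(\<lambda>z. G (v z)) \<in> inner_functions" if "G \<in> inner_functions" for G
    unfolding v_def by (rule compose_finite_blaschke(2)[OF B1 that])
  have \<mu>: "norm \<mu> = 1"
  proof -
    obtain c G where c: "c \<in> ball 0 1" and G: "G \<in> inner_functions"
      and B2cG: "\<And>z. z \<in> cball 0 1 \<Longrightarrow> B2 z = disc_aut c z * G z"
      using finite_blaschke_factor[OF B2] by blast
    define f where "f = resolvent v c k"
    have f: "f \<in> H2" "f \<noteq> 0"
      unfolding f_def using resolvent_in_Hardy[OF v c k(1)] res_nz[OF c k(2)] by simp_all
    have "coanalytic (\<lambda>z. disc_aut c (v z)) f = 0"
      using coanalytic_disc_aut_eq_0_iff[OF v c f(1)] coanalytic_resolvent[OF v c k(1,3)]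
      by (simp add: f_def)
    then have "coanalytic (\<lambda>z. G (v z)) (coanalytic (\<lambda>z. disc_aut c (v z)) f) = 0"
      using coanalytic_scaleC[OF inner_functionsD(1)[OF comp[OF G]], of 0 0] by simp
    moreover have "coanalytic \<beta> f = coanalytic (\<lambda>z. G (v z) * disc_aut c (v z)) f"
      by (rule coanalytic_cong[OF inner_functionsD(1)[OF \<beta>]])
        (use B2cG v_cball in \<open>simp add: \<beta>_def v_def mult.commute\<close>)
    ultimately have "coanalytic \<beta> f = 0"
      by (simp add: coanalytic_mult inner_functionsD(1)[OF comp[OF G]] inner_functionsD(1)[OF aut[OF c]])
    with \<beta> k f show ?thesis
      by (intro norm_coefficient_eq_1[of \<beta> \<mu> k f]) (simp_all add: a_def)
  qed
  have a_inner: "a \<in> inner_functions"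
    unfolding a_def by (intro inner_functions_mult inner_functions_const \<mu> \<beta>)
  from B2 show ?thesis
  proof (cases rule: finite_blaschke_cases)
    case (degree_1 b \<gamma>)
    have "a z = (\<mu> * \<gamma>) * disc_aut b (v z)" if "z \<in> cball 0 1" for z
      using degree_1(3)[OF v_cball[OF that]] by (simp add: a_def \<beta>_def v_def)
    then have "(\<mu> * \<gamma>) * b = cnj b"
      using degree_1(1,2) \<mu> k by (intro degree_1_symmetry[of "\<mu> * \<gamma>" b k]) (simp_all add: norm_mult)
    then show ?thesis
      using degree_1 \<mu> by (intro exI[of _ "\<mu> * \<gamma>"] exI[of _ b]) (simp add: norm_mult)
  next
    case (degree_ge_2 c d G)
    note autc = inner_functionsD(1)[OF aut[OF degree_ge_2(1)]]
      and autd = inner_functionsD(1)[OF aut[OF degree_ge_2(2)]]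
      and Gv = inner_functionsD(1)[OF comp[OF degree_ge_2(3)]]
    \<comment> \<open>With the zeros \<open>c\<close> and \<open>d\<close> of \<open>B2\<close>, the vector \<open>V y\<close> is killed by \<open>disc_aut c (V)\<^sup>* disc_aut d (V)\<^sup>*\<close>, a factor of \<open>A\<^sup>*\<close>.\<close>
    define f where "f = resolvent v c k"
    define y where "y = resolvent v d f"
    have f: "f \<in> H2" "f \<noteq> 0"
      unfolding f_def using resolvent_in_Hardy[OF v degree_ge_2(1) k(1)] res_nz[OF degree_ge_2(1) k(2)] by simp_all
    have y: "y \<in> H2" "y \<noteq> 0"
      unfolding y_def using resolvent_in_Hardy[OF v degree_ge_2(2) f(1)] res_nz[OF degree_ge_2(2) f(2)] by simp_all
    have Vy: "mult_L2 v y \<in> H2" by (rule mult_in_Hardy[OF v' y(1)])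
    have fc: "coanalytic (\<lambda>z. disc_aut c (v z)) f = 0"
      using coanalytic_disc_aut_eq_0_iff[OF v degree_ge_2(1) f(1)]
        coanalytic_resolvent[OF v degree_ge_2(1) k(1,3)]
      by (simp add: f_def)
    note rec = resolvent_symbol_disc_algebra[OF v degree_ge_2(2)]
    have "cnj d *\<^sub>C mult_L2 v y - y = (-1) *\<^sub>C f"
      using resolvent_equation[OF v degree_ge_2(2), of f] by (simp add: y_def scaleC_minus_one algebra_simps)
    then have "coanalytic (\<lambda>z. disc_aut d (v z)) (mult_L2 v y) = (-1) *\<^sub>C coanalytic (\<lambda>z. 1 / (1 - cnj d * v z)) f"
      unfolding coanalytic_disc_aut[OF v degree_ge_2(2) Vy] coanalytic_mult_inner[OF v y(1)]
      by (simp only: coanalytic_scaleC[OF rec])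
    then have "coanalytic (\<lambda>z. disc_aut c (v z)) (coanalytic (\<lambda>z. disc_aut d (v z)) (mult_L2 v y))
        = (-1) *\<^sub>C coanalytic (\<lambda>z. 1 / (1 - cnj d * v z)) (coanalytic (\<lambda>z. disc_aut c (v z)) f)"
      by (simp only: coanalytic_scaleC[OF autc] coanalytic_commute[OF autc rec])
    also have "\<dots> = 0"
      using coanalytic_scaleC[OF rec, of 0 0] by (simp add: fc)
    finally have 0: "coanalytic (\<lambda>z. disc_aut c (v z)) (coanalytic (\<lambda>z. disc_aut d (v z)) (mult_L2 v y)) = 0" .
    have a_eq: "a z = disc_aut c (v z) * (\<mu> * (disc_aut d (v z) * G (v z)))" if "z \<in> cball 0 1" for z
      using degree_ge_2(4)[OF v_cball[OF that]] by (simp add: a_def \<beta>_def v_def)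
    have cd: "(\<lambda>z. disc_aut c (v z) * disc_aut d (v z)) \<in> disc_algebra"
      by (intro disc_algebra_intros autc autd)
    have "coanalytic a (mult_L2 v y) = coanalytic (\<lambda>z. (\<mu> * G (v z)) * (disc_aut c (v z) * disc_aut d (v z))) (mult_L2 v y)"
      by (rule coanalytic_cong[OF a]) (simp add: a_eq)
    also have "\<dots> = coanalytic (\<lambda>z. \<mu> * G (v z)) (coanalytic (\<lambda>z. disc_aut c (v z) * disc_aut d (v z)) (mult_L2 v y))"
      by (rule coanalytic_mult[symmetric]) (intro disc_algebra_intros Gv cd)+
    also have "coanalytic (\<lambda>z. disc_aut c (v z) * disc_aut d (v z)) (mult_L2 v y) = 0"
      using 0 by (simp only: coanalytic_mult[OF autc autd])
    also have "coanalytic (\<lambda>z. \<mu> * G (v z)) 0 = 0"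
      using coanalytic_scaleC[OF disc_algebra_mult[OF disc_algebra_const Gv], of \<mu> 0 0] by simp
    finally have "coanalytic a (mult_L2 v y) = 0" .
    moreover have "(\<lambda>z. \<mu> * (disc_aut d (v z) * G (v z))) \<in> disc_algebra"
      by (intro disc_algebra_intros autd Gv)
    ultimately have "y = 0"
      using degree_less_2[OF a_inner degree_ge_2(1) _ a_eq y(1)] by blast
    with y(2) show ?thesis by simp
  qed
qed

section \<open>Difference quotients and the natural conjugation of the model space\<close>

text \<open>For an inner function \<open>v\<close> this is the conjugate kernel of its model space. The
  value on the diagonal makes it continuous.\<close>

definition difference_quotient :: "(complex \<Rightarrow> complex) \<Rightarrow> complex \<Rightarrow> complex \<Rightarrow> complex" where
  "difference_quotient v z w = (if w = z then deriv v z else (v w - v z) / (w - z))"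

lemma difference_quotient_commute:
  "difference_quotient v z w = difference_quotient v w z"
proof (cases "w = z")
  case False
  then show ?thesis
    by (simp add: difference_quotient_def divide_simps) (simp add: algebra_simps)
qed simp

lemma difference_quotient_disc_algebra:
  assumes v: "v \<in> disc_algebra" and z: "z \<in> ball 0 1"
  shows "difference_quotient v z \<in> disc_algebra"
proof -
  have hol: "difference_quotient v z holomorphic_on ball 0 1"
    unfolding difference_quotient_def[abs_def]
    by (rule pole_lemma_open[OF disc_algebraD(2)[OF v] open_ball])
  have eq: "ball 0 1 \<union> (cball 0 1 - {z}) = cball (0::complex) 1"
    using z by auto
  have "continuous_on (ball 0 1 \<union> (cball 0 1 - {z})) (difference_quotient v z)"
  proof (rule continuous_on_Un_local_open)
    show "openin (top_of_set (ball 0 1 \<union> (cball 0 1 - {z}))) (ball 0 1)"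
      unfolding eq by (rule open_subset) auto
    show "openin (top_of_set (ball 0 1 \<union> (cball 0 1 - {z}))) (cball 0 1 - {z})"
      unfolding eq by (rule openin_delete) simp
    show "continuous_on (ball 0 1) (difference_quotient v z)"
      by (rule holomorphic_on_imp_continuous_on[OF hol])
    have "continuous_on (cball 0 1 - {z}) (\<lambda>w. (v w - v z) / (w - z))"
      by (intro continuous_intros continuous_on_subset[OF disc_algebraD(1)[OF v]]) auto
    then show "continuous_on (cball 0 1 - {z}) (difference_quotient v z)"
      by (rule continuous_on_eq) (auto simp: difference_quotient_def)
  qed
  with hol show ?thesis by (simp add: disc_algebra_def eq)
qed

text \<open>The reproducing kernel of the model space of an inner function \<open>v\<close>, the kernel of
  the adjoint of multiplication by \<open>v\<close>.\<close>

definition model_kernel :: "(complex \<Rightarrow> complex) \<Rightarrow> complex \<Rightarrow> complex \<Rightarrow> complex" where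
  "model_kernel v z w = (1 - cnj (v z) * v w) * szego_kernel z w"

context
  fixes v :: "complex \<Rightarrow> complex"
  assumes v: "v \<in> inner_functions"
begin

private lemma v_in_disc: "v \<in> disc_algebra" using v by (rule inner_functionsD)

lemma model_kernel_disc_algebra: "z \<in> ball 0 1 \<Longrightarrow> model_kernel v z \<in> disc_algebra"
  unfolding model_kernel_def[abs_def]
  by (intro disc_algebra_intros v_in_disc szego_kernel_disc_algebra)

text \<open>The map \<open>f \<mapsto> cnj w * v w * cnj (f w)\<close> on the circle is the natural
  conjugation of the model space of \<open>v\<close>, here applied to its reproducing kernels.\<close>

lemma difference_quotient_on_circle:
  assumes z: "z \<in> ball 0 1" and w: "w \<in> sphere 0 1"
  shows "difference_quotient v z w = cnj w * v w * cnj (model_kernel v z w)"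
proof -
  have ww: "cnj w * w = 1"
    using w complex_norm_square[of w] by (simp add: mult.commute)
  have vv: "v w * cnj (v w) = 1"
    using inner_functionsD(2)[OF v w] complex_norm_square[of "v w"] by simp
  have wz: "w \<noteq> z" using z w by auto
  have "cnj (1 - cnj z * w) \<noteq> 0"
    using mult_lt_one_neq[of "cnj z" w] z w by (simp only: complex_cnj_zero_iff) simp
  then have nz: "1 - z * cnj w \<noteq> 0" by simp
  have "cnj w * (w - z) = 1 - z * cnj w"
    using ww by (simp add: algebra_simps)
  then have "cnj w / (1 - z * cnj w) = 1 / (w - z)"
    using nz wz by (simp add: divide_simps)
  moreover have "v w * (1 - v z * cnj (v w)) = v w - v z"
    using vv by (simp add: algebra_simps)
  ultimately have "(v w * (1 - v z * cnj (v w))) * (cnj w / (1 - z * cnj w)) = (v w - v z) * (1 / (w - z))"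
    by simp
  then show ?thesis
    using wz by (simp add: difference_quotient_def model_kernel_def szego_kernel_def mult_ac)
qed

lemma L2_class_model_kernel:
  assumes z: "z \<in> ball 0 1"
  shows "L2_class (model_kernel v z) = szego z - cnj (v z) *\<^sub>C mult_L2 v (szego z)"
proof -
  note k = disc_algebraD(4)[OF szego_kernel_disc_algebra[OF z]]
  have vk: "(\<lambda>w. v w * szego_kernel z w) \<in> disc_algebra"
    by (intro disc_algebra_intros v_in_disc szego_kernel_disc_algebra z)
  have "szego z - cnj (v z) *\<^sub>C mult_L2 v (szego z)
      = L2_class (szego_kernel z) - L2_class (\<lambda>w. cnj (v z) * (v w * szego_kernel z w))"
    using k disc_algebraD(4)[OF vk]
    by (simp add: szego_def mult_L2_class continuous_on_circle_Linfty disc_algebraD(3)[OF v_in_disc] L2_class_scaleC)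
  also have "\<dots> = L2_class (\<lambda>w. szego_kernel z w - cnj (v z) * (v w * szego_kernel z w))"
    by (intro L2_class_diff k sq_integrable_cmult disc_algebraD(4)[OF vk])
  also have "\<dots> = L2_class (model_kernel v z)"
    by (simp add: model_kernel_def[abs_def] algebra_simps)
  finally show ?thesis by simp
qed

lemma coanalytic_model_kernel:
  assumes z: "z \<in> ball 0 1"
  shows "coanalytic v (L2_class (model_kernel v z)) = 0"
  by (simp add: L2_class_model_kernel[OF z] coanalytic_diff[OF v_in_disc] coanalytic_scaleC[OF v_in_disc]
      coanalytic_mult_inner[OF v szego_in_Hardy[OF z]] coanalytic_szego[OF v_in_disc z])

text \<open>The natural conjugation of the model space is isometric, which reduces the claim to the
  reproducing property.\<close>

lemma cinner_difference_quotient: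
  assumes z: "z \<in> ball 0 1" and w: "w \<in> ball 0 1"
  shows "cinner (L2_class (difference_quotient v z)) (L2_class (difference_quotient v w))
    = (1 - v z * cnj (v w)) * szego_kernel w z"
proof -
  note Q = disc_algebraD(4)[OF difference_quotient_disc_algebra[OF v_in_disc]]
  note K = disc_algebraD(4)[OF model_kernel_disc_algebra]
  have "cinner (L2_class (difference_quotient v z)) (L2_class (difference_quotient v w))
      = (LINT x|circle_measure. difference_quotient v z x * cnj (difference_quotient v w x))"
    by (rule cinner_L2_class[OF Q[OF z] Q[OF w]])
  also have "\<dots> = (LINT x|circle_measure. model_kernel v w x * cnj (model_kernel v z x))"
  proof (rule Bochner_Integration.integral_cong[OF refl])
    fix x assume "x \<in> space circle_measure"
    then have x: "x \<in> sphere 0 1" by simp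
    have "(cnj x * v x) * cnj (cnj x * v x) = 1"
      using x inner_functionsD(2)[OF v x] complex_norm_square[of "cnj x * v x"] by (simp add: norm_mult)
    then show "difference_quotient v z x * cnj (difference_quotient v w x)
        = model_kernel v w x * cnj (model_kernel v z x)"
      unfolding difference_quotient_on_circle[OF z x] difference_quotient_on_circle[OF w x]
        complex_cnj_mult complex_cnj_cnj
      by (metis (no_types, opaque_lifting) mult.assoc mult.commute mult_1)
  qed
  also have "\<dots> = cinner (L2_class (model_kernel v w)) (L2_class (model_kernel v z))"
    by (rule cinner_L2_class[symmetric, OF K[OF w] K[OF z]])
  also have "\<dots> = cinner (L2_class (model_kernel v w)) (szego z)"
    unfolding L2_class_model_kernel[OF z] cinner_diff_right cinner_scaleC_right
      cinner_coanalytic[OF v_in_disc szego_in_Hardy[OF z], symmetric] coanalytic_model_kernel[OF w]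
    by simp
  also have "\<dots> = (1 - v z * cnj (v w)) * szego_kernel w z"
    by (simp add: cinner_L2_class_szego[OF model_kernel_disc_algebra[OF w] z] model_kernel_def mult.commute)
  finally show ?thesis .
qed

text \<open>Against \<open>v f\<close> the boundary values of the difference quotient leave the conjugate of
  an analytic function that vanishes at \<open>0\<close>.\<close>

lemma coanalytic_difference_quotient:
  assumes z: "z \<in> ball 0 1"
  shows "coanalytic v (L2_class (difference_quotient v z)) = 0"
proof (rule szego_total[OF coanalytic_in_Hardy])
  fix w :: complex assume w: "w \<in> ball 0 1"
  note k = szego_kernel_disc_algebra[OF w]
  have vk: "(\<lambda>x. v x * szego_kernel w x) \<in> disc_algebra"
    by (intro disc_algebra_intros v_in_disc k)
  have h: "(\<lambda>x. x * model_kernel v z x * szego_kernel w x) \<in> disc_algebra"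
    by (intro disc_algebra_intros model_kernel_disc_algebra z k)
  have one: "szego_kernel 0 \<in> disc_algebra" by (rule szego_kernel_disc_algebra) simp
  have "cinner (coanalytic v (L2_class (difference_quotient v z))) (szego w)
      = cinner (L2_class (difference_quotient v z)) (L2_class (\<lambda>x. v x * szego_kernel w x))"
    unfolding cinner_coanalytic[OF v_in_disc szego_in_Hardy[OF w]]
    by (simp add: szego_def mult_L2_class continuous_on_circle_Linfty disc_algebraD(3)[OF v_in_disc] disc_algebraD(4)[OF k])
  also have "\<dots> = (LINT x|circle_measure. difference_quotient v z x * cnj (v x * szego_kernel w x))"
    by (intro cinner_L2_class disc_algebraD(4) difference_quotient_disc_algebra v_in_disc z vk)
  also have "\<dots> = (LINT x|circle_measure. szego_kernel 0 x * cnj (x * model_kernel v z x * szego_kernel w x))"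
  proof (rule Bochner_Integration.integral_cong[OF refl])
    fix x assume "x \<in> space circle_measure"
    then have x: "x \<in> sphere 0 1" by simp
    have "v x * cnj (v x) = 1"
      using inner_functionsD(2)[OF v x] complex_norm_square[of "v x"] by simp
    then have "difference_quotient v z x * cnj (v x) = cnj x * cnj (model_kernel v z x)"
      unfolding difference_quotient_on_circle[OF z x]
      by (metis (no_types, opaque_lifting) mult.assoc mult.commute mult_1)
    then show "difference_quotient v z x * cnj (v x * szego_kernel w x)
        = szego_kernel 0 x * cnj (x * model_kernel v z x * szego_kernel w x)"
      by (simp add: mult.assoc[symmetric]) (simp add: szego_kernel_def)
  qed
  also have "\<dots> = cinner (szego 0) (L2_class (\<lambda>x. x * model_kernel v z x * szego_kernel w x))"
    unfolding szego_def by (rule cinner_L2_class[symmetric, OF disc_algebraD(4)[OF one] disc_algebraD(4)[OF h]])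
  also have "\<dots> = cnj (cinner (L2_class (\<lambda>x. x * model_kernel v z x * szego_kernel w x)) (szego 0))"
    by (rule cinner_commute)
  also have "\<dots> = 0"
    using cinner_L2_class_szego[OF h, of 0] by simp
  finally show "cinner (coanalytic v (L2_class (difference_quotient v z))) (szego w) = 0" .
qed

text \<open>The conjugation maps the Szego kernel at \<open>z\<close> to \<open>G z\<close>, a multiple of the resolvent
  \<open>(I - a z V)\<inverse>\<close> applied to the difference quotient at \<open>z\<close>. Since \<open>V\<^sup>*\<close> kills the difference quotient,
  \<open>G z\<close> is an eigenvector of \<open>V\<^sup>*\<close> for \<open>a z\<close>. The Szego kernel is an eigenvector of \<open>A\<^sup>*\<close> for
  \<open>cnj (a z)\<close>, so \<open>C A\<^sup>* = V\<^sup>* C\<close> holds on a total set. The normalizing factor of \<open>G z\<close> makes the Gram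
  matrices agree.\<close>

lemma conjugation_intertwining_adjoint:
  assumes v_lt: "\<And>z. z \<in> ball 0 1 \<Longrightarrow> norm (v z) < 1"
    and q: "norm q = 1" and b: "b \<in> ball 0 1" and qb: "q * b = cnj b"
    and a: "a \<in> disc_algebra" and a_eq: "\<And>z. z \<in> cball 0 1 \<Longrightarrow> a z = q * disc_aut b (v z)"
  shows "\<exists>C. conjugation_on H2 C \<and>
    (\<forall>x\<in>H2. C (mult_L2 v x + coanalytic a x) = coanalytic v (C x) + mult_L2 a (C x))"
proof -
  define s where "s = complex_of_real (sqrt (1 - (norm b)\<^sup>2))"
  have s2: "s * s = 1 - b * cnj b"
  proof -
    have "(norm b)\<^sup>2 \<le> 1" using b by (simp add: abs_square_le_1)
    then have "s * s = complex_of_real (1 - (norm b)\<^sup>2)"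
      unfolding s_def of_real_mult[symmetric] by simp
    then show ?thesis by (simp add: complex_norm_square del: of_real_power)
  qed
  have s_cnj: "cnj s = s" by (simp add: s_def)
  have vb: "1 - cnj b * v z \<noteq> 0" if "z \<in> cball 0 1" for z
    using norm_inner_function_le_1[OF v that] b by (intro mult_lt_one_neq) auto
  have a_lt: "norm (a z) < 1" if "z \<in> ball 0 1" for z
    using a_eq[of z] norm_disc_aut_less_1[OF b, of "v z"] v_lt[OF that] that q by (simp add: norm_mult)
  have av: "1 - a z * v w \<noteq> 0" if "z \<in> ball 0 1" "w \<in> cball 0 1" for z w
    by (rule mult_lt_one_neq[OF a_lt[OF that(1)] norm_inner_function_le_1[OF v that(2)]])
  define G where "G z = (\<lambda>w. (s / (1 - cnj b * v z)) * difference_quotient v z w / (1 - a z * v w))" for z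
  \<comment> \<open>The relation between \<open>q\<close> and \<open>b\<close> makes this product symmetric in \<open>z\<close> and \<open>w\<close>.\<close>
  have den: "(1 - cnj b * v z) * (1 - a z * v w) = 1 - cnj b * v z - cnj b * v w + q * v z * v w"
    if "z \<in> cball 0 1" for z w
  proof -
    have "(1 - cnj b * v z) * a z = q * (b - v z)"
      using vb[OF that] a_eq[OF that] by (simp add: disc_aut_def)
    also have "\<dots> = cnj b - q * v z" using qb by (simp add: algebra_simps)
    finally have "(1 - cnj b * v z) * a z * v w = (cnj b - q * v z) * v w" by simp
    then show ?thesis by (simp add: algebra_simps)
  qed
  have G_A: "G z \<in> disc_algebra" if "z \<in> ball 0 1" for z
    unfolding G_def using av[OF that]
    by (intro disc_algebra_intros difference_quotient_disc_algebra v_in_disc that) auto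
  have G_commute: "G z w = G w z" if "z \<in> ball 0 1" "w \<in> ball 0 1" for z w
  proof -
    have "G z w = s * difference_quotient v z w / ((1 - cnj b * v z) * (1 - a z * v w))" for z w
      by (simp add: G_def)
    moreover have "(1 - cnj b * v z) * (1 - a z * v w) = (1 - cnj b * v w) * (1 - a w * v z)"
    proof -
      have zw: "z \<in> cball 0 1" "w \<in> cball 0 1" using that by auto
      show ?thesis unfolding den[OF zw(1)] den[OF zw(2)] by (simp add: algebra_simps)
    qed
    ultimately show ?thesis
      using difference_quotient_commute[of v z w] by simp
  qed
  define Q where "Q z = L2_class (difference_quotient v z)" for z
  define g where "g z = L2_class (G z)" for z
  have g_H: "g z \<in> H2" if "z \<in> ball 0 1" for z
    unfolding g_def by (rule L2_class_in_Hardy[OF G_A[OF that]])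
  have Q_H: "Q z \<in> H2" if "z \<in> ball 0 1" for z
    unfolding Q_def by (rule L2_class_in_Hardy[OF difference_quotient_disc_algebra[OF v_in_disc that]])
  have g_eq: "g z = (s / (1 - cnj b * v z)) *\<^sub>C Q z + a z *\<^sub>C mult_L2 v (g z)" if z: "z \<in> ball 0 1" for z
  proof -
    have vG: "(\<lambda>w. v w * G z w) \<in> disc_algebra" by (intro disc_algebra_intros v_in_disc G_A z)
    have "(s / (1 - cnj b * v z)) *\<^sub>C Q z + a z *\<^sub>C mult_L2 v (g z)
        = L2_class (\<lambda>w. (s / (1 - cnj b * v z)) * difference_quotient v z w) + L2_class (\<lambda>w. a z * (v w * G z w))"
      using disc_algebraD(4)[OF vG] disc_algebraD(4)[OF G_A[OF z]]
        disc_algebraD(4)[OF difference_quotient_disc_algebra[OF v_in_disc z]]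
      by (simp add: Q_def g_def mult_L2_class continuous_on_circle_Linfty disc_algebraD(3)[OF v_in_disc] L2_class_scaleC)
    also have "\<dots> = L2_class (\<lambda>w. (s / (1 - cnj b * v z)) * difference_quotient v z w + a z * (v w * G z w))"
      by (intro L2_class_add sq_integrable_cmult disc_algebraD(4) difference_quotient_disc_algebra v_in_disc z vG)
    also have "\<dots> = L2_class (G z)"
    proof (rule L2_class_cong)
      fix w :: complex assume "w \<in> sphere 0 1"
      then have "1 - a z * v w \<noteq> 0" using av[OF z, of w] by simp
      moreover define c where "c = (s / (1 - cnj b * v z)) * difference_quotient v z w"
      ultimately show "(s / (1 - cnj b * v z)) * difference_quotient v z w + a z * (v w * G z w) = G z w"
        unfolding G_def c_def[symmetric] by (simp add: field_simps)
    qed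
    finally show ?thesis by (simp add: g_def)
  qed
  have vQ: "coanalytic v (Q z) = 0" if "z \<in> ball 0 1" for z
    unfolding Q_def by (rule coanalytic_difference_quotient[OF that])
  have vg: "coanalytic v (g z) = a z *\<^sub>C g z" if z: "z \<in> ball 0 1" for z
  proof -
    have "coanalytic v (g z) = coanalytic v ((s / (1 - cnj b * v z)) *\<^sub>C Q z + a z *\<^sub>C mult_L2 v (g z))"
      using g_eq[OF z] by simp
    also have "\<dots> = a z *\<^sub>C g z"
      by (simp add: coanalytic_add[OF v_in_disc] coanalytic_scaleC[OF v_in_disc] Hardy_closed Q_H[OF z] g_H[OF z]
          v_in_disc vQ[OF z] coanalytic_mult_inner[OF v g_H[OF z]])
    finally show ?thesis .
  qed
  have iso: "cinner (g z) (g w) = cinner (szego w) (szego z)" if z: "z \<in> ball 0 1" and w: "w \<in> ball 0 1" for z w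
  proof -
    define c where "c z = s / (1 - cnj b * v z)" for z
    have "cinner (g z) (g w) = cinner (c z *\<^sub>C Q z + a z *\<^sub>C mult_L2 v (g z)) (c w *\<^sub>C Q w + a w *\<^sub>C mult_L2 v (g w))"
      using g_eq[OF z] g_eq[OF w] unfolding c_def by simp
    also have "\<dots> = c z * cnj (c w) * cinner (Q z) (Q w) + a z * cnj (a w) * cinner (g z) (g w)"
    proof -
      have "cinner (Q z) (mult_L2 v (g w)) = 0"
        using cinner_coanalytic[OF v_in_disc g_H[OF w], of "Q z"] vQ[OF z] by simp
      moreover have "cinner (mult_L2 v (g z)) (Q w) = 0"
        using cinner_mult_coanalytic[OF v_in_disc g_H[OF z], of "Q w"] vQ[OF w] by simp
      moreover have "cinner (mult_L2 v (g z)) (mult_L2 v (g w)) = cinner (g z) (g w)"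
        by (rule cinner_mult_inner[OF v g_H[OF z] g_H[OF w]])
      ultimately show ?thesis by (simp add: cinner_algebra)
    qed
    finally have "(1 - a z * cnj (a w)) * cinner (g z) (g w) = c z * cnj (c w) * cinner (Q z) (Q w)"
      by (simp add: algebra_simps)
    also have "\<dots> = c z * cnj (c w) * (1 - v z * cnj (v w)) * szego_kernel w z"
      unfolding Q_def cinner_difference_quotient[OF z w] by simp
    also have "c z * cnj (c w) * (1 - v z * cnj (v w)) = 1 - a z * cnj (a w)"
    proof -
      have zw: "z \<in> cball 0 1" "w \<in> cball 0 1" using z w by auto
      have "a z * cnj (a w) = (q * cnj q) * (disc_aut b (v z) * cnj (disc_aut b (v w)))"
        using a_eq[OF zw(1)] a_eq[OF zw(2)] by simp
      also have "q * cnj q = 1" using q complex_norm_square[of q] by simp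
      finally have "1 - a z * cnj (a w) = 1 - disc_aut b (v z) * cnj (disc_aut b (v w))" by simp
      also have "\<dots> = (1 - b * cnj b) * (1 - v z * cnj (v w)) / ((1 - cnj b * v z) * (1 - b * cnj (v w)))"
        using norm_inner_function_le_1[OF v] zw by (intro disc_aut_identity b) auto
      finally show ?thesis
        by (simp add: c_def s_cnj s2[symmetric])
    qed
    finally have "(1 - a z * cnj (a w)) * cinner (g z) (g w) = (1 - a z * cnj (a w)) * szego_kernel w z" .
    moreover have "1 - a z * cnj (a w) \<noteq> 0"
      using a_lt[OF z] a_lt[OF w] by (intro mult_lt_one_neq) auto
    moreover have "szego_kernel w z = cinner (szego w) (szego z)"
      using cinner_L2_class_szego[OF szego_kernel_disc_algebra[OF w] z] by (simp add: szego_def)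
    ultimately show ?thesis by simp
  qed
  have "\<exists>C. conjugation_on H2 C \<and> (\<forall>z\<in>ball 0 1. C (szego z) = g z)"
  proof (rule conjugation_from_total_family[OF csubspace_Hardy complete_Hardy])
    show "cinner (g z) (szego w) = cinner (g w) (szego z)" if "z \<in> ball 0 1" "w \<in> ball 0 1" for z w
      using G_commute[OF that] by (simp only: g_def cinner_L2_class_szego G_A that)
  qed (fact szego_in_Hardy g_H szego_total iso)+
  then obtain C where C: "conjugation_on H2 C" and Cg: "\<And>z. z \<in> ball 0 1 \<Longrightarrow> C (szego z) = g z"
    by blast
  have C_in: "C x \<in> H2" and CC: "C (C x) = x" if "x \<in> H2" for x
    using C that by (auto simp: conjugation_on_def)
  have C_add: "C (x + y) = C x + C y" and C_iso: "cinner (C x) (C y) = cinner y x"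
    if "x \<in> H2" "y \<in> H2" for x y
    using C that by (auto simp: conjugation_on_def)
  have C_sym: "cinner (C x) y = cinner (C y) x" if "x \<in> H2" "y \<in> H2" for x y
    using C_iso[of x "C y"] that C_in CC by simp
  have g_total: "x = y" if x: "x \<in> H2" and y: "y \<in> H2"
    and "\<And>z. z \<in> ball 0 1 \<Longrightarrow> cinner x (g z) = cinner y (g z)" for x y
  proof -
    have d: "x - y \<in> H2" by (intro Hardy_closed x y)
    have "C (x - y) = 0"
    proof (rule szego_total[OF C_in[OF d]])
      fix z :: complex assume z: "z \<in> ball 0 1"
      have "cinner (C (x - y)) (szego z) = cinner (g z) (x - y)"
        using C_sym[OF d szego_in_Hardy[OF z]] Cg[OF z] by simp
      also have "\<dots> = cnj (cinner (x - y) (g z))" by (rule cinner_commute)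
      also have "\<dots> = 0" using that(3)[OF z] by (simp add: cinner_diff_left)
      finally show "cinner (C (x - y)) (szego z) = 0" .
    qed
    then have "cinner (x - y) (x - y) = 0"
      using C_iso[OF d d] by simp
    then show ?thesis by simp
  qed
  have VC: "mult_L2 v (C x) = C (mult_L2 a x)" if x: "x \<in> H2" for x
  proof (rule g_total)
    show "mult_L2 v (C x) \<in> H2" "C (mult_L2 a x) \<in> H2"
      by (intro mult_in_Hardy v_in_disc C_in a x)+
    fix z :: complex assume z: "z \<in> ball 0 1"
    have "cinner (mult_L2 v (C x)) (g z) = cnj (a z) * cinner (C x) (C (szego z))"
      using cinner_mult_coanalytic[OF v_in_disc C_in[OF x], of "g z"] by (simp add: vg[OF z] cinner_scaleC_right Cg[OF z])
    also have "\<dots> = cnj (a z * cinner x (szego z))"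
      unfolding C_iso[OF x szego_in_Hardy[OF z]] by (subst cinner_commute) simp
    also have "\<dots> = cnj (cinner (mult_L2 a x) (szego z))"
      by (simp add: cinner_mult_szego[OF a x z])
    also have "\<dots> = cinner (szego z) (mult_L2 a x)"
      by (rule cinner_commute[symmetric])
    also have "\<dots> = cinner (C (mult_L2 a x)) (C (szego z))"
      by (rule C_iso[symmetric]) (intro mult_in_Hardy a x szego_in_Hardy z)+
    finally show "cinner (mult_L2 v (C x)) (g z) = cinner (C (mult_L2 a x)) (g z)"
      by (simp add: Cg[OF z])
  qed
  show ?thesis
  proof (intro exI[of _ C] conjI ballI C)
    fix x assume x: "x \<in> H2"
    have 1: "C (mult_L2 v x) = mult_L2 a (C x)"
      using VC[OF C_in[OF x]] CC[OF x] CC[OF mult_in_Hardy[OF a C_in[OF x]]] by simp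
    have 2: "C (coanalytic a x) = coanalytic v (C x)"
    proof (rule Hardy_ext)
      fix y assume y: "y \<in> H2"
      have "cinner (C (coanalytic a x)) y = cinner (C y) (coanalytic a x)"
        by (rule C_sym[OF coanalytic_in_Hardy y])
      also have "\<dots> = cinner (mult_L2 a (C y)) x"
        by (rule cinner_mult_coanalytic[OF a C_in[OF y], symmetric])
      also have "mult_L2 a (C y) = C (mult_L2 v y)"
        using VC[OF C_in[OF y]] CC[OF y] CC[OF mult_in_Hardy[OF a C_in[OF y]]] by simp
      also have "cinner (C (mult_L2 v y)) x = cinner (C x) (mult_L2 v y)"
        by (rule C_sym[OF mult_in_Hardy[OF v_in_disc y] x])
      also have "\<dots> = cinner (coanalytic v (C x)) y"
        by (rule cinner_coanalytic[OF v_in_disc y, symmetric])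
      finally show "cinner (C (coanalytic a x)) y = cinner (coanalytic v (C x)) y" .
    qed (intro C_in coanalytic_in_Hardy)+
    show "C (mult_L2 v x + coanalytic a x) = coanalytic v (C x) + mult_L2 a (C x)"
      by (simp add: C_add[OF mult_in_Hardy[OF v_in_disc x] coanalytic_in_Hardy] 1 2 add.commute)
  qed
qed

end

section \<open>Equivalence of complex symmetry and UET\<close>

text \<open>The relation \<open>C T = T\<^sup>* C\<close> of the previous lemma and \<open>C\<^sup>2 =
  I\<close> give \<open>C T C = T\<^sup>*\<close>.\<close>

lemma degree_1_imp_complex_symmetric:
  assumes B1: "finite_blaschke B1" and B2: "finite_blaschke B2"
    and \<phi>: "\<phi> = (\<lambda>z. B1 z + cnj (\<mu> * B2 (B1 z)))"
    and q: "norm q = 1" and b: "b \<in> ball 0 1" and qb: "q * b = cnj b"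
    and B2_eq: "\<And>z. z \<in> cball 0 1 \<Longrightarrow> \<mu> * B2 z = q * disc_aut b z"
  shows "complex_symmetric_on H2 (toeplitz \<phi>)"
proof -
  define a where "a = (\<lambda>z. \<mu> * B2 (B1 z))"
  have v: "B1 \<in> inner_functions" by (rule finite_blaschke_inner[OF B1])
  note v' = inner_functionsD(1)[OF v]
  have a: "a \<in> disc_algebra"
    unfolding a_def
    by (intro disc_algebra_intros compose_finite_blaschke(1)[OF B1] inner_functionsD(1)[OF finite_blaschke_inner[OF B2]])
  have a_eq: "a z = q * disc_aut b (B1 z)" if "z \<in> cball 0 1" for z
    using B2_eq[of "B1 z"] norm_inner_function_le_1[OF v that] by (simp add: a_def)
  have T: "toeplitz \<phi> x = mult_L2 B1 x + coanalytic a x" if "x \<in> H2" for x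
    using toeplitz_analytic_plus_coanalytic[OF v' a that] by (simp add: \<phi> a_def)
  obtain C where C: "conjugation_on H2 C"
    and CT: "\<And>x. x \<in> H2 \<Longrightarrow> C (mult_L2 B1 x + coanalytic a x) = coanalytic B1 (C x) + mult_L2 a (C x)"
    using conjugation_intertwining_adjoint[OF v finite_blaschke_norm_less_1[OF B1] q b qb a a_eq] by blast
  have "continuous_on (sphere 0 1) \<phi>"
    using continuous_on_add[OF disc_algebraD(3)[OF v'] continuous_on_cnj[OF disc_algebraD(3)[OF a]]]
    by (simp add: \<phi> a_def)
  then have "bounded_op_on H2 (toeplitz \<phi>)"
    by (rule bounded_op_on_toeplitz)
  moreover have "C (toeplitz \<phi> (C x)) = adjoint_on H2 (toeplitz \<phi>) x" if x: "x \<in> H2" for x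
  proof -
    have Cx: "C x \<in> H2" "C (C x) = x"
      using C x by (auto simp: conjugation_on_def)
    have "adjoint_on H2 (toeplitz \<phi>) x = coanalytic B1 x + mult_L2 a x"
    proof (rule adjoint_on_eqI[OF csubspace_Hardy, of "\<lambda>x. coanalytic B1 x + mult_L2 a x"])
      show "coanalytic B1 x + mult_L2 a x \<in> H2"
        by (intro Hardy_closed coanalytic_in_Hardy a x)
      show "cinner (toeplitz \<phi> y) x = cinner y (coanalytic B1 x + mult_L2 a x)" if "y \<in> H2" for y
        unfolding T[OF that] by (rule cinner_analytic_plus_coanalytic[OF v' a that x])
    qed
    also have "\<dots> = C (toeplitz \<phi> (C x))"
      by (simp add: T[OF Cx(1)] CT[OF Cx(1)] Cx(2))
    finally show ?thesis by simp
  qed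
  ultimately show ?thesis
    using C by (auto simp: complex_symmetric_on_def)
qed

theorem theorem1p3:
  fixes B1 B2 \<phi> :: "complex \<Rightarrow> complex" and \<mu> :: complex
  assumes "finite_blaschke B1" and "finite_blaschke B2"
    and "\<phi> = (\<lambda>z. B1 z + cnj (\<mu> * B2 (B1 z)))"
  shows "(complex_symmetric_on Hardy_circle (toeplitz \<phi>) \<longleftrightarrow> UET_on Hardy_circle (toeplitz \<phi>)) \<and>
    (UET_on Hardy_circle (toeplitz \<phi>) \<longleftrightarrow>
      (\<exists>q b. norm q = 1 \<and> b \<in> ball 0 1 \<and> (\<forall>z\<in>cball 0 1. \<mu> * B2 z = q * disc_aut b z) \<and>
        q * b = cnj b))"
    (is "(?a \<longleftrightarrow> ?b) \<and> (?b \<longleftrightarrow> ?c)")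
proof -
  have "?a \<Longrightarrow> ?b"
    by (rule complex_symmetric_imp_UET)
  moreover have "?b \<Longrightarrow> ?c"
    by (rule UET_imp_degree_1[OF assms])
  moreover have "?c \<Longrightarrow> ?a"
    using degree_1_imp_complex_symmetric[OF assms] by blast
  ultimately show ?thesis by blast
qed

end
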